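(* Let $f(x_1,x_2)$ be a real-valued function that is real analytic on a neighborhood of the origin in $\mathbb{R}^2$, not identically zero, with $f(0,0)=0$. Suppose that for every compact edge $e$ of the Newton polygon $N(f)$ the polynomial $f_e(x_1,x_2)$ has no zeroes on $(\mathbb{R}-\{0\})^2$. Then there is a neighborhood $U$ of the origin such that the following holds for every real number $\rho$ (including $\rho<0$) for which $|f|^{-\rho}$ is integrable on a neighborhood of the origin. Let $\phi(x_1,x_2)$ be a real-valued function on $\mathbb{R}^2$ supported in $U$ which is $C^\infty$ on $(\mathbb{R}-\{0\})^2$ and for which there are constants $A$ and $A_{a,b}$ such that on $(\mathbb{R}-\{0\})^2$ $$|\phi(x_1,x_2)|\le A,\qquad |\partial_{x_1}^a\partial_{x_2}^b\phi(x_1,x_2)|\le A_{a,b}|x_1|^{-a}|x_2|^{-b}\quad\text{for all integers } a,b\ge0,$$ and let $$F(\lambda_1,\lambda_2)=\int_{\mathbb{R}^2}\phi(x_1,x_2)\,|f(x_1,x_2)|^{-\rho}e^{-i\lambda_1x_1-i\lambda_2x_2}\,dx_1\,dx_2 .$$ Then for all $(\lambda_1,\lambda_2)\in\mathbb{R}^2$ $$|F(\lambda_1,\lambda_2)|<C(2+|\lambda_1|)^{\epsilon_1-1}(\ln(2+|\lambda_1|))^{d_1},$$ $$|F(\lambda_1,\lambda_2)|<C(2+|\lambda_2|)^{\epsilon_2-1}(\ln(2+|\lambda_2|))^{d_2},$$ where $(\epsilon_1,d_1)$ and $(\epsilon_2,d_2)$ are the growth exponents of $f$ associated to $\rho$ (see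 context). In fact, one has the stronger estimate $$|F(\lambda_1,\lambda_2)|\le C\int_{\{(x_1,x_2)\in U:\ |x_1|<|\lambda_1|^{-1},\ |x_2|<|\lambda_2|^{-1}\}}(f^*(x_1,x_2))^{-\rho}\,dx_1\,dx_2 .$$ Here $C$ denotes constants depending only on $f$, $\rho$, $U$, and the constants $A$, $A_{a,b}$.
   Context: $(\mathbb{R}-\{0\})^2=\{(x_1,x_2):x_1\ne0,\ x_2\ne0\}$. If $\lambda_i=0$, then $|\lambda_i|^{-1}$ is interpreted as $+\infty$. Newton polygon: let $f(x_1,x_2)=\sum_{a,b}f_{ab}x_1^ax_2^b$ be the Taylor expansion at the origin. For each $(a,b)$ with $f_{ab}\ne0$ let $Q_{ab}=\{(x,y)\in\mathbb{R}^2:x\ge a,\ y\ge b\}$. The Newton polygon $N(f)$ is the convex hull of the union of all such $Q_{ab}$. Its boundary consists of finitely many (possibly no) bounded edges of negative slope, an unbounded vertical ray and an unbounded horizontal ray. For a compact (bounded) edge $e$ of $N(f)$, $f_e(x_1,x_2)=\sum_{(a,b)\in e}f_{ab}x_1^ax_2^b$. The function $f^*$: $f^*(x_1,x_2)=\sum_{(v_1,v_2)\text{ a vertex of }N(f)}|x_1|^{v_1}|x_2|^{v_2}$. Growth exponents: for $\rho$ such that $(f^* )^{-\rho}$ is integrable on a neighborhood of the origin (which holds when $|f|^{-\rho}$ is integrable on a neighborhood of the origin, for $f$ as in the claim), $(\epsilon_1,d_1)$, with $\epsilon_1$ real and $d_1\in\{0,1\}$, is the unique pair such that for every $0<r_0<\frac12$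 there are positive constants $c_1,c_2$ (depending on $\rho,f,r_0$) with $$c_1r^{-\epsilon_1}|\ln r|^{d_1}\le\int_0^{r_0}(f^*(r,s))^{-\rho}\,ds\le c_2r^{-\epsilon_1}|\ln r|^{d_1}\qquad\text{for all }0<r<r_0.$$ The pair $(\epsilon_2,d_2)$ is defined in the same way with the roles of the variables interchanged, i.e. with $\int_0^{r_0}(f^*(s,r))^{-\rho}\,ds$ in place of $\int_0^{r_0}(f^*(r,s))^{-\rho}\,ds$. *)

theory Defs
  imports "HOL-Analysis.Analysis"
begin

text \<open>Unconditional summability over all exponent pairs is the usual absolute convergence of a
  double power series.\<close>
definition real_analytic_on :: "(real \<times> real \<Rightarrow> real) \<Rightarrow> (real \<times> real) set \<Rightarrow> bool" where
  "real_analytic_on f V \<longleftrightarrow>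
     (\<forall>(p, q)\<in>V. \<exists>c :: nat \<Rightarrow> nat \<Rightarrow> real. \<exists>r>0. \<forall>h k. \<bar>h\<bar> < r \<and> \<bar>k\<bar> < r \<longrightarrow>
        ((\<lambda>(a, b). c a b * h ^ a * k ^ b) has_sum f (p + h, q + k)) UNIV)"

definition partial1 :: "(real \<times> real \<Rightarrow> real) \<Rightarrow> real \<times> real \<Rightarrow> real" where
  "partial1 f = (\<lambda>(x, y). deriv (\<lambda>t. f (t, y)) x)"

definition partial2 :: "(real \<times> real \<Rightarrow> real) \<Rightarrow> real \<times> real \<Rightarrow> real" where
  "partial2 f = (\<lambda>(x, y). deriv (\<lambda>t. f (x, t)) y)"

definition partials :: "nat \<Rightarrow> nat \<Rightarrow> (real \<times> real \<Rightarrow> real) \<Rightarrow> real \<times> real \<Rightarrow> real" where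
  "partials a b f = (partial1 ^^ a) ((partial2 ^^ b) f)"

text \<open>To be used on open sets only. There \<open>deriv\<close> takes its meaningful value, because
  differentiability is demanded before the partial derivatives are inspected.\<close>
fun Ck_on :: "nat \<Rightarrow> (real \<times> real) set \<Rightarrow> (real \<times> real \<Rightarrow> real) \<Rightarrow> bool" where
  "Ck_on 0 S g \<longleftrightarrow> continuous_on S g"
| "Ck_on (Suc k) S g \<longleftrightarrow> g differentiable_on S \<and> Ck_on k S (partial1 g) \<and> Ck_on k S (partial2 g)"

definition smooth_on :: "(real \<times> real) set \<Rightarrow> (real \<times> real \<Rightarrow> real) \<Rightarrow> bool" where
  "smooth_on S g \<longleftrightarrow> (\<forall>k. Ck_on k S g)"

definition off_axes :: "(real \<times> real) set" where
  "off_axes = {(x, y). x \<noteq> 0 \<and> y \<noteq> 0}"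

definition taylor_coeff :: "(real \<times> real \<Rightarrow> real) \<Rightarrow> nat \<Rightarrow> nat \<Rightarrow> real" where
  "taylor_coeff f a b = partials a b f (0, 0) / (fact a * fact b)"

definition quadrant :: "nat \<Rightarrow> nat \<Rightarrow> (real \<times> real) set" where
  "quadrant a b = {(x, y). x \<ge> real a \<and> y \<ge> real b}"

definition newton_polygon :: "(real \<times> real \<Rightarrow> real) \<Rightarrow> (real \<times> real) set" where
  "newton_polygon f = convex hull (\<Union>(a, b)\<in>{(a, b). taylor_coeff f a b \<noteq> 0}. quadrant a b)"

text \<open>Only meaningful for compact \<open>e\<close>, where the index set is finite.\<close>
definition edge_poly :: "(real \<times> real \<Rightarrow> real) \<Rightarrow> (real \<times> real) set \<Rightarrow> real \<times> real \<Rightarrow> real" where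
  "edge_poly f e = (\<lambda>(x, y). \<Sum>(a, b) | (real a, real b) \<in> e. taylor_coeff f a b * x ^ a * y ^ b)"

text \<open>The vertices of the Newton polygon are corners of quadrants, hence lattice points with
  nonnegative coordinates; indexing by naturals allows ordinary powers, with \<open>0 ^ 0 = 1\<close>.\<close>
definition fstar :: "(real \<times> real \<Rightarrow> real) \<Rightarrow> real \<times> real \<Rightarrow> real" where
  "fstar f = (\<lambda>(x, y). \<Sum>(a, b) | (real a, real b) extreme_point_of newton_polygon f.
     \<bar>x\<bar> ^ a * \<bar>y\<bar> ^ b)"

definition is_growth_pair :: "(real \<Rightarrow> real \<Rightarrow> real) \<Rightarrow> real \<times> nat \<Rightarrow> bool" where
  "is_growth_pair h = (\<lambda>(\<epsilon>, d). d \<in> {0, 1} \<and>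
     (\<forall>r0. 0 < r0 \<and> r0 < 1 / 2 \<longrightarrow>
       (\<exists>c1>0. \<exists>c2>0. \<forall>r. 0 < r \<and> r < r0 \<longrightarrow>
          c1 * r powr (- \<epsilon>) * \<bar>ln r\<bar> ^ d \<le> (LINT s:{0..r0}|lebesgue. h r s) \<and>
          (LINT s:{0..r0}|lebesgue. h r s) \<le> c2 * r powr (- \<epsilon>) * \<bar>ln r\<bar> ^ d)))"

definition growth_pair1 :: "(real \<times> real \<Rightarrow> real) \<Rightarrow> real \<Rightarrow> real \<times> nat" where
  "growth_pair1 f \<rho> = (THE p. is_growth_pair (\<lambda>r s. fstar f (r, s) powr (- \<rho>)) p)"

definition growth_pair2 :: "(real \<times> real \<Rightarrow> real) \<Rightarrow> real \<Rightarrow> real \<times> nat" where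
  "growth_pair2 f \<rho> = (THE p. is_growth_pair (\<lambda>r s. fstar f (s, r) powr (- \<rho>)) p)"

definition integrable_near_origin :: "(real \<times> real \<Rightarrow> real) \<Rightarrow> bool" where
  "integrable_near_origin g \<longleftrightarrow> (\<exists>W. open W \<and> (0, 0) \<in> W \<and> set_integrable lebesgue W g)"

text \<open>No regularity of \<open>\<phi>\<close> is imposed on the coordinate axes.\<close>
definition admissible_amplitude ::
  "(real \<times> real) set \<Rightarrow> real \<Rightarrow> (nat \<Rightarrow> nat \<Rightarrow> real) \<Rightarrow> (real \<times> real \<Rightarrow> real) \<Rightarrow> bool" where
  "admissible_amplitude U A B \<phi> \<longleftrightarrow>
     {z. \<phi> z \<noteq> 0} \<subseteq> U \<and> smooth_on off_axes \<phi> \<and>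
     (\<forall>(x, y)\<in>off_axes. \<bar>\<phi> (x, y)\<bar> \<le> A \<and>
        (\<forall>a b. \<bar>partials a b \<phi> (x, y)\<bar> \<le> B a b * \<bar>x\<bar> powr (- real a) * \<bar>y\<bar> powr (- real b)))"

text \<open>The null set where \<open>f\<close> vanishes is irrelevant here, so the convention \<open>0 powr t = 0\<close> is
  harmless. Completed Lebesgue measure is used since \<open>\<phi>\<close> is arbitrary on the axes.\<close>
definition osc_integrand ::
  "(real \<times> real \<Rightarrow> real) \<Rightarrow> real \<Rightarrow> (real \<times> real \<Rightarrow> real) \<Rightarrow> real \<Rightarrow> real \<Rightarrow> real \<times> real \<Rightarrow> complex" where
  "osc_integrand f \<rho> \<phi> l1 l2 = (\<lambda>(x, y).
     of_real (\<phi> (x, y) * \<bar>f (x, y)\<bar> powr (- \<rho>)) *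
     exp (- \<i> * of_real (l1 * x) - \<i> * of_real (l2 * y)))"

definition osc_integral ::
  "(real \<times> real \<Rightarrow> real) \<Rightarrow> real \<Rightarrow> (real \<times> real \<Rightarrow> real) \<Rightarrow> real \<Rightarrow> real \<Rightarrow> complex" where
  "osc_integral f \<rho> \<phi> l1 l2 = (LINT z|lebesgue. osc_integrand f \<rho> \<phi> l1 l2 z)"

text \<open>The bound \<open>1 / \<bar>l\<bar>\<close> is read as infinity for \<open>l = 0\<close>.\<close>
definition dual_box :: "real \<Rightarrow> real \<Rightarrow> (real \<times> real) set" where
  "dual_box l1 l2 =
     {(x, y). (l1 = 0 \<or> \<bar>x\<bar> < 1 / \<bar>l1\<bar>) \<and> (l2 = 0 \<or> \<bar>y\<bar> < 1 / \<bar>l2\<bar>)}"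

end

theory Submission
  imports Defs
begin

text \<open>Write \<open>w = fstar f powr - \<rho>\<close>. The estimate rests on the comparison of
  \<open>f\<close> with \<open>fstar f\<close>: near the origin and off the axes,
  \<open>\<bar>f\<bar>\<close> is bounded above and below by multiples of \<open>fstar f\<close>.
  Above, every monomial of the Taylor series is at most a vertex monomial
  (\<open>monomial_le_vertex_sum\<close>), and rescaling the variables gains a geometric factor that
  makes the tail of the series summable (\<open>monomial_dominated\<close>,
  \<open>psum_le_vertex_sum\<close>). The lower bound (\<open>nondegenerate_lower_bound\<close>) is
  where the nondegeneracy of the edge polynomials enters. If it failed, there would be points
  tending to the origin along which \<open>\<bar>f\<bar>\<close> is negligible against the largest
  vertex monomial. Divided by that monomial, a subsequence of the values of \<open>f\<close>
  converges, and the limit is either the coefficient at the vertex or a positive multiple of the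
  value of an edge polynomial at a point off the axes, so it is not zero
  (\<open>rescaled_nonzero_limit\<close>).

  The Euler operators \<open>x \<partial>/\<partial>x\<close> and \<open>y
  \<partial>/\<partial>y\<close> multiply the coefficients of a power series by the exponents, so
  all iterated Euler derivatives of \<open>f\<close> are bounded by multiples of \<open>fstar
  f\<close>. Together with the lower bound and the product rule this shows that the iterated Euler
  derivatives of \<open>\<phi> * \<bar>f\<bar> powr - \<rho>\<close> are bounded by multiples of
  \<open>w\<close> (\<open>symb_psum\<close>, \<open>symb_abs_powr\<close>,
  \<open>symb_amplitude\<close>, \<open>symb_mult\<close>). From here on only the support of
  \<open>\<phi>\<close> and the integrability of \<open>w\<close> are used besides these bounds.

  In one variable, a function whose Euler derivatives are bounded by a positive weight of at most
  polynomial variation has an oscillatory integral bounded by the integral of the weight over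
  \<open>x < 1 / \<bar>l\<bar>\<close>: there the integrand is bounded by absolute values, and
  beyond that point each integration by parts gains a factor \<open>1 / (\<bar>l\<bar> * x)\<close>
  (\<open>oscillatory_tail_bound\<close>, \<open>oscillatory_bound_1d\<close>). In two variables,
  the Fourier integral over \<open>x\<close> alone is, as a function of \<open>y\<close>, again of
  this kind, with the weight integrated over \<open>x < 1 / \<bar>l1\<bar>\<close>, so that the
  one-dimensional bound applies a second time (\<open>ptrans_sym1\<close>,
  \<open>oscillatory_bound_2d\<close>). Reflections carry the other three quadrants to the first.
  This is the estimate by the integral of \<open>w\<close> over the dual box.

  The other two estimates follow by dropping the restriction on one of the variables. What remains
  is the integral over \<open>r < 1 / \<bar>l\<bar>\<close> of the function that the growth
  exponents describe (\<open>cutoff_integral_bound\<close>). These exponents are given by a definite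
  description, so their existence and uniqueness have to be shown. For \<open>\<rho> > 0\<close> and
  \<open>s = r powr u\<close>, the integrand times \<open>s\<close> is comparable to a power of
  \<open>r\<close> whose exponent is a maximum of affine functions of \<open>u\<close>. The integral
  is governed by the minimum of that maximum: it has no logarithm if the minimum is attained at one
  point, and one logarithm if it is attained on an interval (\<open>max_affine_minimum\<close>,
  \<open>growth_two_sided_pos\<close>).

  If all Taylor coefficients vanish, \<open>f\<close> vanishes near the origin and every integral is
  zero.\<close>

section \<open>Double power series\<close>

definition psum :: "(nat \<Rightarrow> nat \<Rightarrow> real) \<Rightarrow> real \<times> real \<Rightarrow> real" where
  "psum c = (\<lambda>(x, y). \<Sum>\<^sub>\<infinity>(a, b)\<in>UNIV. c a b * x ^ a * y ^ b)"

text \<open>Absolute convergence on the open square of half-width \<open>r\<close>: convergence for all points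
  of the square, rather than at one positive point, is preserved by differentiation.\<close>
definition pconv :: "(nat \<Rightarrow> nat \<Rightarrow> real) \<Rightarrow> real \<Rightarrow> bool" where
  "pconv c r \<longleftrightarrow> (\<forall>x y. \<bar>x\<bar> < r \<longrightarrow> \<bar>y\<bar> < r \<longrightarrow> (\<lambda>(a, b). c a b * x ^ a * y ^ b) summable_on UNIV)"

definition pdiff1 :: "(nat \<Rightarrow> nat \<Rightarrow> real) \<Rightarrow> nat \<Rightarrow> nat \<Rightarrow> real" where
  "pdiff1 c a b = real (Suc a) * c (Suc a) b"

definition pdiff2 :: "(nat \<Rightarrow> nat \<Rightarrow> real) \<Rightarrow> nat \<Rightarrow> nat \<Rightarrow> real" where
  "pdiff2 c a b = real (Suc b) * c a (Suc b)"

text \<open>Exchanging the roles of the variables transfers every statement about the first variable to the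
  second.\<close>
definition pswap :: "(nat \<Rightarrow> nat \<Rightarrow> real) \<Rightarrow> nat \<Rightarrow> nat \<Rightarrow> real" where
  "pswap c a b = c b a"

lemma psum_pswap: "psum (pswap c) (y, x) = psum c (x, y)"
  unfolding psum_def pswap_def
  by (simp, rule infsum_reindex_bij_witness[where i = prod.swap and j = prod.swap]) (auto simp: mult_ac)

lemma pconv_pswap: "pconv (pswap c) r = pconv c r"
proof -
  have "pconv (pswap c) r" if "pconv c r" for c
    unfolding pconv_def
  proof (intro allI impI)
    fix x y :: real assume "\<bar>x\<bar> < r" "\<bar>y\<bar> < r"
    then have "(\<lambda>(a, b). c a b * y ^ a * x ^ b) summable_on UNIV"
      using that by (auto simp: pconv_def)
    then show "(\<lambda>(a, b). pswap c a b * x ^ a * y ^ b) summable_on UNIV"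
      by (subst summable_on_reindex_bij_witness[where i = prod.swap and j = prod.swap
            and T = UNIV and h = "\<lambda>(a, b). c a b * y ^ a * x ^ b"]) (auto simp: pswap_def mult_ac)
  qed
  from this[of c] this[of "pswap c"] show ?thesis by (auto simp: pswap_def[abs_def])
qed

lemma pdiff2_pswap: "pdiff2 c = pswap (pdiff1 (pswap c))"
  by (auto simp: pdiff1_def pdiff2_def pswap_def fun_eq_iff)

text \<open>The factor \<open>Suc a\<close> from differentiation is absorbed by moving to a point
  \<open>t\<close> strictly between \<open>\<bar>x\<bar>\<close> and \<open>r\<close>, because
  \<open>Suc a * (\<bar>x\<bar> / t) ^ a\<close> is bounded.\<close>
lemma pconv_pdiff1:
  assumes "pconv c r"
  shows "pconv (pdiff1 c) r"
  unfolding pconv_def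
proof (intro allI impI)
  fix x y :: real assume xy: "\<bar>x\<bar> < r" "\<bar>y\<bar> < r"
  then obtain t where t: "\<bar>x\<bar> < t" "t < r" using dense by blast
  have t0: "t > 0" using t by linarith
  have "(\<lambda>(a, b). c a b * t ^ a * y ^ b) summable_on UNIV"
    using assms t xy t0 unfolding pconv_def by auto
  then have "(\<lambda>(a, b). c a b * t ^ a * y ^ b) summable_on (\<lambda>(a, b). (Suc a, b)) ` UNIV"
    by (rule summable_on_subset_banach) auto
  then have S: "(\<lambda>(a, b). c (Suc a) b * t ^ Suc a * y ^ b) summable_on UNIV"
    by (subst (asm) summable_on_reindex) (auto simp: inj_on_def o_def case_prod_unfold)
  have "(\<lambda>n. of_nat (Suc n) * (\<bar>x\<bar> / t) ^ n) \<longlonglongrightarrow> 0"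
  proof -
    have "(\<lambda>n. real n * (\<bar>x\<bar> / t) ^ n) \<longlonglongrightarrow> 0"
      using t t0 by (intro powser_times_n_limit_0) auto
    moreover have "(\<lambda>n. (\<bar>x\<bar> / t) ^ n) \<longlonglongrightarrow> 0"
      using t t0 by (intro LIMSEQ_realpow_zero) auto
    ultimately show ?thesis
      using tendsto_add[of "\<lambda>n. real n * (\<bar>x\<bar> / t) ^ n" 0 sequentially "\<lambda>n. (\<bar>x\<bar> / t) ^ n" 0]
      by (simp add: distrib_right add.commute)
  qed
  then have "Bseq (\<lambda>n. of_nat (Suc n) * (\<bar>x\<bar> / t) ^ n)"
    by (intro convergent_imp_Bseq convergentI)
  then obtain M where M: "\<And>n. \<bar>of_nat (Suc n) * (\<bar>x\<bar> / t) ^ n\<bar> \<le> M"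
    unfolding Bseq_def real_norm_def by blast
  have S': "(\<lambda>p. (M / t) * norm (case p of (a, b) \<Rightarrow> c (Suc a) b * t ^ Suc a * y ^ b)) summable_on UNIV"
    by (intro summable_on_cmult_right) (rule iffD1[OF summable_on_iff_abs_summable_on_real S])
  show "(\<lambda>(a, b). pdiff1 c a b * x ^ a * y ^ b) summable_on UNIV"
  proof (rule abs_summable_summable, rule summable_on_comparison_test[OF S'])
    fix p :: "nat \<times> nat" 
    obtain a b where p: "p = (a, b)" by (cases p)
    have "\<bar>real (Suc a) * \<bar>x\<bar> ^ a\<bar> \<le> M * t ^ a"
      using M[of a] t0 by (simp add: power_divide field_simps)
    then have "\<bar>real (Suc a) * \<bar>x\<bar> ^ a\<bar> * (\<bar>c (Suc a) b\<bar> * \<bar>y\<bar> ^ b) \<le> M * t ^ a * (\<bar>c (Suc a) b\<bar> * \<bar>y\<bar> ^ b)"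
      by (intro mult_right_mono) auto
    then show "norm (case p of (a, b) \<Rightarrow> pdiff1 c a b * x ^ a * y ^ b)
       \<le> (M / t) * norm (case p of (a, b) \<Rightarrow> c (Suc a) b * t ^ Suc a * y ^ b)"
      using t0 by (simp add: p pdiff1_def abs_mult power_abs mult_ac)
  qed auto
qed

text \<open>For fixed \<open>y\<close> the double series is an ordinary power series in \<open>x\<close>,
  which makes termwise differentiation of ordinary power series applicable.\<close>
lemma psum_iterated:
  assumes "pconv c r" "\<bar>x\<bar> < r" "\<bar>y\<bar> < r"
  shows "(\<lambda>a. (\<Sum>\<^sub>\<infinity>b\<in>UNIV. c a b * y ^ b) * x ^ a) sums psum c (x, y)"
proof -
  have S: "(\<lambda>(a, b). c a b * x ^ a * y ^ b) summable_on (Sigma UNIV (\<lambda>_. UNIV))"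
    using assms by (auto simp: pconv_def)
  have eq: "(\<Sum>\<^sub>\<infinity>b\<in>UNIV. c a b * x ^ a * y ^ b) = (\<Sum>\<^sub>\<infinity>b\<in>UNIV. c a b * y ^ b) * x ^ a" for a
    by (subst infsum_cmult_left'[symmetric]) (simp add: mult_ac)
  have "(\<lambda>a. \<Sum>\<^sub>\<infinity>b\<in>UNIV. c a b * x ^ a * y ^ b) summable_on UNIV"
    using summable_on_Sigma_banach[OF S] by simp
  moreover have "infsum (\<lambda>a. \<Sum>\<^sub>\<infinity>b\<in>UNIV. c a b * x ^ a * y ^ b) UNIV = psum c (x, y)"
    using infsum_Sigma'_banach[OF S] by (simp add: psum_def)
  ultimately have "((\<lambda>a. \<Sum>\<^sub>\<infinity>b\<in>UNIV. c a b * x ^ a * y ^ b) has_sum psum c (x, y)) UNIV"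
    by (simp add: has_sum_iff)
  then show ?thesis unfolding eq by (rule has_sum_imp_sums)
qed

lemma eventually_abs_less:
  fixes x r :: real
  assumes "\<bar>x\<bar> < r"
  shows "\<forall>\<^sub>F t in nhds x. \<bar>t\<bar> < r"
  by (rule eventually_nhds_in_open[of "{-r<..<r}" x, THEN eventually_mono]) (use assms in auto)

lemma psum_deriv1:
  assumes "pconv c r" "\<bar>x\<bar> < r" "\<bar>y\<bar> < r"
  shows "((\<lambda>t. psum c (t, y)) has_real_derivative psum (pdiff1 c) (x, y)) (at x)"
proof -
  let ?A = "\<lambda>a. \<Sum>\<^sub>\<infinity>b\<in>UNIV. c a b * y ^ b"
  have *: "(\<lambda>a. ?A a * t ^ a) sums psum c (t, y)" if "norm t < r" for t
    using psum_iterated[OF assms(1) _ assms(3)] that by simp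
  have D: "((\<lambda>t. \<Sum>a. ?A a * t ^ a) has_real_derivative (\<Sum>n. diffs ?A n * x ^ n)) (at x)"
    by (rule termdiffs_strong'[where K = r]) (use assms(2) * in \<open>auto simp: sums_iff\<close>)
  have "\<forall>\<^sub>F t in nhds x. \<bar>t\<bar> < r"
    by (rule eventually_abs_less) (use assms(2) in auto)
  then have "\<forall>\<^sub>F t in nhds x. (\<Sum>a. ?A a * t ^ a) = psum c (t, y)"
    by eventually_elim (use * in \<open>auto simp: sums_iff\<close>)
  with D have "((\<lambda>t. psum c (t, y)) has_real_derivative (\<Sum>n. diffs ?A n * x ^ n)) (at x)"
    by (subst (asm) DERIV_cong_ev[OF refl _ refl])
  moreover have "(\<lambda>n. diffs ?A n * x ^ n) sums psum (pdiff1 c) (x, y)"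
    using psum_iterated[OF pconv_pdiff1[OF assms(1)] assms(2,3)]
    by (simp add: diffs_def pdiff1_def mult.assoc infsum_cmult_right' del: of_nat_Suc)
  ultimately show ?thesis by (simp add: sums_iff)
qed

lemma pconv_pdiff2: "pconv c r \<Longrightarrow> pconv (pdiff2 c) r"
  by (simp add: pdiff2_pswap pconv_pswap pconv_pdiff1)

lemma psum_deriv2:
  assumes "pconv c r" "\<bar>x\<bar> < r" "\<bar>y\<bar> < r"
  shows "((\<lambda>t. psum c (x, t)) has_real_derivative psum (pdiff2 c) (x, y)) (at y)"
  using psum_deriv1[of "pswap c" r y x] assms
  by (simp add: pdiff2_pswap pconv_pswap psum_pswap)

lemma partial1_apply: "partial1 f (x, y) = deriv (\<lambda>t. f (t, y)) x"
  by (simp add: partial1_def)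

lemma partial2_apply: "partial2 f (x, y) = deriv (\<lambda>t. f (x, t)) y"
  by (simp add: partial2_def)

lemma partials_psum:
  assumes "pconv c r" "\<And>x y. \<bar>x\<bar> < r \<Longrightarrow> \<bar>y\<bar> < r \<Longrightarrow> f (x, y) = psum c (x, y)"
    and "\<bar>x\<bar> < r" "\<bar>y\<bar> < r"
  shows "partials a b f (x, y) = psum ((pdiff1 ^^ a) ((pdiff2 ^^ b) c)) (x, y)"
proof -
  have c2: "pconv ((pdiff2 ^^ b) c) r" for b
    by (induction b) (auto intro: assms(1) pconv_pdiff2)
  have c1: "pconv ((pdiff1 ^^ a) ((pdiff2 ^^ b) c)) r" for a b
    by (induction a) (auto intro: c2 pconv_pdiff1)
  have ev: "\<forall>\<^sub>F t in nhds x. \<bar>t\<bar> < r" if "\<bar>x\<bar> < r" for x :: real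
    by (rule eventually_abs_less) (use that in auto)
  have 2: "(partial2 ^^ b) f (x, y) = psum ((pdiff2 ^^ b) c) (x, y)" if "\<bar>x\<bar> < r" "\<bar>y\<bar> < r" for b x y
    using that
  proof (induction b arbitrary: x y)
    case (Suc b)
    have "deriv (\<lambda>t. (partial2 ^^ b) f (x, t)) y = deriv (\<lambda>t. psum ((pdiff2 ^^ b) c) (x, t)) y"
      by (rule deriv_cong_ev, rule eventually_mono[OF ev[OF Suc.prems(2)]]) (auto simp: Suc)
    also have "\<dots> = psum (pdiff2 ((pdiff2 ^^ b) c)) (x, y)"
      by (rule DERIV_imp_deriv, rule psum_deriv2[OF c2 Suc.prems])
    finally show ?case by (simp add: partial2_apply)
  qed (use assms in auto)
  show ?thesis using assms(3,4) unfolding partials_def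
  proof (induction a arbitrary: x y)
    case (Suc a)
    have "deriv (\<lambda>t. (partial1 ^^ a) ((partial2 ^^ b) f) (t, y)) x
        = deriv (\<lambda>t. psum ((pdiff1 ^^ a) ((pdiff2 ^^ b) c)) (t, y)) x"
      by (rule deriv_cong_ev, rule eventually_mono[OF ev[OF Suc.prems(1)]]) (auto simp: Suc)
    also have "\<dots> = psum (pdiff1 ((pdiff1 ^^ a) ((pdiff2 ^^ b) c))) (x, y)"
      by (rule DERIV_imp_deriv, rule psum_deriv1[OF c1 Suc.prems])
    finally show ?case by (simp add: partial1_apply)
  qed (use 2 in auto)
qed

lemma psum_0_0: "psum c (0, 0) = c 0 0"
proof -
  have "psum c (0, 0) = (\<Sum>\<^sub>\<infinity>(a, b)\<in>{(0, 0)}. c a b * 0 ^ a * 0 ^ b)"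
    unfolding psum_def by (simp del: infsum_finite, rule infsum_cong_neutral) (auto simp: power_0_left split: if_splits)
  then show ?thesis by simp
qed

text \<open>Differentiation multiplies the coefficients by factors that build up the factorials, so the Taylor
  coefficients are the coefficients of any double power series that represents the function, and the
  Newton polygon can be read off that series.\<close>
lemma taylor_coeff_psum:
  assumes "pconv c r" "r > 0" "\<And>x y. \<bar>x\<bar> < r \<Longrightarrow> \<bar>y\<bar> < r \<Longrightarrow> f (x, y) = psum c (x, y)"
  shows "taylor_coeff f a b = c a b"
proof -
  have 2: "(pdiff2 ^^ b) c i j * fact j = fact (j + b) * c i (j + b)" for i j
  proof (induction b arbitrary: j)
    case (Suc b)
    then show ?case using Suc[of "Suc j"] by (simp add: pdiff2_def mult_ac)
  qed simp
  have 1: "(pdiff1 ^^ a) c i j * fact i = fact (i + a) * c (i + a) j" for i j and c :: "nat \<Rightarrow> nat \<Rightarrow> real"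
  proof (induction a arbitrary: i)
    case (Suc a)
    then show ?case using Suc[of "Suc i"] by (simp add: pdiff1_def mult_ac)
  qed simp
  have "partials a b f (0, 0) = fact a * (fact b * c a b)"
    using partials_psum[of c r f 0 0 a b] assms 1[of "(pdiff2 ^^ b) c" 0 0] 2[of a 0] 
    by (simp add: psum_0_0)
  then show ?thesis by (simp add: taylor_coeff_def)
qed

section \<open>Vertices of the Newton polygon\<close>

text \<open>The Newton polygon for an arbitrary set \<open>S\<close> of exponents, which may be empty or
  infinite.\<close>
definition hull_quadrants :: "(nat \<times> nat) set \<Rightarrow> (real \<times> real) set" where
  "hull_quadrants S = convex hull (\<Union>(a, b)\<in>S. quadrant a b)"

definition vertices :: "(nat \<times> nat) set \<Rightarrow> (nat \<times> nat) set" where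
  "vertices S = {(a, b). (real a, real b) extreme_point_of hull_quadrants S}"

definition vertex_sum :: "(nat \<times> nat) set \<Rightarrow> real \<times> real \<Rightarrow> real" where
  "vertex_sum S = (\<lambda>(x, y). \<Sum>(a, b)\<in>vertices S. \<bar>x\<bar> ^ a * \<bar>y\<bar> ^ b)"

lemma convex_hull_quadrants: "convex (hull_quadrants S)"
  by (simp add: hull_quadrants_def convex_convex_hull)

lemma quadrant_subset_hull: "(a, b) \<in> S \<Longrightarrow> quadrant a b \<subseteq> hull_quadrants S"
  unfolding hull_quadrants_def by (rule order_trans[OF _ hull_subset]) auto

text \<open>A vertex \<open>(a, b)\<close> of the hull that dominates another exponent \<open>p\<close> would
  be the midpoint of \<open>p\<close> and of the reflection of \<open>p\<close> in \<open>(a,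
  b)\<close>, and both lie in the quadrant with corner \<open>p\<close>.\<close>
lemma vertex_minimal:
  assumes v: "(a, b) \<in> vertices S" and p: "(i, j) \<in> S" "i \<le> a" "j \<le> b"
  shows "(i, j) = (a, b)"
proof (rule ccontr)
  assume neq: "(i, j) \<noteq> (a, b)"
  let ?p = "(real i, real j)" and ?q = "(2 * real a - real i, 2 * real b - real j)"
  have "?p \<in> hull_quadrants S" "?q \<in> hull_quadrants S"
    using quadrant_subset_hull[OF p(1)] p(2,3) by (auto simp: quadrant_def subset_iff)
  moreover have "midpoint ?p ?q = (real a, real b)"
    by (simp add: midpoint_def)
  moreover have "midpoint ?p ?q \<in> open_segment ?p ?q"
    using neq p by (auto simp: midpoint_in_open_segment)
  ultimately show False
    using v by (auto simp: vertices_def extreme_point_of_def)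
qed

lemma vertices_subset: "vertices S \<subseteq> S"
proof
  fix v assume v: "v \<in> vertices S"
  obtain a b where ab: "v = (a, b)" by (cases v)
  have "(real a, real b) \<in> (\<Union>(a, b)\<in>S. quadrant a b)"
    by (rule extreme_point_of_convex_hull)
       (use v in \<open>simp add: ab vertices_def hull_quadrants_def\<close>)
  then obtain i j where "(i, j) \<in> S" "i \<le> a" "j \<le> b"
    by (auto simp: quadrant_def)
  then show "v \<in> S"
    using vertex_minimal v ab by metis
qed

text \<open>No vertex dominates another, so vertices are determined by either coordinate. Given one vertex
  \<open>(a0, b0)\<close>, every other has its first coordinate at most \<open>a0\<close> or its
  second at most \<open>b0\<close>.\<close>
lemma finite_vertices: "finite (vertices S)"
proof (cases "vertices S = {}")
  case False
  then obtain a0 b0 where v: "(a0, b0) \<in> vertices S" by auto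
  have anti: "(a, b) \<in> vertices S \<Longrightarrow> (i, j) \<in> vertices S \<Longrightarrow> i \<le> a \<Longrightarrow> j \<le> b \<Longrightarrow> (i, j) = (a, b)"
    for a b i j using vertex_minimal vertices_subset by blast
  let ?L = "{v \<in> vertices S. fst v \<le> a0}" and ?R = "{v \<in> vertices S. snd v \<le> b0}"
  have "finite ?L"
  proof (rule inj_on_finite[of fst _ "{..a0}"])
    show "inj_on fst ?L"
      by (auto simp: inj_on_def) (metis anti nle_le order_refl prod.inject)
  qed auto
  moreover have "finite ?R"
  proof (rule inj_on_finite[of snd _ "{..b0}"])
    show "inj_on snd ?R"
      by (auto simp: inj_on_def) (metis anti nle_le order_refl prod.inject)
  qed auto
  moreover have "vertices S \<subseteq> ?L \<union> ?R"
  proof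
    fix v' assume v': "v' \<in> vertices S"
    obtain a b where ab: "v' = (a, b)" by (cases v')
    show "v' \<in> ?L \<union> ?R"
      using anti[of a b a0 b0] v v' ab by (cases "a0 \<le> a"; cases "b0 \<le> b") auto
  qed
  ultimately show ?thesis by (meson finite_UnI finite_subset)
qed simp

text \<open>Locates the hull with respect to a supporting line: it lies strictly above the line except for a
  convex piece \<open>F\<close> of the line that contains all the exponents on it. The reason is
  that the open half-plane together with such an \<open>F\<close> is convex. The cases of interest
  are \<open>F\<close> the whole line, \<open>F\<close> a closed half-line (to recognise a vertex)
  and \<open>F\<close> the convex hull of finitely many points (to show that an edge is compact).\<close>
lemma hull_subset_face:
  assumes pos: "\<alpha> > 0" "\<beta> > 0"
    and le: "\<And>i j. (i, j) \<in> S \<Longrightarrow> m \<le> \<alpha> * real i + \<beta> * real j"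
    and corners: "\<And>i j. (i, j) \<in> S \<Longrightarrow> \<alpha> * real i + \<beta> * real j = m \<Longrightarrow> (real i, real j) \<in> F"
    and F: "convex F" "F \<subseteq> {(x, y). \<alpha> * x + \<beta> * y = m}"
  shows "hull_quadrants S \<subseteq> {(x, y). \<alpha> * x + \<beta> * y > m} \<union> F"
  unfolding hull_quadrants_def
proof (rule hull_minimal)
  show "(\<Union>(a, b)\<in>S. quadrant a b) \<subseteq> {(x, y). \<alpha> * x + \<beta> * y > m} \<union> F"
  proof clarify
    fix i j x y
    assume p: "(i, j) \<in> S" and q: "(x, y) \<in> quadrant i j" and n: "(x, y) \<notin> F"
    have xy: "x \<ge> real i" "y \<ge> real j" using q by (auto simp: quadrant_def)
    then have ge: "\<alpha> * x \<ge> \<alpha> * real i" "\<beta> * y \<ge> \<beta> * real j" using pos by auto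
    show "\<alpha> * x + \<beta> * y > m"
    proof (rule ccontr)
      assume "\<not> \<alpha> * x + \<beta> * y > m"
      with ge le[OF p] have "\<alpha> * x = \<alpha> * real i" "\<beta> * y = \<beta> * real j" "\<alpha> * real i + \<beta> * real j = m"
        by linarith+
      then show False using corners[OF p] n pos by simp
    qed
  qed
  show "convex ({(x, y). \<alpha> * x + \<beta> * y > m} \<union> F)"
    unfolding convex_def
  proof (intro ballI allI impI)
    fix z z' u v
    assume z: "z \<in> {(x, y). \<alpha> * x + \<beta> * y > m} \<union> F" and z': "z' \<in> {(x, y). \<alpha> * x + \<beta> * y > m} \<union> F"
      and uv: "0 \<le> (u::real)" "0 \<le> v" "u + v = 1"
    obtain x y x' y' where xy: "z = (x, y)" "z' = (x', y')" by (cases z, cases z')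
    let ?l = "\<alpha> * x + \<beta> * y" and ?l' = "\<alpha> * x' + \<beta> * y'"
    have ge: "?l \<ge> m" "?l' \<ge> m" using z z' F(2) xy by auto
    have eq: "\<alpha> * (u * x + v * x') + \<beta> * (u * y + v * y') - m = u * (?l - m) + v * (?l' - m)"
    proof -
      have "m = (u + v) * m" using uv by simp
      then show ?thesis by (simp add: algebra_simps)
    qed
    consider "z \<in> F" "z' \<in> F" | "u * (?l - m) > 0" | "v * (?l' - m) > 0" | "u = 0" "z' \<in> F" | "v = 0" "z \<in> F"
      using z z' uv ge unfolding xy by (cases "u = 0"; cases "v = 0") (auto simp: zero_less_mult_iff)
    then show "u *\<^sub>R z + v *\<^sub>R z' \<in> {(x, y). \<alpha> * x + \<beta> * y > m} \<union> F"
    proof cases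
      case 1
      then show ?thesis using F(1) uv unfolding convex_def by blast
    next
      case 2
      moreover have "v * (?l' - m) \<ge> 0" using uv ge by simp
      ultimately show ?thesis using eq by (auto simp: xy)
    next
      case 3
      moreover have "u * (?l - m) \<ge> 0" using uv ge by simp
      ultimately show ?thesis using eq by (auto simp: xy)
    qed (use uv in auto)
  qed
qed

lemma hull_subset_halfplane:
  assumes "\<alpha> > 0" "\<beta> > 0" "\<And>i j. (i, j) \<in> S \<Longrightarrow> m \<le> \<alpha> * real i + \<beta> * real j"
    and "(x, y) \<in> hull_quadrants S"
  shows "m \<le> \<alpha> * x + \<beta> * y"
proof -
  have "{(x, y). \<alpha> * x + \<beta> * y = m} = {z. (\<alpha>, \<beta>) \<bullet> z = m}"
    by (auto simp: inner_Pair)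
  then have "convex {(x, y). \<alpha> * x + \<beta> * y = m}"
    by (simp add: convex_hyperplane)
  then have "hull_quadrants S \<subseteq> {(x, y). \<alpha> * x + \<beta> * y > m} \<union> {(x, y). \<alpha> * x + \<beta> * y = m}"
    by (intro hull_subset_face) (use assms in auto)
  then show ?thesis using assms(4) by auto
qed

text \<open>A linear form with positive coefficients attains its minimum over the exponents at a vertex. Among
  the minimisers, the one with the least first coordinate is extreme: the minimisers in the hull lie
  on a half-line of which it is the end point.\<close>
lemma exists_minimising_vertex:
  assumes "s > 0" "t > 0" "S \<noteq> {}"
  obtains a b where "(a, b) \<in> vertices S"
    and "\<And>i j. (i, j) \<in> S \<Longrightarrow> s * real a + t * real b \<le> s * real i + t * real j"
proof -
  let ?l = "\<lambda>(i, j). s * real i + t * real j"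
  obtain p0 where p0: "p0 \<in> S" using assms by auto
  \<comment> \<open>Only finitely many exponents compete with a given one, as both coefficients are
    positive.\<close>
  let ?T = "{p \<in> S. ?l p \<le> ?l p0}"
  have "?T \<subseteq> {..nat \<lceil>?l p0 / s\<rceil>} \<times> {..nat \<lceil>?l p0 / t\<rceil>}"
  proof
    fix p assume p: "p \<in> ?T"
    obtain i j where ij: "p = (i, j)" by (cases p)
    define l0 where "l0 = ?l p0"
    have le: "s * real i + t * real j \<le> l0" using p ij by (simp add: l0_def)
    have "s * real i \<ge> 0" "t * real j \<ge> 0" using assms by auto
    then have "s * real i \<le> l0" "t * real j \<le> l0" using le by linarith+
    then have "real i \<le> l0 / s" "real j \<le> l0 / t"
      using assms by (auto simp: pos_le_divide_eq mult.commute)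
    then show "p \<in> {..nat \<lceil>?l p0 / s\<rceil>} \<times> {..nat \<lceil>?l p0 / t\<rceil>}"
      by (simp add: ij l0_def[symmetric]) linarith
  qed
  then have fin: "finite ?T" by (rule finite_subset) auto
  define m where "m = Min (?l ` ?T)"
  have m_le: "m \<le> ?l p" if "p \<in> S" for p
  proof (cases "?l p \<le> ?l p0")
    case True
    then show ?thesis unfolding m_def using that fin by (intro Min_le) auto
  next
    case False
    moreover have "m \<le> ?l p0" unfolding m_def using p0 fin by (intro Min_le) auto
    ultimately show ?thesis by linarith
  qed
  have "p0 \<in> ?T" using p0 by simp
  then have "m \<in> ?l ` ?T" unfolding m_def using fin by (intro Min_in finite_imageI) blast+
  then have ex: "\<exists>a b. (a, b) \<in> S \<and> ?l (a, b) = m" by auto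
  define a where "a = (LEAST a. \<exists>b. (a, b) \<in> S \<and> ?l (a, b) = m)"
  obtain b where b: "(a, b) \<in> S" "?l (a, b) = m"
    using LeastI_ex[OF ex] unfolding a_def by auto
  have a_le: "a \<le> i" if "(i, j) \<in> S" "?l (i, j) = m" for i j
    unfolding a_def by (rule Least_le) (use that in auto)
  let ?F = "{(x, y). s * x + t * y = m \<and> real a \<le> x}"
  have "?F = {z. (s, t) \<bullet> z = m} \<inter> {z. (1, 0) \<bullet> z \<ge> real a}"
    by (auto simp: inner_Pair)
  then have "convex ?F"
    using convex_hyperplane[of "(s, t)" m] convex_halfspace_ge[of "real a" "(1::real, 0::real)"]
    by (simp add: convex_Int)
  then have H: "hull_quadrants S \<subseteq> {(x, y). s * x + t * y > m} \<union> ?F"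
    by (rule hull_subset_face[OF assms(1,2), rotated 2]) (use m_le a_le in fastforce)+
  have "(real a, real b) extreme_point_of hull_quadrants S"
    unfolding extreme_point_of_def
  proof (intro conjI ballI notI)
    show "(real a, real b) \<in> hull_quadrants S"
      using quadrant_subset_hull[OF b(1)] by (auto simp: quadrant_def)
    fix z z' assume z: "z \<in> hull_quadrants S" "z' \<in> hull_quadrants S"
      and "(real a, real b) \<in> open_segment z z'"
    then obtain u where u: "0 < u" "u < 1" "z \<noteq> z'" "(real a, real b) = (1 - u) *\<^sub>R z + u *\<^sub>R z'"
      by (auto simp: in_segment)
    obtain x y x' y' where xy: "z = (x, y)" "z' = (x', y')" by (cases z, cases z')
    have A: "real a = (1 - u) * x + u * x'" "real b = (1 - u) * y + u * y'"
      using u(4) by (auto simp: xy)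
    have zz: "s * x + t * y > m \<or> s * x + t * y = m \<and> x \<ge> real a"
         "s * x' + t * y' > m \<or> s * x' + t * y' = m \<and> x' \<ge> real a"
      using H z by (auto simp: xy)
    have "(1 - u) * (s * x + t * y - m) + u * (s * x' + t * y' - m) = s * real a + t * real b - m"
      unfolding A by (simp add: algebra_simps)
    also have "\<dots> = 0" using b by simp
    finally have E: "(1 - u) * (s * x + t * y - m) + u * (s * x' + t * y' - m) = 0" .
    \<comment> \<open>A convex combination of nonnegative terms vanishes, so both end points lie on the
      supporting line.\<close>
    have "(1 - u) * (s * x + t * y - m) \<ge> 0" "u * (s * x' + t * y' - m) \<ge> 0"
      using zz u by auto
    then have "(1 - u) * (s * x + t * y - m) = 0" "u * (s * x' + t * y' - m) = 0"
      using E by linarith+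
    then have M: "s * x + t * y = m" "s * x' + t * y' = m" using u by auto
    then have X: "x \<ge> real a" "x' \<ge> real a" using zz by auto
    \<comment> \<open>The same argument along the line shows that both end points have first coordinate
      \<open>a\<close>.\<close>
    have "(1 - u) * (x - real a) + u * (x' - real a) = 0"
      using A(1) by (simp add: algebra_simps)
    moreover have "(1 - u) * (x - real a) \<ge> 0" "u * (x' - real a) \<ge> 0" using X u by auto
    ultimately have "(1 - u) * (x - real a) = 0" "u * (x' - real a) = 0" by linarith+
    then have "x = x'" using u by auto
    then have "y = y'" using M assms by auto
    then show False using u(3) xy \<open>x = x'\<close> by simp
  qed
  then have "(a, b) \<in> vertices S" by (simp add: vertices_def)
  then show thesis using that m_le b by fastforce
qed

lemma monomial_exp: "exp (- s) ^ a * exp (- t) ^ b = exp (- (s * real a + t * real b))"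
  for s t :: real
  by (simp add: exp_of_nat_mult[symmetric] exp_add[symmetric] mult.commute)

lemma vertex_sum_nonneg: "vertex_sum S z \<ge> 0"
  by (auto simp: vertex_sum_def split: prod.split intro!: sum_nonneg)

text \<open>In logarithmic coordinates a monomial is the exponential of minus a linear form with positive
  coefficients evaluated at the exponent, so the largest monomial belongs to a vertex.\<close>
lemma monomial_le_vertex_sum:
  assumes "(i, j) \<in> S" "0 < \<bar>x\<bar>" "\<bar>x\<bar> < 1" "0 < \<bar>y\<bar>" "\<bar>y\<bar> < 1"
  shows "\<bar>x\<bar> ^ i * \<bar>y\<bar> ^ j \<le> vertex_sum S (x, y)"
proof -
  define s t where "s = - ln \<bar>x\<bar>" and "t = - ln \<bar>y\<bar>"
  have st: "s > 0" "t > 0" "\<bar>x\<bar> = exp (- s)" "\<bar>y\<bar> = exp (- t)"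
    using assms by (auto simp: s_def t_def ln_less_zero)
  obtain a b where ab: "(a, b) \<in> vertices S"
    "s * real a + t * real b \<le> s * real i + t * real j"
    using exists_minimising_vertex[OF st(1,2), of S] assms(1) by (metis empty_iff)
  have "\<bar>x\<bar> ^ i * \<bar>y\<bar> ^ j \<le> \<bar>x\<bar> ^ a * \<bar>y\<bar> ^ b"
    unfolding st(3,4) monomial_exp using ab by simp
  also have "\<dots> = (\<lambda>(a, b). \<bar>x\<bar> ^ a * \<bar>y\<bar> ^ b) (a, b)" by simp
  also have "\<dots> \<le> vertex_sum S (x, y)"
    unfolding vertex_sum_def prod.case[where f = "\<lambda>x y. \<Sum>(a, b)\<in>vertices S. \<bar>x\<bar> ^ a * \<bar>y\<bar> ^ b"]
    by (rule member_le_sum[OF ab(1)]) (auto simp: finite_vertices)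
  finally show ?thesis .
qed

lemma vertex_degree_bound:
  obtains D where "\<And>a b. (a, b) \<in> vertices S \<Longrightarrow> a + b \<le> D"
proof -
  have "finite ((\<lambda>(a, b). a + b) ` vertices S)" using finite_vertices by blast
  then obtain D where "\<forall>n \<in> (\<lambda>(a, b). a + b) ` vertices S. n \<le> D"
    using finite_nat_set_iff_bounded_le by blast
  then show thesis using that by force
qed

text \<open>The geometric gain \<open>\<delta> ^ (i + j)\<close> turns the termwise bound into a summable one.
  It comes from the previous bound at the rescaled point \<open>(x / \<delta>, y /
  \<delta>)\<close>, at which the finitely many vertex monomials have grown by at most a factor
  \<open>1 / \<delta> ^ D\<close>.\<close>
lemma monomial_dominated:
  assumes D: "\<And>a b. (a, b) \<in> vertices S \<Longrightarrow> a + b \<le> D"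
    and p: "(i, j) \<in> S" and x: "0 < \<bar>x\<bar>" "\<bar>x\<bar> < \<delta>" "0 < \<bar>y\<bar>" "\<bar>y\<bar> < \<delta>" and "\<delta> \<le> 1"
  shows "\<bar>x\<bar> ^ i * \<bar>y\<bar> ^ j \<le> \<delta> ^ (i + j) * (vertex_sum S (x, y) / \<delta> ^ D)"
proof -
  have \<delta>: "\<delta> > 0" using x by linarith
  have "\<bar>x / \<delta>\<bar> ^ i * \<bar>y / \<delta>\<bar> ^ j \<le> vertex_sum S (x / \<delta>, y / \<delta>)"
    by (rule monomial_le_vertex_sum) (use x \<delta> p in auto)
  also have "\<dots> \<le> vertex_sum S (x, y) / \<delta> ^ D"
    unfolding vertex_sum_def prod.case sum_divide_distrib
  proof (rule sum_mono)
    fix v assume v: "v \<in> vertices S"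
    obtain a b where ab: "v = (a, b)" by (cases v)
    have "\<delta> ^ D \<le> \<delta> ^ (a + b)" using D[of a b] v ab \<delta> assms(7) by (intro power_decreasing) auto
    then have "\<bar>x\<bar> ^ a * \<bar>y\<bar> ^ b / \<delta> ^ (a + b) \<le> \<bar>x\<bar> ^ a * \<bar>y\<bar> ^ b / \<delta> ^ D"
      using \<delta> by (intro divide_left_mono) auto
    then show "(case v of (a, b) \<Rightarrow> \<bar>x / \<delta>\<bar> ^ a * \<bar>y / \<delta>\<bar> ^ b) \<le> (case v of (a, b) \<Rightarrow> \<bar>x\<bar> ^ a * \<bar>y\<bar> ^ b) / \<delta> ^ D"
      using \<delta> by (simp add: ab power_divide power_add abs_divide)
  qed
  finally have "(\<bar>x\<bar> ^ i * \<bar>y\<bar> ^ j) / \<delta> ^ (i + j) \<le> vertex_sum S (x, y) / \<delta> ^ D"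
    using \<delta> by (simp add: power_divide power_add abs_divide)
  then show ?thesis using \<delta> by (simp add: field_simps)
qed

section \<open>The lower bound for nondegenerate functions\<close>

text \<open>Dominated convergence for counting measure.\<close>
lemma infsum_tannery:
  fixes T :: "nat \<Rightarrow> 'i \<Rightarrow> real"
  assumes lim: "\<And>p. (\<lambda>n. T n p) \<longlonglongrightarrow> L p"
    and bound: "\<And>n p. \<bar>T n p\<bar> \<le> M p" and M: "M summable_on UNIV"
  shows "(\<lambda>n. infsum (T n) UNIV) \<longlonglongrightarrow> infsum L UNIV"
proof -
  have M0: "0 \<le> M p" for p using bound[of 0 p] by linarith
  have Mi: "integrable (count_space UNIV) M"
    using abs_summable_equivalent[of M UNIV] M M0 by (simp add: abs_summable_on_def abs_of_nonneg)
  have Ti: "integrable (count_space UNIV) (T n)" for n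
    by (rule Bochner_Integration.integrable_bound[OF Mi]) (use bound M0 in \<open>auto simp: abs_of_nonneg\<close>)
  have Lb: "\<bar>L p\<bar> \<le> M p" for p
    by (rule tendsto_upperbound[OF tendsto_rabs[OF lim]]) (use bound in auto)
  have Li: "integrable (count_space UNIV) L"
    by (rule Bochner_Integration.integrable_bound[OF Mi]) (use Lb M0 in \<open>auto simp: abs_of_nonneg\<close>)
  have "(\<lambda>n. integral\<^sup>L (count_space UNIV) (T n)) \<longlonglongrightarrow> integral\<^sup>L (count_space UNIV) L"
    by (rule integral_dominated_convergence[OF _ _ Mi]) (use bound lim in auto)
  moreover have "integral\<^sup>L (count_space UNIV) g = infsum g UNIV"
    if "integrable (count_space UNIV) g" for g :: "'i \<Rightarrow> real"
    using infsetsum_infsum[of g UNIV] that by (simp add: infsetsum_def abs_summable_on_def)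
  ultimately show ?thesis using Ti Li by simp
qed

lemma vertex_sum_le_maximal:
  assumes "\<And>i j. (i, j) \<in> S \<Longrightarrow> s * real a0 + t * real b0 \<le> s * real i + t * real j"
    and "\<bar>x\<bar> = exp (- s)" "\<bar>y\<bar> = exp (- t)"
  shows "vertex_sum S (x, y) \<le> real (card (vertices S)) * exp (- (s * real a0 + t * real b0))"
proof -
  have "vertex_sum S (x, y) \<le> (\<Sum>v\<in>vertices S. exp (- (s * real a0 + t * real b0)))"
    unfolding vertex_sum_def prod.case[where f = "\<lambda>x y. \<Sum>(a, b)\<in>vertices S. \<bar>x\<bar> ^ a * \<bar>y\<bar> ^ b"]
  proof (rule sum_mono)
    fix v assume "v \<in> vertices S"
    then show "(case v of (a, b) \<Rightarrow> \<bar>x\<bar> ^ a * \<bar>y\<bar> ^ b) \<le> exp (- (s * real a0 + t * real b0))"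
      using assms(1)[of "fst v" "snd v"] assms(2,3) vertices_subset[of S]
      by (cases v) (auto simp: monomial_exp subset_iff)
  qed
  then show ?thesis by simp
qed

text \<open>Along a sequence of points \<open>(\<sigma> * exp (- s n), \<tau> * exp (- t n))\<close> whose
  largest monomial has the exponent \<open>(a0, b0)\<close> throughout, the series divided by that
  monomial may be passed to the limit term by term. The majorant is supplied by
  \<open>monomial_dominated\<close> together with \<open>vertex_sum_le_maximal\<close>.\<close>
lemma psum_rescaled_limit:
  assumes conv: "pconv c r" "r > 0" and S: "S = {(i, j). c i j \<noteq> 0}"
    and st: "filterlim s at_top sequentially" "filterlim t at_top sequentially"
    and min: "\<And>n i j. (i, j) \<in> S \<Longrightarrow> s n * real a0 + t n * real b0 \<le> s n * real i + t n * real j"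
    and sg: "\<bar>\<sigma>\<bar> = 1" "\<bar>\<tau>\<bar> = 1"
    and lim: "\<And>i j. (i, j) \<in> S \<Longrightarrow>
      (\<lambda>n. exp (- (s n * (real i - real a0) + t n * (real j - real b0)))) \<longlonglongrightarrow> l i j"
  shows "(\<lambda>n. psum c (\<sigma> * exp (- s n), \<tau> * exp (- t n)) / exp (- (s n * real a0 + t n * real b0)))
    \<longlonglongrightarrow> (\<Sum>\<^sub>\<infinity>(i, j)\<in>UNIV. c i j * \<sigma> ^ i * \<tau> ^ j * l i j)"
proof -
  define \<delta> where "\<delta> = min r 1 / 2"
  have \<delta>: "0 < \<delta>" "\<delta> < r" "\<delta> \<le> 1" using conv by (auto simp: \<delta>_def)
  obtain D where D: "\<And>a b. (a, b) \<in> vertices S \<Longrightarrow> a + b \<le> D"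
    using vertex_degree_bound by blast
  have "\<forall>\<^sub>F n in sequentially. s n > - ln \<delta> \<and> t n > - ln \<delta>"
    using st by (auto simp: filterlim_at_top_dense eventually_conj)
  then obtain N where N: "\<And>n. n \<ge> N \<Longrightarrow> s n > - ln \<delta>" "\<And>n. n \<ge> N \<Longrightarrow> t n > - ln \<delta>"
    by (auto simp: eventually_sequentially)
  have small: "exp (- u) < \<delta>" if "u > - ln \<delta>" for u
  proof -
    have "exp (- u) < exp (ln \<delta>)" using that by (subst exp_less_cancel_iff) simp
    then show ?thesis using \<delta> by simp
  qed
  \<comment> \<open>The terms of the rescaled series, and a summable majorant that does not depend on
    \<open>n\<close>.\<close>
  define T where "T = (\<lambda>n (i, j). c i j * \<sigma> ^ i * \<tau> ^ j *
     exp (- (s n * (real i - real a0) + t n * (real j - real b0))))"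
  define K where "K = real (card (vertices S)) / \<delta> ^ D"
  define M where "M = (\<lambda>(i, j). K * \<bar>c i j * \<delta> ^ i * \<delta> ^ j\<bar>)"
  \<comment> \<open>The majorant is valid only once both coordinates are below \<open>\<delta>\<close>,
    hence the shift by \<open>N\<close>.\<close>
  have "(\<lambda>n. infsum (T (n + N)) UNIV) \<longlonglongrightarrow> (\<Sum>\<^sub>\<infinity>(i, j)\<in>UNIV. c i j * \<sigma> ^ i * \<tau> ^ j * l i j)"
  proof (rule infsum_tannery)
    fix p :: "nat \<times> nat"
    obtain i j where p: "p = (i, j)" by (cases p)
    show "(\<lambda>n. T (n + N) p) \<longlonglongrightarrow> (case p of (i, j) \<Rightarrow> c i j * \<sigma> ^ i * \<tau> ^ j * l i j)"
    proof (cases "(i, j) \<in> S")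
      case True
      show ?thesis unfolding p T_def prod.case
        by (intro tendsto_intros LIMSEQ_ignore_initial_segment[OF lim[OF True]])
    next
      case False
      then show ?thesis by (simp add: p T_def S)
    qed
  next
    fix n and p :: "nat \<times> nat"
    obtain i j where p: "p = (i, j)" by (cases p)
    let ?n = "n + N"
    show "\<bar>T ?n p\<bar> \<le> M p"
    proof (cases "(i, j) \<in> S")
      case True
      let ?x = "exp (- s ?n)" and ?y = "exp (- t ?n)" and ?w = "s ?n * real a0 + t ?n * real b0"
      have "\<bar>?x\<bar> ^ i * \<bar>?y\<bar> ^ j \<le> \<delta> ^ (i + j) * (vertex_sum S (?x, ?y) / \<delta> ^ D)"
        by (rule monomial_dominated[OF D True]) (use small N \<delta> in auto)
      also have "\<dots> \<le> \<delta> ^ (i + j) * (real (card (vertices S)) * exp (- ?w) / \<delta> ^ D)"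
        using \<delta> by (intro mult_left_mono divide_right_mono vertex_sum_le_maximal[OF min]) auto
      finally have "exp (- (s ?n * real i + t ?n * real j)) \<le> \<delta> ^ (i + j) * K * exp (- ?w)"
        by (simp add: monomial_exp K_def)
      then have "exp (- (s ?n * real i + t ?n * real j)) / exp (- ?w) \<le> \<delta> ^ (i + j) * K"
        by (simp add: divide_le_eq)
      also have "exp (- (s ?n * real i + t ?n * real j)) / exp (- ?w)
          = exp (- (s ?n * (real i - real a0) + t ?n * (real j - real b0)))"
        by (simp add: exp_diff[symmetric] algebra_simps)
      finally have "\<bar>c i j\<bar> * exp (- (s ?n * (real i - real a0) + t ?n * (real j - real b0)))
          \<le> \<bar>c i j\<bar> * (\<delta> ^ (i + j) * K)" by (rule mult_left_mono) auto
      then show ?thesis 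
        using sg \<delta> by (simp add: p T_def M_def abs_mult power_abs power_add mult_ac)
    next
      case False
      then show ?thesis using \<delta> by (simp add: p T_def S M_def K_def)
    qed
  next
    have "(\<lambda>(i, j). c i j * \<delta> ^ i * \<delta> ^ j) summable_on UNIV"
      using conv \<delta> by (simp add: pconv_def)
    then show "M summable_on UNIV"
      unfolding M_def case_prod_unfold
      using summable_on_iff_abs_summable_on_real[THEN iffD1]
      by (intro summable_on_cmult_right) fastforce
  qed
  then have "(\<lambda>n. infsum (T n) UNIV) \<longlonglongrightarrow> (\<Sum>\<^sub>\<infinity>(i, j)\<in>UNIV. c i j * \<sigma> ^ i * \<tau> ^ j * l i j)"
    by (rule LIMSEQ_offset)
  moreover have "infsum (T n) UNIV
      = psum c (\<sigma> * exp (- s n), \<tau> * exp (- t n)) / exp (- (s n * real a0 + t n * real b0))" for n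
  proof -
    have "T n p = (case p of (i, j) \<Rightarrow> c i j * (\<sigma> * exp (- s n)) ^ i * (\<tau> * exp (- t n)) ^ j)
        * inverse (exp (- (s n * real a0 + t n * real b0)))" for p
    proof (cases p)
      case (Pair i j)
      have "exp (- (s n * (real i - real a0) + t n * (real j - real b0)))
          = exp (- s n) ^ i * exp (- t n) ^ j * inverse (exp (- (s n * real a0 + t n * real b0)))"
        unfolding monomial_exp exp_minus[symmetric] exp_add[symmetric] by (simp add: algebra_simps)
      then show ?thesis by (simp add: Pair T_def power_mult_distrib mult_ac)
    qed
    then show ?thesis unfolding psum_def prod.case divide_inverse
      by (subst infsum_cmult_left'[symmetric]) presburger
  qed
  ultimately show ?thesis by simp
qed

text \<open>A line of negative slope that supports the hull at two exponents cuts out an edge. Since both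
  coefficients of the line are positive, it carries finitely many exponents, and the edge is their
  convex hull.\<close>
lemma supporting_line_edge:
  fixes S :: "(nat \<times> nat) set"
  assumes \<theta>: "\<theta> > 0" and le: "\<And>i j. (i, j) \<in> S \<Longrightarrow> m \<le> \<theta> * real i + real j"
    and u: "(a, b) \<in> S" "\<theta> * real a + real b = m" and u': "(a', b') \<in> S" "\<theta> * real a' + real b' = m"
    and neq: "(a, b) \<noteq> (a', b')"
  defines "e \<equiv> hull_quadrants S \<inter> {z. (\<theta>, 1) \<bullet> z = m}"
  shows "e edge_of hull_quadrants S" "compact e"
proof -
  have face: "e face_of hull_quadrants S"
    unfolding e_def
    by (rule face_of_Int_supporting_hyperplane_ge[OF convex_hull_quadrants])
       (use hull_subset_halfplane[of \<theta> 1 S m] \<theta> le in \<open>auto simp: inner_Pair\<close>)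
  have "aff_dim e \<le> aff_dim {z. (\<theta>, 1::real) \<bullet> z = m}"
    by (rule aff_dim_subset) (auto simp: e_def)
  also have "\<dots> = 1" by (subst aff_dim_hyperplane) (auto simp: zero_prod_def)
  finally have le1: "aff_dim e \<le> 1" .
  have "{(real a, real b), (real a', real b')} \<subseteq> e"
    using quadrant_subset_hull[OF u(1)] quadrant_subset_hull[OF u'(1)] u u'
    by (auto simp: e_def quadrant_def inner_Pair)
  then have "aff_dim {(real a, real b), (real a', real b')} \<le> aff_dim e"
    by (rule aff_dim_subset)
  then have "aff_dim e = 1" using le1 neq by (auto split: if_splits)
  with face show "e edge_of hull_quadrants S" by (simp add: edge_of_def)

  define P where "P = {(i, j). (i, j) \<in> S \<and> \<theta> * real i + real j = m}"
  define F where "F = (\<lambda>(i, j). (real i, real j)) ` P"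
  have "P \<subseteq> {..nat \<lceil>m / \<theta>\<rceil>} \<times> {..nat \<lceil>m\<rceil>}"
  proof clarify
    fix i j assume "(i, j) \<in> P"
    then have eq: "\<theta> * real i + real j = m" by (simp add: P_def)
    have "\<theta> * real i \<ge> 0" using \<theta> by simp
    then have "real j \<le> m" "real i \<le> m / \<theta>" using eq \<theta> by (auto simp: pos_le_divide_eq mult.commute)
    then show "i \<in> {..nat \<lceil>m / \<theta>\<rceil>} \<and> j \<in> {..nat \<lceil>m\<rceil>}"
      by simp linarith
  qed
  then have "finite P" by (rule finite_subset) auto
  then have "compact (convex hull F)" by (simp add: F_def finite_imp_compact_convex_hull)
  moreover have "e = convex hull F"
  proof
    have line: "{(x, y). \<theta> * x + 1 * y = m} = {z. (\<theta>, 1) \<bullet> z = m}"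
      by (auto simp: inner_Pair)
    have sub: "convex hull F \<subseteq> {(x, y). \<theta> * x + 1 * y = m}"
      unfolding line by (rule hull_minimal) (auto simp: F_def P_def inner_Pair convex_hyperplane)
    have "hull_quadrants S \<subseteq> {(x, y). \<theta> * x + 1 * y > m} \<union> convex hull F"
    proof (rule hull_subset_face)
      fix i j assume "(i, j) \<in> S" "\<theta> * real i + 1 * real j = m"
      then have "(real i, real j) \<in> F" by (force simp: F_def P_def)
      then show "(real i, real j) \<in> convex hull F" by (rule hull_inc)
    qed (use \<theta> le sub in \<open>auto simp: convex_convex_hull\<close>)
    then show "e \<subseteq> convex hull F" by (auto simp: e_def inner_Pair)
    have "F \<subseteq> e"
      using quadrant_subset_hull by (fastforce simp: F_def P_def e_def quadrant_def inner_Pair)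
    moreover have "convex e" using face face_of_imp_convex by blast
    ultimately show "convex hull F \<subseteq> e" by (simp add: hull_minimal)
  qed
  ultimately show "compact e" by simp
qed

lemma not_at_top_convergent_subsequence:
  fixes g :: "nat \<Rightarrow> real"
  assumes "\<not> filterlim g at_top sequentially" "\<And>n. g n \<ge> 0"
  obtains r L where "strict_mono r" "(g \<circ> r) \<longlonglongrightarrow> L"
proof -
  obtain Z where "\<not> (\<forall>\<^sub>F n in sequentially. Z \<le> g n)"
    using assms(1) by (auto simp: filterlim_at_top)
  then have "infinite {n. g n < Z}"
    by (auto simp: frequently_cofinite cofinite_eq_sequentially[symmetric] eventually_cofinite not_le)
  then obtain r :: "nat \<Rightarrow> nat" where r: "strict_mono r" "\<And>n. r n \<in> {n. g n < Z}"
    using infinite_enumerate[of "{n. g n < Z}"] by auto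
  have "\<forall>n. (g \<circ> r) n \<in> {0..Z}" using r(2) assms(2) by (auto intro: less_imp_le)
  moreover have "seq_compact {0..Z}" by (intro compact_imp_seq_compact compact_Icc)
  ultimately obtain l and q :: "nat \<Rightarrow> nat" where q: "strict_mono q" "((g \<circ> r) \<circ> q) \<longlonglongrightarrow> l"
    unfolding seq_compact_def by (elim allE[of _ "g \<circ> r"]) blast
  show thesis
  proof (rule that)
    show "strict_mono (r \<circ> q)" using r(1) q(1) by (rule strict_mono_o)
    show "(g \<circ> (r \<circ> q)) \<longlonglongrightarrow> l" using q(2) by (simp only: o_assoc)
  qed
qed

lemma exp_minus_tendsto_0:
  fixes f :: "nat \<Rightarrow> real"
  assumes "filterlim f at_top sequentially"
  shows "(\<lambda>n. exp (- f n)) \<longlonglongrightarrow> 0"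
  by (rule filterlim_compose[OF exp_at_bot]) (use assms in \<open>simp add: filterlim_uminus_at_top\<close>)

text \<open>The limit is determined by the exponents that survive the rescaling. If the linear forms of all
  exponents other than \<open>(a0, b0)\<close> run away from the minimum, only the coefficient at
  \<open>(a0, b0)\<close> survives. Otherwise the value at some \<open>(i1, j1)\<close> stays within
  bounded distance of the minimum along a subsequence. Then \<open>s\<close> and \<open>t\<close>
  are asymptotically proportional, up to a convergent error, in the ratio that makes the line
  through the two exponents a supporting line. Its edge is compact, exactly the exponents on this
  edge survive, and the limit is the edge polynomial at a point off the axes, up to a positive
  factor.\<close>
lemma rescaled_nonzero_limit:
  assumes conv: "pconv c r" "r > 0" and S: "S = {(i, j). c i j \<noteq> 0}"
    and edges: "\<And>e z. e edge_of hull_quadrants S \<Longrightarrow> compact e \<Longrightarrow> z \<in> off_axes \<Longrightarrow>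
      (case z of (x, y) \<Rightarrow> \<Sum>(a, b) | (real a, real b) \<in> e. c a b * x ^ a * y ^ b) \<noteq> 0"
    and v: "(a0, b0) \<in> S"
    and st: "filterlim s at_top sequentially" "filterlim t at_top sequentially"
    and min: "\<And>n i j. (i, j) \<in> S \<Longrightarrow> s n * real a0 + t n * real b0 \<le> s n * real i + t n * real j"
    and sg: "\<bar>\<sigma>\<bar> = 1" "\<bar>\<tau>\<bar> = 1"
  obtains q L where "strict_mono q" "L \<noteq> 0"
    "(\<lambda>n. psum c (\<sigma> * exp (- s (q n)), \<tau> * exp (- t (q n))) / exp (- (s (q n) * real a0 + t (q n) * real b0)))
       \<longlonglongrightarrow> L"
proof (cases "\<exists>i j. (i, j) \<in> S \<and> (i, j) \<noteq> (a0, b0) \<and>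
     \<not> filterlim (\<lambda>n. s n * (real i - real a0) + t n * (real j - real b0)) at_top sequentially")
  case False
  have lim: "(\<lambda>n. exp (- (s n * (real i - real a0) + t n * (real j - real b0))))
      \<longlonglongrightarrow> (if (i, j) = (a0, b0) then 1 else 0)" if "(i, j) \<in> S" for i j
  proof (cases "(i, j) = (a0, b0)")
    case nv: False
    then have "filterlim (\<lambda>n. s n * (real i - real a0) + t n * (real j - real b0)) at_top sequentially"
      using False that by blast
    from exp_minus_tendsto_0[OF this] show ?thesis using nv by (simp only: if_False)
  qed auto
  have "(\<Sum>\<^sub>\<infinity>(i, j)\<in>UNIV. c i j * \<sigma> ^ i * \<tau> ^ j * (if (i, j) = (a0, b0) then 1 else 0))
      = (\<Sum>\<^sub>\<infinity>(i, j)\<in>{(a0, b0)}. c i j * \<sigma> ^ i * \<tau> ^ j * (if (i, j) = (a0, b0) then 1 else 0))"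
    by (rule infsum_cong_neutral) (auto split: if_splits)
  also have "\<dots> = c a0 b0 * \<sigma> ^ a0 * \<tau> ^ b0" by simp
  also have "\<dots> \<noteq> 0" using v sg S by auto
  finally have nz: "(\<Sum>\<^sub>\<infinity>(i, j)\<in>UNIV. c i j * \<sigma> ^ i * \<tau> ^ j * (if (i, j) = (a0, b0) then 1 else 0)) \<noteq> 0" .
  show ?thesis
    by (rule that[of "\<lambda>n. n", OF _ nz psum_rescaled_limit[OF conv S st min sg lim]])
       (simp add: strict_mono_def)
next
  case True
  then obtain i1 j1 where u: "(i1, j1) \<in> S" "(i1, j1) \<noteq> (a0, b0)"
    "\<not> filterlim (\<lambda>n. s n * (real i1 - real a0) + t n * (real j1 - real b0)) at_top sequentially"
    by blast
  have ge: "0 \<le> s n * (real i - real a0) + t n * (real j - real b0)" if "(i, j) \<in> S" for i j n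
    using min[OF that, of n] by (simp add: algebra_simps)
  obtain q L where q: "strict_mono q"
    and L: "((\<lambda>n. s n * (real i1 - real a0) + t n * (real j1 - real b0)) \<circ> q) \<longlonglongrightarrow> L"
    using not_at_top_convergent_subsequence[OF u(3) ge[OF u(1)]] by blast
  define d1 d2 where "d1 = real i1 - real a0" and "d2 = real j1 - real b0"
  have g: "(\<lambda>n. s (q n) * d1 + t (q n) * d2) \<longlonglongrightarrow> L"
    using L by (simp add: o_def d1_def d2_def)
  have sq: "filterlim (\<lambda>n. s (q n)) at_top sequentially" "filterlim (\<lambda>n. t (q n)) at_top sequentially"
    using st filterlim_compose filterlim_subseq[OF q] by blast+
  have s0: "\<exists>n. s n > 0 \<and> t n > 0"
  proof -
    have "\<forall>\<^sub>F n in sequentially. s n > 0 \<and> t n > 0"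
      using st by (auto simp: filterlim_at_top_dense eventually_conj)
    then show ?thesis by (auto simp: eventually_sequentially)
  qed
  \<comment> \<open>The form \<open>s * d1 + t * d2\<close> would tend to infinity if \<open>d1\<close>
    and \<open>d2\<close> were both nonnegative, and be negative if both were
    nonpositive.\<close>
  have opp: "d1 * d2 < 0"
  proof (rule ccontr)
    assume "\<not> d1 * d2 < 0"
    then consider "d1 \<ge> 0" "d2 \<ge> 0" "d1 > 0 \<or> d2 > 0" | "d1 \<le> 0" "d2 \<le> 0" "d1 < 0 \<or> d2 < 0"
      using u(2) by (auto simp: d1_def d2_def mult_less_0_iff) linarith+
    then show False
    proof cases
      case 1
      have "filterlim (\<lambda>n. s (q n) * d1 + t (q n) * d2) at_top sequentially"
      proof (cases "d1 > 0")
        case True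
        have "\<forall>\<^sub>F n in sequentially. t (q n) \<ge> 0" using sq by (auto simp: filterlim_at_top)
        then have "\<forall>\<^sub>F n in sequentially. s (q n) * d1 \<le> s (q n) * d1 + t (q n) * d2"
          by eventually_elim (use 1 in simp)
        moreover have "filterlim (\<lambda>n. s (q n) * d1) at_top sequentially"
          using filterlim_tendsto_pos_mult_at_top[OF tendsto_const True sq(1)] by (simp add: mult.commute)
        ultimately show ?thesis by (rule filterlim_at_top_mono[rotated])
      next
        case False
        then have "d2 > 0" using 1 by auto
        have "\<forall>\<^sub>F n in sequentially. s (q n) \<ge> 0" using sq by (auto simp: filterlim_at_top)
        then have "\<forall>\<^sub>F n in sequentially. t (q n) * d2 \<le> s (q n) * d1 + t (q n) * d2"
          by eventually_elim (use 1 in simp)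
        moreover have "filterlim (\<lambda>n. t (q n) * d2) at_top sequentially"
          using filterlim_tendsto_pos_mult_at_top[OF tendsto_const \<open>d2 > 0\<close> sq(2)] by (simp add: mult.commute)
        ultimately show ?thesis by (rule filterlim_at_top_mono[rotated])
      qed
      then show False using g not_tendsto_and_filterlim_at_infinity[of sequentially]
        by (metis filterlim_at_top_imp_at_infinity sequentially_bot)
    next
      case 2
      obtain n where n: "s n > 0" "t n > 0" using s0 by blast
      have "s n * d1 \<le> 0" "t n * d2 \<le> 0" "s n * d1 < 0 \<or> t n * d2 < 0"
        using 2 n by (auto simp: mult_le_0_iff mult_less_0_iff)
      then show False using ge[OF u(1), of n] by (auto simp: d1_def d2_def)
    qed
  qed
  then have d10: "d1 \<noteq> 0" by auto
  define \<theta> where "\<theta> = - d2 / d1"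
  have \<theta>: "\<theta> > 0" using opp by (auto simp: \<theta>_def mult_less_0_iff divide_less_0_iff)
  define m where "m = \<theta> * real a0 + real b0"
  define \<kappa> where "\<kappa> = (\<lambda>i j. \<theta> * real i + real j - m)"
  \<comment> \<open>Every linear form is a multiple of the convergent one plus a multiple of
    \<open>t\<close>; the second coefficient \<open>\<kappa>\<close> measures the height
    over the line through \<open>(a0, b0)\<close> and \<open>(i1, j1)\<close>.\<close>
  have decomp: "s n * (real i - real a0) + t n * (real j - real b0)
      = (real i - real a0) / d1 * (s n * d1 + t n * d2) + \<kappa> i j * t n" for i j n
    using d10 by (simp add: \<kappa>_def m_def \<theta>_def field_simps)
  have g': "(\<lambda>n. (real i - real a0) / d1 * (s (q n) * d1 + t (q n) * d2)) \<longlonglongrightarrow> (real i - real a0) / d1 * L" for i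
    by (intro tendsto_intros g)
  \<comment> \<open>An exponent below the line would undercut the minimum, as \<open>t\<close> tends to
    infinity.\<close>
  have \<kappa>0: "\<kappa> i j \<ge> 0" if p: "(i, j) \<in> S" for i j
  proof (rule ccontr)
    assume "\<not> \<kappa> i j \<ge> 0"
    then have "- \<kappa> i j > 0" by simp
    from filterlim_tendsto_add_at_top[OF tendsto_minus[OF g'[of i]]
        filterlim_tendsto_pos_mult_at_top[OF tendsto_const this sq(2)]]
    have "\<forall>\<^sub>F n in sequentially. - ((real i - real a0) / d1 * (s (q n) * d1 + t (q n) * d2)) + - \<kappa> i j * t (q n) > 0"
      unfolding filterlim_at_top_dense by (rule spec)
    then have "\<forall>\<^sub>F n in sequentially. s (q n) * (real i - real a0) + t (q n) * (real j - real b0) < 0"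
      by eventually_elim (simp add: decomp)
    then obtain n where "s (q n) * (real i - real a0) + t (q n) * (real j - real b0) < 0"
      by (auto simp: eventually_sequentially)
    then show False using ge[OF p, of "q n"] by simp
  qed
  define l where "l = (\<lambda>i j. if \<kappa> i j = 0 then exp (- ((real i - real a0) / d1 * L)) else 0)"
  have lim: "(\<lambda>n. exp (- (s (q n) * (real i - real a0) + t (q n) * (real j - real b0)))) \<longlonglongrightarrow> l i j"
    if p: "(i, j) \<in> S" for i j
  proof (cases "\<kappa> i j = 0")
    case True
    then show ?thesis unfolding decomp l_def using tendsto_exp[OF tendsto_minus[OF g'[of i]]]
      by (simp only: if_True simp_thms mult_zero_left add_0_right)
  next
    case False
    then have "\<kappa> i j > 0" using \<kappa>0[OF p] by linarith
    then have "filterlim (\<lambda>n. \<kappa> i j * t (q n)) at_top sequentially"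
      using filterlim_tendsto_pos_mult_at_top[OF tendsto_const _ sq(2)] by simp
    then have "filterlim (\<lambda>n. (real i - real a0) / d1 * (s (q n) * d1 + t (q n) * d2) + \<kappa> i j * t (q n)) at_top sequentially"
      using filterlim_tendsto_add_at_top[OF g'] by blast
    from exp_minus_tendsto_0[OF this] show ?thesis unfolding decomp l_def using False by simp
  qed
  define e where "e = hull_quadrants S \<inter> {z. (\<theta>, 1) \<bullet> z = m}"
  have "\<kappa> i1 j1 = 0" using d10 by (simp add: \<kappa>_def m_def \<theta>_def d1_def d2_def field_simps)
  then have "\<theta> * real i1 + real j1 = m" by (simp add: \<kappa>_def)
  moreover have "m \<le> \<theta> * real i + real j" if "(i, j) \<in> S" for i j
    using \<kappa>0[OF that] by (simp add: \<kappa>_def)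
  ultimately have e: "e edge_of hull_quadrants S" "compact e"
    unfolding e_def using supporting_line_edge[OF \<theta> _ v m_def[symmetric] u(1) _ u(2)[symmetric]] by blast+
  \<comment> \<open>On the edge, \<open>l i j\<close> is a constant times \<open>X ^ i\<close>, so that
    the limit of the rescaled series is the edge polynomial at \<open>(\<sigma> * X,
    \<tau>)\<close>, up to that constant.\<close>
  define X where "X = exp (- (L / d1))"
  have Xpow: "X ^ i = exp (- (real i / d1 * L))" for i
    by (simp add: X_def exp_of_nat_mult[symmetric])
  have on_e: "(real i, real j) \<in> e \<longleftrightarrow> \<kappa> i j = 0" if "(i, j) \<in> S" for i j
    using quadrant_subset_hull[OF that] by (auto simp: e_def \<kappa>_def inner_Pair quadrant_def)
  have fin: "finite {(a, b). (real a, real b) \<in> e}"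
  proof -
    obtain B where B: "\<And>z. z \<in> e \<Longrightarrow> norm z \<le> B" using compact_imp_bounded[OF e(2)] by (auto simp: bounded_iff)
    have "{(a, b). (real a, real b) \<in> e} \<subseteq> {..nat \<lceil>B\<rceil>} \<times> {..nat \<lceil>B\<rceil>}"
    proof clarify
      fix a b assume "(real a, real b) \<in> e"
      then have "norm (real a, real b) \<le> B" by (rule B)
      then have "real a \<le> B" "real b \<le> B"
        using norm_fst_le[of "real a" "real b"] norm_snd_le[of "real b" "real a"] by simp_all
      then show "a \<in> {..nat \<lceil>B\<rceil>} \<and> b \<in> {..nat \<lceil>B\<rceil>}" by simp linarith
    qed
    then show ?thesis by (rule finite_subset) auto
  qed
  have "(\<Sum>\<^sub>\<infinity>(i, j)\<in>UNIV. c i j * \<sigma> ^ i * \<tau> ^ j * l i j)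
      = (\<Sum>\<^sub>\<infinity>(i, j)\<in>{(a, b). (real a, real b) \<in> e}. exp (real a0 / d1 * L) * (c i j * (\<sigma> * X) ^ i * \<tau> ^ j))"
  proof (rule infsum_cong_neutral, goal_cases)
    case (2 p)
    then show ?case using on_e S by (auto simp: l_def split: if_splits)
  next
    case (3 p)
    obtain i j where p: "p = (i, j)" by (cases p)
    show ?case
    proof (cases "(i, j) \<in> S")
      case True
      then have "\<kappa> i j = 0" using 3 p on_e by auto
      have "exp (- ((real i - real a0) / d1 * L)) = exp (real a0 / d1 * L) * X ^ i"
        unfolding Xpow exp_add[symmetric] by (simp add: field_simps diff_divide_distrib)
      then show ?thesis using \<open>\<kappa> i j = 0\<close> by (simp add: p l_def power_mult_distrib)
    qed (simp add: p S)
  qed auto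
  also have "\<dots> = exp (real a0 / d1 * L) * (\<Sum>(i, j) | (real i, real j) \<in> e. c i j * (\<sigma> * X) ^ i * \<tau> ^ j)"
    using fin by (simp add: sum_distrib_left case_prod_unfold)
  also have "\<dots> \<noteq> 0"
  proof -
    have "\<sigma> \<noteq> 0" "\<tau> \<noteq> 0" using sg by auto
    then have "(\<sigma> * X, \<tau>) \<in> off_axes" by (simp add: off_axes_def X_def)
    from edges[OF e this] show ?thesis by simp
  qed
  finally show ?thesis
    using that[OF q _ psum_rescaled_limit[OF conv S sq min sg lim]] by blast
qed

text \<open>The proof is by contradiction and compactness. A sequence that violates the bound with constants
  tending to 0 has a subsequence with one dominant vertex and constant signs, and
  \<open>rescaled_nonzero_limit\<close> contradicts the assumed smallness.\<close>
lemma nondegenerate_lower_bound: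
  assumes conv: "pconv c r" "r > 0" and S: "S = {(i, j). c i j \<noteq> 0}"
    and edges: "\<And>e z. e edge_of hull_quadrants S \<Longrightarrow> compact e \<Longrightarrow> z \<in> off_axes \<Longrightarrow>
      (case z of (x, y) \<Rightarrow> \<Sum>(a, b) | (real a, real b) \<in> e. c a b * x ^ a * y ^ b) \<noteq> 0"
    and ne: "S \<noteq> {}"
  shows "\<exists>\<delta>>0. \<forall>x y. 0 < \<bar>x\<bar> \<longrightarrow> \<bar>x\<bar> < \<delta> \<longrightarrow> 0 < \<bar>y\<bar> \<longrightarrow> \<bar>y\<bar> < \<delta> \<longrightarrow>
      \<delta> * vertex_sum S (x, y) \<le> \<bar>psum c (x, y)\<bar>"
proof (rule ccontr)
  assume no: "\<not> ?thesis"
  \<comment> \<open>\<open>\<delta>\<close> is tried along the sequence \<open>h n\<close>; it bounds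
    the coordinates and serves as the constant at the same time.\<close>
  define h :: "nat \<Rightarrow> real" where "h n = 1 / real (n + 2)" for n
  have h: "h n > 0" "h n < 1" for n by (auto simp: h_def)
  have h0: "h \<longlonglongrightarrow> 0"
    unfolding h_def using LIMSEQ_ignore_initial_segment[OF lim_1_over_n[where 'a = real], of 2] by simp
  have "\<exists>x y. 0 < \<bar>x\<bar> \<and> \<bar>x\<bar> < h n \<and> 0 < \<bar>y\<bar> \<and> \<bar>y\<bar> < h n \<and> \<bar>psum c (x, y)\<bar> < h n * vertex_sum S (x, y)" for n
    using no h(1)[of n] by (meson not_le)
  then obtain X Y where XY: "\<And>n. 0 < \<bar>X n\<bar>" "\<And>n. \<bar>X n\<bar> < h n" "\<And>n. 0 < \<bar>Y n\<bar>" "\<And>n. \<bar>Y n\<bar> < h n"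
    "\<And>n. \<bar>psum c (X n, Y n)\<bar> < h n * vertex_sum S (X n, Y n)" by metis
  define s t where "s n = - ln \<bar>X n\<bar>" and "t n = - ln \<bar>Y n\<bar>" for n
  have es: "\<bar>X n\<bar> = exp (- s n)" "\<bar>Y n\<bar> = exp (- t n)" for n using XY by (auto simp: s_def t_def)
  have st0: "s n > 0" "t n > 0" for n
    using XY(2,4)[of n] h(2)[of n] XY(1,3)[of n] by (auto simp: s_def t_def ln_less_zero)
  have to0: "(\<lambda>n. \<bar>X n\<bar>) \<longlonglongrightarrow> 0" "(\<lambda>n. \<bar>Y n\<bar>) \<longlonglongrightarrow> 0"
    by (rule tendsto_sandwich[OF _ _ tendsto_const h0];
        use XY in \<open>auto intro!: always_eventually less_imp_le\<close>)+
  have log_top: "filterlim (\<lambda>n. - ln \<bar>Z n\<bar>) at_top sequentially"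
    if "(\<lambda>n. \<bar>Z n\<bar>) \<longlonglongrightarrow> 0" "\<And>n. 0 < \<bar>Z n\<bar>" for Z :: "nat \<Rightarrow> real"
  proof -
    have "filterlim (\<lambda>n. \<bar>Z n\<bar>) (at_right 0) sequentially"
      using that by (auto simp: filterlim_at)
    from filterlim_compose[OF ln_at_0 this] show ?thesis
      by (simp add: filterlim_uminus_at_bot)
  qed
  have st: "filterlim s at_top sequentially" "filterlim t at_top sequentially"
    unfolding s_def t_def using log_top to0 XY by blast+
  have "\<exists>v \<in> vertices S. \<forall>(i, j)\<in>S. s n * real (fst v) + t n * real (snd v) \<le> s n * real i + t n * real j" for n
    using exists_minimising_vertex[OF st0(1)[of n] st0(2)[of n] ne] by (metis (no_types, lifting) case_prodI2 fst_conv snd_conv)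
  then obtain v where v: "\<And>n. v n \<in> vertices S"
    "\<And>n i j. (i, j) \<in> S \<Longrightarrow> s n * real (fst (v n)) + t n * real (snd (v n)) \<le> s n * real i + t n * real j"
    by (metis (no_types, lifting) case_prodD)
  \<comment> \<open>The dominant vertex and the two signs take finitely many values.\<close>
  define G where "G n = (v n, sgn (X n), sgn (Y n))" for n
  have sgnX: "sgn (X n) \<in> {-1, 1}" and sgnY: "sgn (Y n) \<in> {-1, 1}" for n
    using XY(1,3)[of n] by (auto simp: sgn_real_def)
  have "range G \<subseteq> vertices S \<times> {-1, 1} \<times> {-1, 1}"
    using v(1) sgnX sgnY by (auto simp: G_def)
  then have "finite (range G)" by (rule finite_subset) (auto simp: finite_vertices)
  then obtain k where "infinite {n. G n = G k}"
    using pigeonhole_infinite[of UNIV G] by auto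
  then obtain r :: "nat \<Rightarrow> nat" where r: "strict_mono r" "\<And>n. G (r n) = G k"
    using infinite_enumerate[of "{n. G n = G k}"] by auto
  define a b \<sigma> \<tau> where "a = fst (v k)" and "b = snd (v k)" and "\<sigma> = sgn (X k)" and "\<tau> = sgn (Y k)"
  have vr: "v (r n) = (a, b)" "sgn (X (r n)) = \<sigma>" "sgn (Y (r n)) = \<tau>" for n
    using r(2)[of n] by (auto simp: G_def a_def b_def \<sigma>_def \<tau>_def prod_eq_iff)
  have sg: "\<bar>\<sigma>\<bar> = 1" "\<bar>\<tau>\<bar> = 1" using XY(1,3)[of k] by (auto simp: \<sigma>_def \<tau>_def abs_sgn_eq)
  have ab: "(a, b) \<in> S" using v(1)[of "r 0"] vr(1)[of 0] vertices_subset[of S] by (simp add: subset_iff)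
  have str: "filterlim (\<lambda>n. s (r n)) at_top sequentially" "filterlim (\<lambda>n. t (r n)) at_top sequentially"
    using filterlim_compose[OF st(1) filterlim_subseq[OF r(1)]]
      filterlim_compose[OF st(2) filterlim_subseq[OF r(1)]] by auto
  have min: "s (r n) * real a + t (r n) * real b \<le> s (r n) * real i + t (r n) * real j" if "(i, j) \<in> S" for n i j
    using v(2)[OF that, of "r n"] by (simp add: vr)
  obtain q L where q: "strict_mono q" "L \<noteq> 0"
    and L: "(\<lambda>n. psum c (\<sigma> * exp (- s (r (q n))), \<tau> * exp (- t (r (q n))))
        / exp (- (s (r (q n)) * real a + t (r (q n)) * real b))) \<longlonglongrightarrow> L"
    using rescaled_nonzero_limit[OF conv S edges ab str min sg] by blast
  have XYr: "\<sigma> * exp (- s (r n)) = X (r n)" "\<tau> * exp (- t (r n)) = Y (r n)" for n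
    using vr(2,3)[of n] es[of "r n"] sgn_mult_abs[of "X (r n)"] sgn_mult_abs[of "Y (r n)"]
    by (simp_all add: mult.commute)
  define K where "K = real (card (vertices S))"
  have "(\<lambda>n. K * h (r (q n))) \<longlonglongrightarrow> K * 0"
    by (intro tendsto_intros LIMSEQ_subseq_LIMSEQ[OF h0 strict_mono_o[OF r(1) q(1)], unfolded o_def])
  then have K0: "(\<lambda>n. K * h (r (q n))) \<longlonglongrightarrow> 0" by simp
  have bd: "\<bar>psum c (X (r n), Y (r n)) / exp (- (s (r n) * real a + t (r n) * real b))\<bar> \<le> K * h (r n)" for n
  proof -
    have "\<bar>psum c (X (r n), Y (r n))\<bar> \<le> h (r n) * vertex_sum S (X (r n), Y (r n))"
      using XY(5)[of "r n"] by simp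
    also have "\<dots> \<le> h (r n) * (K * exp (- (s (r n) * real a + t (r n) * real b)))"
      unfolding K_def using h(1)[of "r n"]
      by (intro mult_left_mono vertex_sum_le_maximal min es) auto
    finally show ?thesis by (simp add: divide_le_eq abs_divide mult_ac)
  qed
  have "(\<lambda>n. psum c (X (r (q n)), Y (r (q n))) / exp (- (s (r (q n)) * real a + t (r (q n)) * real b))) \<longlonglongrightarrow> 0"
    by (rule Lim_null_comparison[OF always_eventually K0]) (simp only: real_norm_def bd simp_thms)
  then show False using LIMSEQ_unique[OF L[unfolded XYr]] q(2) by simp
qed

section \<open>Functions with scale-invariant derivative bounds\<close>

text \<open>\<open>symb b n \<Omega> K w h\<close> bounds \<open>h\<close> and its Euler derivatives up to
  order \<open>n\<close> by \<open>K * w\<close> on \<open>\<Omega>\<close>, where the first Euler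
  derivative is the function \<open>h1\<close> whose quotient by \<open>x\<close> is the partial
  derivative of \<open>h\<close>, and similarly for \<open>h2\<close> and \<open>y\<close>. The flag
  \<open>b\<close> records whether derivatives in \<open>y\<close> may still be taken: all
  derivatives in \<open>y\<close> come first and are followed by those in \<open>x\<close>. This is
  the order in which \<open>partials a b\<close> differentiates, so no interchange of mixed partial
  derivatives is ever needed.\<close>
fun symb :: "bool \<Rightarrow> nat \<Rightarrow> (real \<times> real) set \<Rightarrow> real \<Rightarrow> (real \<times> real \<Rightarrow> real) \<Rightarrow> (real \<times> real \<Rightarrow> real) \<Rightarrow> bool" where
  "symb b 0 \<Omega> K w h \<longleftrightarrow> continuous_on \<Omega> h \<and> (\<forall>z\<in>\<Omega>. \<bar>h z\<bar> \<le> K * w z)"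
| "symb b (Suc n) \<Omega> K w h \<longleftrightarrow> continuous_on \<Omega> h \<and> (\<forall>z\<in>\<Omega>. \<bar>h z\<bar> \<le> K * w z) \<and>
     (\<exists>h1. (\<forall>x y. (x, y) \<in> \<Omega> \<longrightarrow> ((\<lambda>t. h (t, y)) has_real_derivative h1 (x, y) / x) (at x)) \<and> symb False n \<Omega> K w h1) \<and>
     (b \<longrightarrow> (\<exists>h2. (\<forall>x y. (x, y) \<in> \<Omega> \<longrightarrow> ((\<lambda>t. h (x, t)) has_real_derivative h2 (x, y) / y) (at y)) \<and> symb True n \<Omega> K w h2))"

lemma symb_cont: "symb b n \<Omega> K w h \<Longrightarrow> continuous_on \<Omega> h"
  by (cases n) auto

lemma symb_bound: "symb b n \<Omega> K w h \<Longrightarrow> z \<in> \<Omega> \<Longrightarrow> \<bar>h z\<bar> \<le> K * w z"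
  by (cases n) auto

lemma symb_deriv1:
  assumes "symb b (Suc n) \<Omega> K w h"
  obtains h1 where "\<And>x y. (x, y) \<in> \<Omega> \<Longrightarrow> ((\<lambda>t. h (t, y)) has_real_derivative h1 (x, y) / x) (at x)"
    "symb False n \<Omega> K w h1"
  using assms by auto

lemma symb_deriv2:
  assumes "symb True (Suc n) \<Omega> K w h"
  obtains h2 where "\<And>x y. (x, y) \<in> \<Omega> \<Longrightarrow> ((\<lambda>t. h (x, t)) has_real_derivative h2 (x, y) / y) (at y)"
    "symb True n \<Omega> K w h2"
  using assms by auto

lemma symb_SucI:
  assumes "continuous_on \<Omega> h" "\<And>z. z \<in> \<Omega> \<Longrightarrow> \<bar>h z\<bar> \<le> K * w z"
    and "\<And>x y. (x, y) \<in> \<Omega> \<Longrightarrow> ((\<lambda>t. h (t, y)) has_real_derivative h1 (x, y) / x) (at x)"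
    and "symb False n \<Omega> K w h1"
    and "\<And>x y. b \<Longrightarrow> (x, y) \<in> \<Omega> \<Longrightarrow> ((\<lambda>t. h (x, t)) has_real_derivative h2 (x, y) / y) (at y)"
    and "b \<Longrightarrow> symb True n \<Omega> K w h2"
  shows "symb b (Suc n) \<Omega> K w h"
  unfolding symb.simps using assms by blast

lemma symb_weaken:
  assumes "symb b n \<Omega> K w h" "\<And>z. z \<in> \<Omega>' \<Longrightarrow> K * w z \<le> K' * w' z" "\<Omega>' \<subseteq> \<Omega>"
  shows "symb b n \<Omega>' K' w' h"
  using assms(1)
proof (induction n arbitrary: b h)
  case 0
  then show ?case using assms(2,3) by (auto intro: continuous_on_subset) (meson order_trans subsetD)
next
  case (Suc n)
  obtain h1 where h1: "\<And>x y. (x, y) \<in> \<Omega> \<Longrightarrow> ((\<lambda>t. h (t, y)) has_real_derivative h1 (x, y) / x) (at x)"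
    "symb False n \<Omega> K w h1" using symb_deriv1[OF Suc.prems] by blast
  have h2: "\<exists>h2. b \<longrightarrow> (\<forall>x y. (x, y) \<in> \<Omega> \<longrightarrow> ((\<lambda>t. h (x, t)) has_real_derivative h2 (x, y) / y) (at y)) \<and> symb True n \<Omega> K w h2"
    using Suc.prems by auto
  then obtain h2 where h2: "\<And>x y. b \<Longrightarrow> (x, y) \<in> \<Omega> \<Longrightarrow> ((\<lambda>t. h (x, t)) has_real_derivative h2 (x, y) / y) (at y)"
    "b \<Longrightarrow> symb True n \<Omega> K w h2" by blast
  show ?case
  proof (rule symb_SucI[where ?h1.0 = h1 and ?h2.0 = h2])
    show "continuous_on \<Omega>' h" using symb_cont[OF Suc.prems] assms(3) by (rule continuous_on_subset)
    show "\<bar>h z\<bar> \<le> K' * w' z" if "z \<in> \<Omega>'" for z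
      using symb_bound[OF Suc.prems, of z] assms(2)[OF that] that assms(3) by auto
  qed (use h1 h2 Suc.IH assms(3) in blast)+
qed

lemma symb_False: "symb b n \<Omega> K w h \<Longrightarrow> symb False n \<Omega> K w h"
  by (induction n arbitrary: b h) (auto; blast)+

lemma symb_Suc_imp: "symb b (Suc n) \<Omega> K w h \<Longrightarrow> symb b n \<Omega> K w h"
proof (induction n arbitrary: b h)
  case (Suc n)
  show ?case
    unfolding symb.simps(2)[of b n]
    using Suc.prems[unfolded symb.simps(2)[of b "Suc n"]] Suc.IH by blast
qed auto

lemma symb_le: "symb b n \<Omega> K w h \<Longrightarrow> m \<le> n \<Longrightarrow> symb b m \<Omega> K w h"
  by (induction n) (auto simp del: symb.simps simp: le_Suc_eq dest: symb_Suc_imp)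

lemma symb_add:
  assumes "symb b n \<Omega> K w h" "symb b n \<Omega> K' w h'"
  shows "symb b n \<Omega> (K + K') w (\<lambda>z. h z + h' z)"
  using assms
proof (induction n arbitrary: b h h')
  case 0
  then show ?case
    by (auto intro!: continuous_intros simp: distrib_right intro: order_trans[OF abs_triangle_ineq] add_mono)
next
  case (Suc n)
  obtain h1 where h1: "\<And>x y. (x, y) \<in> \<Omega> \<Longrightarrow> ((\<lambda>t. h (t, y)) has_real_derivative h1 (x, y) / x) (at x)"
    "symb False n \<Omega> K w h1" using symb_deriv1[OF Suc.prems(1)] by blast
  obtain h1' where h1': "\<And>x y. (x, y) \<in> \<Omega> \<Longrightarrow> ((\<lambda>t. h' (t, y)) has_real_derivative h1' (x, y) / x) (at x)"
    "symb False n \<Omega> K' w h1'" using symb_deriv1[OF Suc.prems(2)] by blast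
  obtain h2 where h2: "\<And>x y. b \<Longrightarrow> (x, y) \<in> \<Omega> \<Longrightarrow> ((\<lambda>t. h (x, t)) has_real_derivative h2 (x, y) / y) (at y)"
    "b \<Longrightarrow> symb True n \<Omega> K w h2" using Suc.prems(1) by (cases b) auto
  obtain h2' where h2': "\<And>x y. b \<Longrightarrow> (x, y) \<in> \<Omega> \<Longrightarrow> ((\<lambda>t. h' (x, t)) has_real_derivative h2' (x, y) / y) (at y)"
    "b \<Longrightarrow> symb True n \<Omega> K' w h2'" using Suc.prems(2) by (cases b) auto
  show ?case
  proof (rule symb_SucI)
    show "continuous_on \<Omega> (\<lambda>z. h z + h' z)"
      using Suc.prems by (intro continuous_on_add symb_cont)
    show "\<bar>h z + h' z\<bar> \<le> (K + K') * w z" if "z \<in> \<Omega>" for z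
      using symb_bound[OF Suc.prems(1) that] symb_bound[OF Suc.prems(2) that] by (simp add: distrib_right)
    show "symb False n \<Omega> (K + K') w (\<lambda>z. h1 z + h1' z)" by (rule Suc.IH[OF h1(2) h1'(2)])
    show "symb True n \<Omega> (K + K') w (\<lambda>z. h2 z + h2' z)" if b by (rule Suc.IH[OF h2(2)[OF that] h2'(2)[OF that]])
    show "((\<lambda>t. h (t, y) + h' (t, y)) has_real_derivative (h1 (x, y) + h1' (x, y)) / x) (at x)"
      if "(x, y) \<in> \<Omega>" for x y using DERIV_add[OF h1(1)[OF that] h1'(1)[OF that]] by (simp add: add_divide_distrib)
    show "((\<lambda>t. h (x, t) + h' (x, t)) has_real_derivative (h2 (x, y) + h2' (x, y)) / y) (at y)"
      if "b" "(x, y) \<in> \<Omega>" for x y using DERIV_add[OF h2(1)[OF that] h2'(1)[OF that]] by (simp add: add_divide_distrib)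
  qed
qed

text \<open>By the Leibniz rule a product has at most \<open>2 ^ n\<close> terms at order \<open>n\<close>,
  each bounded by the product of the bounds.\<close>
lemma symb_mult:
  assumes "symb b n \<Omega> K w h" "symb b n \<Omega> K' w' h'"
  shows "symb b n \<Omega> (2 ^ n * (K * K')) (\<lambda>z. w z * w' z) (\<lambda>z. h z * h' z)"
  using assms
proof (induction n arbitrary: b h h')
  case 0
  have "\<bar>h z * h' z\<bar> \<le> K * w z * (K' * w' z)" if "z \<in> \<Omega>" for z
    unfolding abs_mult using symb_bound[OF 0(1) that] symb_bound[OF 0(2) that] by (intro mult_mono) auto
  then show ?case using symb_cont[OF 0(1)] symb_cont[OF 0(2)]
    by (auto intro!: continuous_on_mult simp: mult_ac)
next
  case (Suc n)
  obtain h1 where h1: "\<And>x y. (x, y) \<in> \<Omega> \<Longrightarrow> ((\<lambda>t. h (t, y)) has_real_derivative h1 (x, y) / x) (at x)"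
    "symb False n \<Omega> K w h1" using symb_deriv1[OF Suc.prems(1)] by blast
  obtain h1' where h1': "\<And>x y. (x, y) \<in> \<Omega> \<Longrightarrow> ((\<lambda>t. h' (t, y)) has_real_derivative h1' (x, y) / x) (at x)"
    "symb False n \<Omega> K' w' h1'" using symb_deriv1[OF Suc.prems(2)] by blast
  obtain h2 where h2: "\<And>x y. b \<Longrightarrow> (x, y) \<in> \<Omega> \<Longrightarrow> ((\<lambda>t. h (x, t)) has_real_derivative h2 (x, y) / y) (at y)"
    "b \<Longrightarrow> symb True n \<Omega> K w h2" using Suc.prems(1) by (cases b) auto
  obtain h2' where h2': "\<And>x y. b \<Longrightarrow> (x, y) \<in> \<Omega> \<Longrightarrow> ((\<lambda>t. h' (x, t)) has_real_derivative h2' (x, y) / y) (at y)"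
    "b \<Longrightarrow> symb True n \<Omega> K' w' h2'" using Suc.prems(2) by (cases b) auto
  have P: "symb b n \<Omega> K w h" "symb b n \<Omega> K' w' h'"
    using Suc.prems by (auto dest!: symb_Suc_imp simp del: symb.simps)
  have two: "2 ^ n * (K * K') + 2 ^ n * (K * K') = 2 ^ Suc n * (K * K')" by simp
  show ?case
  proof (rule symb_SucI)
    show "continuous_on \<Omega> (\<lambda>z. h z * h' z)"
      using Suc.prems by (intro continuous_on_mult symb_cont)
    show "\<bar>h z * h' z\<bar> \<le> 2 ^ Suc n * (K * K') * (w z * w' z)" if "z \<in> \<Omega>" for z
    proof -
      have "\<bar>h z * h' z\<bar> \<le> K * w z * (K' * w' z)"
        unfolding abs_mult using symb_bound[OF P(1) that] symb_bound[OF P(2) that] by (intro mult_mono) auto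
      also have "0 \<le> K * w z * (K' * w' z)"
        by (rule mult_nonneg_nonneg[OF order_trans[OF abs_ge_zero symb_bound[OF P(1) that]]
              order_trans[OF abs_ge_zero symb_bound[OF P(2) that]]])
      then have "K * w z * (K' * w' z) \<le> 2 ^ Suc n * (K * w z * (K' * w' z))"
        using mult_right_mono[OF one_le_power[of "2::real" "Suc n"]] by fastforce
      finally show ?thesis by (simp add: mult_ac)
    qed
    show "symb False n \<Omega> (2 ^ Suc n * (K * K')) (\<lambda>z. w z * w' z) (\<lambda>z. h1 z * h' z + h z * h1' z)"
      unfolding two[symmetric] by (rule symb_add[OF Suc.IH[OF h1(2) symb_False[OF P(2)]] Suc.IH[OF symb_False[OF P(1)] h1'(2)]])
    show "symb True n \<Omega> (2 ^ Suc n * (K * K')) (\<lambda>z. w z * w' z) (\<lambda>z. h2 z * h' z + h z * h2' z)" if b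
      using P that unfolding two[symmetric]
      by (intro symb_add[OF Suc.IH[OF h2(2)[OF that]] Suc.IH[OF _ h2'(2)[OF that]]]) auto
    show "((\<lambda>t. h (t, y) * h' (t, y)) has_real_derivative (h1 (x, y) * h' (x, y) + h (x, y) * h1' (x, y)) / x) (at x)"
      if "(x, y) \<in> \<Omega>" for x y using DERIV_mult[OF h1(1)[OF that] h1'(1)[OF that]] by (simp add: add_divide_distrib mult_ac)
    show "((\<lambda>t. h (x, t) * h' (x, t)) has_real_derivative (h2 (x, y) * h' (x, y) + h (x, y) * h2' (x, y)) / y) (at y)"
      if "b" "(x, y) \<in> \<Omega>" for x y using DERIV_mult[OF h2(1)[OF that] h2'(1)[OF that]] by (simp add: add_divide_distrib mult_ac)
  qed
qed

lemma symb_const: "\<bar>c\<bar> \<le> K \<Longrightarrow> symb b n \<Omega> K (\<lambda>_. 1) (\<lambda>_. c)"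
proof (induction n arbitrary: b c)
  case (Suc n)
  show ?case
    by (rule symb_SucI[where ?h1.0 = "\<lambda>_. 0" and ?h2.0 = "\<lambda>_. 0"]) (use Suc Suc.IH[of 0] in auto)
qed auto

lemma symb_cmult:
  assumes "symb b n \<Omega> K w h"
  shows "symb b n \<Omega> (2 ^ n * (\<bar>c\<bar> * K)) w (\<lambda>z. c * h z)"
  using symb_mult[OF symb_const[of c "\<bar>c\<bar>" b n \<Omega>] assms] by simp

text \<open>A lower bound of the same size as the weight is what keeps the derivatives of the reciprocal under
  control: the Euler derivative of \<open>1 / f\<close> is \<open>- (1 / f) * (1 / f) * h1\<close>,
  of weight \<open>1 / w * (1 / w) * w\<close>.\<close>
lemma symb_inverse:
  assumes f: "symb b n \<Omega> K w f" and w: "\<And>z. z \<in> \<Omega> \<Longrightarrow> w z > 0"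
    and low: "\<And>z. z \<in> \<Omega> \<Longrightarrow> k * w z \<le> \<bar>f z\<bar>" and k: "k > 0"
  shows "\<exists>K'. symb b n \<Omega> K' (\<lambda>z. 1 / w z) (\<lambda>z. 1 / f z)"
  using f
proof (induction n arbitrary: b)
  have nz: "f z \<noteq> 0" if "z \<in> \<Omega>" for z using w[OF that] low[OF that] k by (smt (verit) mult_pos_pos)
  have bd: "\<bar>1 / f z\<bar> \<le> 1 / k * (1 / w z)" if "z \<in> \<Omega>" for z
    using low[OF that] w[OF that] k nz[OF that] by (simp add: divide_simps mult.commute)
  {
    case 0
    then show ?case using bd nz by (intro exI[of _ "1 / k"]) (auto intro!: continuous_intros)
  next
    case (Suc n)
    note P = symb_Suc_imp[OF Suc.prems]
    obtain K1 where K1: "symb b n \<Omega> K1 (\<lambda>z. 1 / w z) (\<lambda>z. 1 / f z)" using Suc.IH[OF P] by blast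
    have prod: "\<exists>K'. symb b' n \<Omega> K' (\<lambda>z. 1 / w z) (\<lambda>z. (- 1) * ((1 / f z) * (1 / f z) * g z))"
      if A: "symb b' n \<Omega> K w g" "symb b' n \<Omega> K1 (\<lambda>z. 1 / w z) (\<lambda>z. 1 / f z)" for b' g
    proof -
      obtain K2 where "symb b' n \<Omega> K2 (\<lambda>z. 1 / w z * (1 / w z) * w z) (\<lambda>z. (- 1) * ((1 / f z) * (1 / f z) * g z))"
        using symb_cmult[OF symb_mult[OF symb_mult[OF A(2) A(2)] A(1)]] by blast
      then have "symb b' n \<Omega> K2 (\<lambda>z. 1 / w z) (\<lambda>z. (- 1) * ((1 / f z) * (1 / f z) * g z))"
        by (rule symb_weaken) (use w in \<open>auto simp: less_imp_neq[symmetric]\<close>)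
      then show ?thesis by blast
    qed
    obtain h1 where h1: "\<And>x y. (x, y) \<in> \<Omega> \<Longrightarrow> ((\<lambda>t. f (t, y)) has_real_derivative h1 (x, y) / x) (at x)"
      "symb False n \<Omega> K w h1" using symb_deriv1[OF Suc.prems] by blast
    obtain h2 where h2: "\<And>x y. b \<Longrightarrow> (x, y) \<in> \<Omega> \<Longrightarrow> ((\<lambda>t. f (x, t)) has_real_derivative h2 (x, y) / y) (at y)"
      "b \<Longrightarrow> symb True n \<Omega> K w h2" using Suc.prems by (cases b) auto
    obtain L1 where L1: "symb False n \<Omega> L1 (\<lambda>z. 1 / w z) (\<lambda>z. (- 1) * ((1 / f z) * (1 / f z) * h1 z))"
      using prod[OF h1(2) symb_False[OF K1]] by blast
    obtain L2 where L2: "b \<Longrightarrow> symb True n \<Omega> L2 (\<lambda>z. 1 / w z) (\<lambda>z. (- 1) * ((1 / f z) * (1 / f z) * h2 z))"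
      using prod[OF h2(2)] K1 by (cases b) auto
    let ?K = "max (1 / k) (max L1 L2)"
    have mono: "L * (1 / w z) \<le> ?K * (1 / w z)" if "z \<in> \<Omega>" "L \<le> ?K" for z L
      using w[OF that(1)] that(2) by (intro mult_right_mono) auto
    have "symb b (Suc n) \<Omega> ?K (\<lambda>z. 1 / w z) (\<lambda>z. 1 / f z)"
    proof (rule symb_SucI)
      show "continuous_on \<Omega> (\<lambda>z. 1 / f z)" using symb_cont[OF P] nz by (intro continuous_intros) auto
      show "\<bar>1 / f z\<bar> \<le> ?K * (1 / w z)" if "z \<in> \<Omega>" for z
        using bd[OF that] mono[OF that, of "1 / k"] by simp
      show "symb False n \<Omega> ?K (\<lambda>z. 1 / w z) (\<lambda>z. (- 1) * ((1 / f z) * (1 / f z) * h1 z))"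
        by (rule symb_weaken[OF L1 mono]) auto
      show "symb True n \<Omega> ?K (\<lambda>z. 1 / w z) (\<lambda>z. (- 1) * ((1 / f z) * (1 / f z) * h2 z))" if b
        by (rule symb_weaken[OF L2[OF that] mono]) auto
      show "((\<lambda>t. 1 / f (t, y)) has_real_derivative (- 1) * ((1 / f (x, y)) * (1 / f (x, y)) * h1 (x, y)) / x) (at x)"
        if "(x, y) \<in> \<Omega>" for x y
        by (rule derivative_eq_intros h1(1)[OF that] refl)+ (use nz[OF that] in auto)
      show "((\<lambda>t. 1 / f (x, t)) has_real_derivative (- 1) * ((1 / f (x, y)) * (1 / f (x, y)) * h2 (x, y)) / y) (at y)"
        if b "(x, y) \<in> \<Omega>" for x y
        by (rule derivative_eq_intros h2(1)[OF that] refl)+ (use nz[OF that(2)] in auto)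
    qed
    then show ?case by blast
  }
qed

lemma DERIV_abs_powr:
  fixes f :: "real \<Rightarrow> real"
  assumes "(f has_real_derivative D) (at x)" "f x \<noteq> 0"
  shows "((\<lambda>t. \<bar>f t\<bar> powr s) has_real_derivative s * (\<bar>f x\<bar> powr s * (1 / f x) * D)) (at x)"
proof -
  have ev: "\<forall>\<^sub>F t in nhds x. sgn (f x) * f t > 0"
  proof (rule order_tendstoD)
    show "((\<lambda>t. sgn (f x) * f t) \<longlongrightarrow> sgn (f x) * f x) (nhds x)"
      using DERIV_isCont[OF assms(1)] by (intro tendsto_intros) (simp add: continuous_at_imp_continuous_at_within isCont_def tendsto_nhds_iff)
    show "0 < sgn (f x) * f x" using assms(2) by (simp add: sgn_if)
  qed
  then have eq: "\<forall>\<^sub>F t in nhds x. \<bar>f t\<bar> powr s = (sgn (f x) * f t) powr s"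
    by eventually_elim (use assms(2) in \<open>auto simp: sgn_if split: if_splits\<close>)
  have pos: "sgn (f x) * f x > 0" using assms(2) by (simp add: sgn_if)
  have "((\<lambda>t. (sgn (f x) * f t) powr s) has_real_derivative s * (\<bar>f x\<bar> powr s * (1 / f x) * D)) (at x)"
    by (rule derivative_eq_intros assms(1) pos refl)+
       (use assms(2) in \<open>auto simp: sgn_if powr_diff divide_simps split: if_splits\<close>)
  then show ?thesis by (subst DERIV_cong_ev[OF refl eq refl])
qed

text \<open>As for the reciprocal: the Euler derivative of \<open>\<bar>f\<bar> powr s\<close> is \<open>s *
  \<bar>f\<bar> powr s * (1 / f) * h1\<close>, of weight \<open>w powr s * (1 / w) * w\<close>.\<close>
lemma symb_abs_powr:
  assumes f: "symb b n \<Omega> K w f" and w: "\<And>z. z \<in> \<Omega> \<Longrightarrow> w z > 0"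
    and low: "\<And>z. z \<in> \<Omega> \<Longrightarrow> k * w z \<le> \<bar>f z\<bar>" and k: "k > 0"
  shows "\<exists>K'. symb b n \<Omega> K' (\<lambda>z. w z powr s) (\<lambda>z. \<bar>f z\<bar> powr s)"
  using f
proof (induction n arbitrary: b)
  have nz: "f z \<noteq> 0" if "z \<in> \<Omega>" for z using w[OF that] low[OF that] k by (smt (verit) mult_pos_pos)
  \<comment> \<open>For \<open>s \<ge> 0\<close> the upper bound on \<open>f\<close> is used, for
    \<open>s < 0\<close> the lower bound.\<close>
  define K0 where "K0 = max (\<bar>K\<bar> powr s) (k powr s)"
  have bd: "\<bar>\<bar>f z\<bar> powr s\<bar> \<le> K0 * w z powr s" if z: "z \<in> \<Omega>" for z
  proof (cases "s \<ge> 0")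
    case True
    have "\<bar>f z\<bar> \<le> \<bar>K\<bar> * w z" using symb_bound[OF f z] w[OF z] by (smt (verit) mult_right_mono)
    then have "\<bar>f z\<bar> powr s \<le> (\<bar>K\<bar> * w z) powr s" using True by (intro powr_mono2) auto
    also have "\<dots> = \<bar>K\<bar> powr s * w z powr s" using w[OF z] by (simp add: powr_mult)
    also have "\<dots> \<le> K0 * w z powr s" by (intro mult_right_mono) (auto simp: K0_def)
    finally show ?thesis by simp
  next
    case False
    have "\<bar>f z\<bar> powr s \<le> (k * w z) powr s"
      using False low[OF z] k w[OF z] by (intro powr_mono2') auto
    also have "\<dots> = k powr s * w z powr s" using w[OF z] k by (simp add: powr_mult)
    also have "\<dots> \<le> K0 * w z powr s" by (intro mult_right_mono) (auto simp: K0_def)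
    finally show ?thesis by simp
  qed
  {
    case 0
    then show ?case using bd nz by (intro exI[of _ K0]) (auto intro!: continuous_intros)
  next
    case (Suc n)
    note P = symb_Suc_imp[OF Suc.prems]
    obtain K1 where K1: "symb b n \<Omega> K1 (\<lambda>z. w z powr s) (\<lambda>z. \<bar>f z\<bar> powr s)" using Suc.IH[OF P] by blast
    obtain K2 where K2: "symb b n \<Omega> K2 (\<lambda>z. 1 / w z) (\<lambda>z. 1 / f z)"
      using symb_inverse[OF P w low k] by blast
    have prod: "\<exists>K'. symb b' n \<Omega> K' (\<lambda>z. w z powr s) (\<lambda>z. s * (\<bar>f z\<bar> powr s * (1 / f z) * g z))"
      if A: "symb b' n \<Omega> K w g" "symb b' n \<Omega> K1 (\<lambda>z. w z powr s) (\<lambda>z. \<bar>f z\<bar> powr s)"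
        "symb b' n \<Omega> K2 (\<lambda>z. 1 / w z) (\<lambda>z. 1 / f z)" for b' g
    proof -
      obtain K2 where "symb b' n \<Omega> K2 (\<lambda>z. w z powr s * (1 / w z) * w z) (\<lambda>z. s * (\<bar>f z\<bar> powr s * (1 / f z) * g z))"
        using symb_cmult[OF symb_mult[OF symb_mult[OF A(2) A(3)] A(1)]] by blast
      then have "symb b' n \<Omega> K2 (\<lambda>z. w z powr s) (\<lambda>z. s * (\<bar>f z\<bar> powr s * (1 / f z) * g z))"
        by (rule symb_weaken) (use w in \<open>auto simp: less_imp_neq[symmetric]\<close>)
      then show ?thesis by blast
    qed
    obtain h1 where h1: "\<And>x y. (x, y) \<in> \<Omega> \<Longrightarrow> ((\<lambda>t. f (t, y)) has_real_derivative h1 (x, y) / x) (at x)"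
      "symb False n \<Omega> K w h1" using symb_deriv1[OF Suc.prems] by blast
    obtain h2 where h2: "\<And>x y. b \<Longrightarrow> (x, y) \<in> \<Omega> \<Longrightarrow> ((\<lambda>t. f (x, t)) has_real_derivative h2 (x, y) / y) (at y)"
      "b \<Longrightarrow> symb True n \<Omega> K w h2" using Suc.prems by (cases b) auto
    obtain L1 where L1: "symb False n \<Omega> L1 (\<lambda>z. w z powr s) (\<lambda>z. s * (\<bar>f z\<bar> powr s * (1 / f z) * h1 z))"
      using prod[OF h1(2) symb_False[OF K1] symb_False[OF K2]] by blast
    obtain L2 where L2: "b \<Longrightarrow> symb True n \<Omega> L2 (\<lambda>z. w z powr s) (\<lambda>z. s * (\<bar>f z\<bar> powr s * (1 / f z) * h2 z))"
      using prod[OF h2(2)] K1 K2 by (cases b) auto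
    let ?K = "max K0 (max L1 L2)"
    have mono: "L * w z powr s \<le> ?K * w z powr s" if "L \<le> ?K" for z L
      using that by (intro mult_right_mono) auto
    have "symb b (Suc n) \<Omega> ?K (\<lambda>z. w z powr s) (\<lambda>z. \<bar>f z\<bar> powr s)"
    proof (rule symb_SucI)
      show "continuous_on \<Omega> (\<lambda>z. \<bar>f z\<bar> powr s)" using symb_cont[OF P] nz by (intro continuous_intros) auto
      show "\<bar>\<bar>f z\<bar> powr s\<bar> \<le> ?K * w z powr s" if "z \<in> \<Omega>" for z
        using bd[OF that] mono[of K0 z] by simp
      show "symb False n \<Omega> ?K (\<lambda>z. w z powr s) (\<lambda>z. s * (\<bar>f z\<bar> powr s * (1 / f z) * h1 z))"
        by (rule symb_weaken[OF L1 mono]) auto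
      show "symb True n \<Omega> ?K (\<lambda>z. w z powr s) (\<lambda>z. s * (\<bar>f z\<bar> powr s * (1 / f z) * h2 z))" if b
        by (rule symb_weaken[OF L2[OF that] mono]) auto
      show "((\<lambda>t. \<bar>f (t, y)\<bar> powr s) has_real_derivative s * (\<bar>f (x, y)\<bar> powr s * (1 / f (x, y)) * h1 (x, y)) / x) (at x)"
        if "(x, y) \<in> \<Omega>" for x y
        using DERIV_abs_powr[OF h1(1)[OF that] nz[OF that]] by (simp add: mult_ac)
      show "((\<lambda>t. \<bar>f (x, t)\<bar> powr s) has_real_derivative s * (\<bar>f (x, y)\<bar> powr s * (1 / f (x, y)) * h2 (x, y)) / y) (at y)"
        if b "(x, y) \<in> \<Omega>" for x y
        using DERIV_abs_powr[OF h2(1)[OF that] nz[OF that(2)]] by (simp add: mult_ac)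
    qed
    then show ?case by blast
  }
qed

text \<open>The series of the Euler derivative has the same exponents as the original one, whereas the series
  of the derivative has them shifted.\<close>
lemma psum_euler1:
  assumes "pconv c r" "\<bar>x\<bar> < r" "\<bar>y\<bar> < r"
  shows "((\<lambda>(i, j). real i * c i j * x ^ i * y ^ j) has_sum x * psum (pdiff1 c) (x, y)) UNIV"
proof -
  let ?g = "\<lambda>(i::nat, j::nat). (Suc i, j)"
  let ?t = "\<lambda>(i, j). real i * c i j * x ^ i * y ^ j"
  have "((\<lambda>(i, j). pdiff1 c i j * x ^ i * y ^ j) has_sum psum (pdiff1 c) (x, y)) UNIV"
    unfolding psum_def prod.case using pconv_pdiff1[OF assms(1)] assms(2,3)
    by (intro has_sum_infsum) (auto simp: pconv_def)
  then have "((\<lambda>p. x * (case p of (i, j) \<Rightarrow> pdiff1 c i j * x ^ i * y ^ j)) has_sum x * psum (pdiff1 c) (x, y)) UNIV"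
    by (rule has_sum_cmult_right)
  then have "((?t \<circ> ?g) has_sum x * psum (pdiff1 c) (x, y)) UNIV"
    by (rule has_sum_cong[THEN iffD1, rotated]) (auto simp: pdiff1_def)
  then have "(?t has_sum x * psum (pdiff1 c) (x, y)) (range ?g)"
    by (subst has_sum_reindex) (auto simp: inj_on_def)
  moreover have "?t p = 0" if "p \<notin> range ?g" for p
  proof (cases p)
    case (Pair i j)
    then have "i = 0" using that by (cases i) auto
    then show ?thesis by (simp add: Pair)
  qed
  ultimately show ?thesis
    by (elim has_sum_cong_neutral[THEN iffD1, rotated 3]) blast+
qed

lemma pconv_euler1:
  assumes "pconv c r"
  shows "pconv (\<lambda>i j. real i * c i j) r"
  unfolding pconv_def using psum_euler1[OF assms] by (auto simp: summable_on_def)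

lemma psum_euler1_deriv:
  assumes "pconv c r" "\<bar>x\<bar> < r" "\<bar>y\<bar> < r" "x \<noteq> 0"
  shows "((\<lambda>t. psum c (t, y)) has_real_derivative psum (\<lambda>i j. real i * c i j) (x, y) / x) (at x)"
proof -
  have "psum (\<lambda>i j. real i * c i j) (x, y) = x * psum (pdiff1 c) (x, y)"
    unfolding psum_def[of "\<lambda>i j. real i * c i j"] prod.case
    by (rule infsumI) (use psum_euler1[OF assms(1-3)] in simp)
  then show ?thesis using psum_deriv1[OF assms(1-3)] assms(4) by simp
qed

lemma pconv_euler2:
  assumes "pconv c r"
  shows "pconv (\<lambda>i j. real j * c i j) r"
proof -
  have "pconv (pswap (\<lambda>i j. real i * pswap c i j)) r"
    unfolding pconv_pswap by (rule pconv_euler1) (simp add: pconv_pswap assms)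
  then show ?thesis by (simp add: pswap_def[abs_def])
qed

lemma psum_euler2_deriv:
  assumes "pconv c r" "\<bar>x\<bar> < r" "\<bar>y\<bar> < r" "y \<noteq> 0"
  shows "((\<lambda>t. psum c (x, t)) has_real_derivative psum (\<lambda>i j. real j * c i j) (x, y) / y) (at y)"
proof -
  have "((\<lambda>t. psum (pswap c) (t, x)) has_real_derivative psum (\<lambda>i j. real i * pswap c i j) (y, x) / y) (at y)"
    by (rule psum_euler1_deriv) (use assms in \<open>auto simp: pconv_pswap\<close>)
  moreover have "psum (\<lambda>i j. real i * pswap c i j) (y, x) = psum (\<lambda>i j. real j * c i j) (x, y)"
    using psum_pswap[of "\<lambda>i j. real j * c i j" y x] by (simp add: pswap_def[abs_def])
  ultimately show ?thesis by (simp add: psum_pswap)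
qed

definition punctured_box :: "real \<Rightarrow> (real \<times> real) set" where
  "punctured_box \<delta> = {(x, y). 0 < \<bar>x\<bar> \<and> \<bar>x\<bar> < \<delta> \<and> 0 < \<bar>y\<bar> \<and> \<bar>y\<bar> < \<delta>}"

text \<open>The set \<open>S\<close> may be larger than the set of exponents of the series: the bound will be
  applied to Euler derivatives, with the vertices of the original series.\<close>
lemma psum_le_vertex_sum:
  assumes c: "pconv c r" "\<And>i j. c i j \<noteq> 0 \<Longrightarrow> (i, j) \<in> S" and \<delta>: "0 < \<delta>" "\<delta> < r" "\<delta> \<le> 1"
  shows "\<exists>K. \<forall>z\<in>punctured_box \<delta>. \<bar>psum c z\<bar> \<le> K * vertex_sum S z"
proof -
  obtain D where D: "\<And>a b. (a, b) \<in> vertices S \<Longrightarrow> a + b \<le> D"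
    using vertex_degree_bound by blast
  let ?T = "\<lambda>(i, j). \<bar>c i j * \<delta> ^ i * \<delta> ^ j\<bar>"
  have "(\<lambda>(i, j). c i j * \<delta> ^ i * \<delta> ^ j) summable_on UNIV" using c \<delta> by (simp add: pconv_def)
  then have T: "?T summable_on UNIV"
    using summable_on_iff_abs_summable_on_real[THEN iffD1] by (simp add: case_prod_unfold)
  show ?thesis
  proof (intro exI[of _ "infsum ?T UNIV / \<delta> ^ D"] ballI)
    fix z assume z: "z \<in> punctured_box \<delta>"
    obtain x y where xy: "z = (x, y)" by (cases z)
    let ?v = "vertex_sum S z / \<delta> ^ D"
    have le: "norm (case p of (i, j) \<Rightarrow> c i j * x ^ i * y ^ j) \<le> ?T p * ?v" for p
    proof (cases p)
      case (Pair i j)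
      show ?thesis
      proof (cases "c i j = 0")
        case False
        have "\<bar>x\<bar> ^ i * \<bar>y\<bar> ^ j \<le> \<delta> ^ (i + j) * ?v"
          unfolding xy by (rule monomial_dominated[OF D c(2)[OF False]]) (use z \<delta> xy in \<open>auto simp: punctured_box_def\<close>)
        then have "\<bar>c i j\<bar> * (\<bar>x\<bar> ^ i * \<bar>y\<bar> ^ j) \<le> \<bar>c i j\<bar> * (\<delta> ^ (i + j) * ?v)"
          by (rule mult_left_mono) auto
        then show ?thesis using Pair \<delta> by (simp add: abs_mult power_abs power_add mult_ac)
      qed (simp add: Pair)
    qed
    have "(\<lambda>(i, j). c i j * x ^ i * y ^ j) summable_on UNIV"
      using c(1) z \<delta> by (auto simp: xy pconv_def punctured_box_def)
    from norm_infsum_le[OF has_sum_infsum[OF this] has_sum_infsum[OF summable_on_cmult_left[OF T]] le]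
    have "norm (psum c z) \<le> (\<Sum>\<^sub>\<infinity>p\<in>UNIV. ?T p * ?v)"
      by (simp add: psum_def xy)
    also have "\<dots> = infsum ?T UNIV * ?v" by (rule infsum_cmult_left')
    finally show "\<bar>psum c z\<bar> \<le> infsum ?T UNIV / \<delta> ^ D * vertex_sum S z" by simp
  qed
qed

text \<open>The Weierstrass majorant is the series at the corner \<open>(\<delta>, \<delta>)\<close>.\<close>
lemma continuous_on_psum:
  assumes c: "pconv c r" and \<delta>: "\<delta> < r"
  shows "continuous_on (punctured_box \<delta>) (psum c)"
  unfolding continuous_on_sequentially
proof (intro ballI allI impI, elim conjE)
  fix u z assume u: "\<forall>n. u n \<in> punctured_box \<delta>" and z: "z \<in> punctured_box \<delta>" and lim: "u \<longlonglongrightarrow> z"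
  have \<delta>0: "\<delta> > 0" using z by (auto simp: punctured_box_def)
  have "(\<lambda>n. infsum (\<lambda>(i, j). c i j * fst (u n) ^ i * snd (u n) ^ j) UNIV)
     \<longlonglongrightarrow> infsum (\<lambda>(i, j). c i j * fst z ^ i * snd z ^ j) UNIV"
  proof (rule infsum_tannery)
    show "(\<lambda>n. case p of (i, j) \<Rightarrow> c i j * fst (u n) ^ i * snd (u n) ^ j)
        \<longlonglongrightarrow> (case p of (i, j) \<Rightarrow> c i j * fst z ^ i * snd z ^ j)" for p
      by (cases p) (auto intro!: tendsto_intros lim)
    show "\<bar>case p of (i, j) \<Rightarrow> c i j * fst (u n) ^ i * snd (u n) ^ j\<bar> \<le> (case p of (i, j) \<Rightarrow> \<bar>c i j * \<delta> ^ i * \<delta> ^ j\<bar>)" for n p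
    proof (cases p)
      case (Pair i j)
      have "\<bar>fst (u n)\<bar> ^ i * \<bar>snd (u n)\<bar> ^ j \<le> \<delta> ^ i * \<delta> ^ j"
        using u[rule_format, of n] \<delta>0 by (intro mult_mono power_mono) (auto simp: punctured_box_def case_prod_unfold)
      then have "\<bar>c i j\<bar> * (\<bar>fst (u n)\<bar> ^ i * \<bar>snd (u n)\<bar> ^ j) \<le> \<bar>c i j\<bar> * (\<delta> ^ i * \<delta> ^ j)"
        by (rule mult_left_mono) auto
      then show ?thesis using \<delta>0 by (simp add: Pair abs_mult power_abs mult_ac)
    qed
    have "(\<lambda>(i, j). c i j * \<delta> ^ i * \<delta> ^ j) summable_on UNIV" using c \<delta> \<delta>0 by (simp add: pconv_def)
    then show "(\<lambda>(i, j). \<bar>c i j * \<delta> ^ i * \<delta> ^ j\<bar>) summable_on UNIV"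
      using summable_on_iff_abs_summable_on_real[THEN iffD1] by (simp add: case_prod_unfold)
  qed
  then show "(psum c \<circ> u) \<longlonglongrightarrow> psum c z"
    by (simp add: psum_def o_def case_prod_unfold)
qed

text \<open>Euler derivatives of a power series are power series without new exponents, so that the bound by
  the same vertex sum applies to all of them.\<close>
lemma symb_psum:
  assumes c: "pconv c r" "\<And>i j. c i j \<noteq> 0 \<Longrightarrow> (i, j) \<in> S" and \<delta>: "0 < \<delta>" "\<delta> < r" "\<delta> \<le> 1"
  shows "\<exists>K. symb b n (punctured_box \<delta>) K (vertex_sum S) (psum c)"
  using c
proof (induction n arbitrary: b c)
  case 0
  then show ?case using psum_le_vertex_sum[OF 0 \<delta>] continuous_on_psum[OF 0(1) \<delta>(2)] by auto
next
  case (Suc n)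
  obtain K0 where K0: "\<And>z. z \<in> punctured_box \<delta> \<Longrightarrow> \<bar>psum c z\<bar> \<le> K0 * vertex_sum S z"
    using psum_le_vertex_sum[OF Suc.prems \<delta>] by blast
  obtain K1 where K1: "symb False n (punctured_box \<delta>) K1 (vertex_sum S) (psum (\<lambda>i j. real i * c i j))"
    using Suc.IH[OF pconv_euler1[OF Suc.prems(1)]] Suc.prems(2) by fastforce
  obtain K2 where K2: "symb True n (punctured_box \<delta>) K2 (vertex_sum S) (psum (\<lambda>i j. real j * c i j))"
    using Suc.IH[OF pconv_euler2[OF Suc.prems(1)]] Suc.prems(2) by fastforce
  let ?K = "max K0 (max K1 K2)"
  have mono: "K * vertex_sum S z \<le> ?K * vertex_sum S z" if "K \<le> ?K" for K z
    using that vertex_sum_nonneg by (rule mult_right_mono)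
  have "symb b (Suc n) (punctured_box \<delta>) ?K (vertex_sum S) (psum c)"
  proof (rule symb_SucI)
    show "continuous_on (punctured_box \<delta>) (psum c)" by (rule continuous_on_psum[OF Suc.prems(1) \<delta>(2)])
    show "\<bar>psum c z\<bar> \<le> ?K * vertex_sum S z" if "z \<in> punctured_box \<delta>" for z
      using K0[OF that] mono[of K0 z] by simp
    show "symb False n (punctured_box \<delta>) ?K (vertex_sum S) (psum (\<lambda>i j. real i * c i j))"
      by (rule symb_weaken[OF K1 mono]) auto
    show "symb True n (punctured_box \<delta>) ?K (vertex_sum S) (psum (\<lambda>i j. real j * c i j))"
      by (rule symb_weaken[OF K2 mono]) auto
  qed (use \<delta> Suc.prems in \<open>auto intro!: psum_euler1_deriv psum_euler2_deriv simp: punctured_box_def\<close>)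
  then show ?case by blast
qed

lemma smooth_on_partials:
  assumes "smooth_on S g"
  shows "smooth_on S (partials a b g)"
proof -
  have 1: "smooth_on S (partial1 g)" and 2: "smooth_on S (partial2 g)" if "smooth_on S g" for g
    using that unfolding smooth_on_def by (auto dest: spec[of _ "Suc _"])
  have "smooth_on S ((partial2 ^^ b) g)" by (induction b) (auto intro: assms 2)
  then have "smooth_on S ((partial1 ^^ a) ((partial2 ^^ b) g))" by (induction a) (auto intro: 1)
  then show ?thesis by (simp add: partials_def)
qed

lemma open_off_axes: "open off_axes"
proof -
  have "off_axes = (- {0}) \<times> (- {0})" by (auto simp: off_axes_def)
  moreover have "open ((- {0}) \<times> (- {0}) :: (real \<times> real) set)"
    by (intro open_Times open_Compl closed_singleton)
  ultimately show ?thesis by (simp only:)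
qed

lemma smooth_on_has_partials:
  assumes "smooth_on S g" "open S" "(x, y) \<in> S"
  shows "((\<lambda>t. g (t, y)) has_real_derivative partial1 g (x, y)) (at x)"
    and "((\<lambda>t. g (x, t)) has_real_derivative partial2 g (x, y)) (at y)"
proof -
  have "g differentiable_on S" using assms(1) unfolding smooth_on_def by (auto dest: spec[of _ "Suc 0"])
  then have d: "g differentiable at (x, y)"
    using assms by (simp add: differentiable_on_eq_differentiable_at)
  have "((\<lambda>t. (t, y)) has_derivative (\<lambda>t. (t, 0))) (at x)" "((\<lambda>t. (x, t)) has_derivative (\<lambda>t. (0, t))) (at y)"
    by (auto intro!: derivative_eq_intros)
  then have pair1: "(\<lambda>t. (t, y)) differentiable at x" and pair2: "(\<lambda>t. (x, t)) differentiable at y"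
    by (auto simp: differentiable_def)
  have "(\<lambda>t. g (t, y)) differentiable at x"
    using differentiable_chain_at[of "\<lambda>t. (t, y)" x g] d by (simp add: o_def pair1)
  then show "((\<lambda>t. g (t, y)) has_real_derivative partial1 g (x, y)) (at x)"
    by (simp add: partial1_apply DERIV_deriv_iff_real_differentiable)
  have "(\<lambda>t. g (x, t)) differentiable at y"
    using differentiable_chain_at[of "\<lambda>t. (x, t)" y g] d by (simp add: o_def pair2)
  then show "((\<lambda>t. g (x, t)) has_real_derivative partial2 g (x, y)) (at y)"
    by (simp add: partial2_apply DERIV_deriv_iff_real_differentiable)
qed

lemma smooth_on_continuous: "smooth_on S g \<Longrightarrow> continuous_on S g"
  unfolding smooth_on_def by (metis Ck_on.simps(1))

lemma partials_Suc1: "partials (Suc a) b g = partial1 (partials a b g)"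
  by (simp add: partials_def)

lemma partials_Suc2: "partials 0 (Suc b) g = partial2 (partials 0 b g)"
  by (simp add: partials_def)

text \<open>The Euler derivatives of \<open>x ^ a * y ^ b * partials a b \<phi>\<close> are combinations of
  functions of this form, all bounded because the powers of \<open>x\<close> and \<open>y\<close>
  compensate the allowed growth of the derivatives. The constant depends on the bounds for
  \<open>\<phi>\<close> only. For \<open>a > 0\<close> no further derivatives in \<open>y\<close>
  are available, which the flag of \<open>symb\<close> expresses.\<close>
lemma symb_amplitude:
  "\<exists>K. \<forall>\<phi>. admissible_amplitude U A B \<phi> \<longrightarrow>
     symb (a = 0) n off_axes K (\<lambda>_. 1) (\<lambda>(x, y). x ^ a * y ^ b * partials a b \<phi> (x, y))"
proof (induction n arbitrary: a b)
  have bd: "\<bar>x ^ a * y ^ b * partials a b \<phi> (x, y)\<bar> \<le> B a b" 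
    if adm: "admissible_amplitude U A B \<phi>" and z: "(x, y) \<in> off_axes" for a b \<phi> x y
  proof -
    have nz: "x \<noteq> 0" "y \<noteq> 0" using z by (auto simp: off_axes_def)
    have "\<bar>partials a b \<phi> (x, y)\<bar> \<le> B a b * \<bar>x\<bar> powr (- real a) * \<bar>y\<bar> powr (- real b)"
      using adm z unfolding admissible_amplitude_def by fast
    then have "\<bar>x\<bar> ^ a * \<bar>y\<bar> ^ b * \<bar>partials a b \<phi> (x, y)\<bar>
        \<le> \<bar>x\<bar> ^ a * \<bar>y\<bar> ^ b * (B a b * \<bar>x\<bar> powr (- real a) * \<bar>y\<bar> powr (- real b))"
      by (rule mult_left_mono) auto
    also have "\<dots> = B a b"
      using nz by (simp add: powr_minus powr_realpow field_simps)
    finally show ?thesis by (simp add: abs_mult power_abs)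
  qed
  have cont: "continuous_on off_axes (\<lambda>(x, y). x ^ a * y ^ b * partials a b \<phi> (x, y))"
    if "admissible_amplitude U A B \<phi>" for a b \<phi>
  proof -
    have "continuous_on off_axes (partials a b \<phi>)"
      using that by (intro smooth_on_continuous smooth_on_partials) (simp add: admissible_amplitude_def)
    then show ?thesis unfolding case_prod_unfold by (auto intro!: continuous_intros)
  qed
  {
    case 0
    show ?case by (rule exI[of _ "B a b"]) (use bd cont in auto)
  next
    case (Suc n)
    obtain K0 where K0: "\<And>\<phi>. admissible_amplitude U A B \<phi> \<Longrightarrow>
       symb (a = 0) n off_axes K0 (\<lambda>_. 1) (\<lambda>(x, y). x ^ a * y ^ b * partials a b \<phi> (x, y))" using Suc by blast
    obtain K1 where K1: "\<And>\<phi>. admissible_amplitude U A B \<phi> \<Longrightarrow>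
       symb (Suc a = 0) n off_axes K1 (\<lambda>_. 1) (\<lambda>(x, y). x ^ Suc a * y ^ b * partials (Suc a) b \<phi> (x, y))" using Suc by blast
    obtain K2 where K2: "\<And>\<phi>. admissible_amplitude U A B \<phi> \<Longrightarrow>
       symb (a = 0) n off_axes K2 (\<lambda>_. 1) (\<lambda>(x, y). x ^ a * y ^ Suc b * partials a (Suc b) \<phi> (x, y))" using Suc by blast
    let ?L1 = "2 ^ n * (\<bar>real a\<bar> * K0) + K1" and ?L2 = "2 ^ n * (\<bar>real b\<bar> * K0) + K2"
    let ?K = "max (B a b) (max ?L1 ?L2)"
    show ?case
    proof (intro exI[of _ ?K] allI impI)
      fix \<phi> assume adm: "admissible_amplitude U A B \<phi>"
      let ?h = "\<lambda>a b (x, y). x ^ a * y ^ b * partials a b \<phi> (x, y)"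
      have sm: "smooth_on off_axes (partials a b \<phi>)" for a b
        using adm by (intro smooth_on_partials) (simp add: admissible_amplitude_def)
      note D = smooth_on_has_partials[OF sm open_off_axes]
      show "symb (a = 0) (Suc n) off_axes ?K (\<lambda>_. 1) (?h a b)"
      proof (rule symb_SucI)
        show "continuous_on off_axes (?h a b)" by (rule cont[OF adm])
        show "\<bar>?h a b z\<bar> \<le> ?K * 1" if "z \<in> off_axes" for z
          using bd[OF adm, of "fst z" "snd z" a b] that by (auto simp: case_prod_unfold intro: max.coboundedI1)
        have "symb False n off_axes ?L1 (\<lambda>_. 1) (\<lambda>z. real a * ?h a b z + ?h (Suc a) b z)"
          by (rule symb_add[OF symb_cmult]) (use symb_False[OF K0[OF adm]] K1[OF adm] in auto)
        then show "symb False n off_axes ?K (\<lambda>_. 1) (\<lambda>z. real a * ?h a b z + ?h (Suc a) b z)"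
          by (rule symb_weaken) auto
        show "symb True n off_axes ?K (\<lambda>_. 1) (\<lambda>z. real b * ?h a b z + ?h a (Suc b) z)" if "a = 0"
        proof -
          have "symb True n off_axes ?L2 (\<lambda>_. 1) (\<lambda>z. real b * ?h a b z + ?h a (Suc b) z)"
            by (rule symb_add[OF symb_cmult]) (use K0[OF adm] K2[OF adm] that in auto)
          then show ?thesis by (rule symb_weaken) auto
        qed
        fix x y :: real assume z: "(x, y) \<in> off_axes"
        then have nz: "x \<noteq> 0" "y \<noteq> 0" by (auto simp: off_axes_def)
        have pow: "((\<lambda>t. t ^ k) has_real_derivative real k * t ^ k / t) (at t)" if "t \<noteq> 0" for k and t :: real
          by (rule DERIV_cong[OF DERIV_pow]) (use that in \<open>cases k; simp\<close>)
        show "((\<lambda>t. ?h a b (t, y)) has_real_derivative (real a * ?h a b (x, y) + ?h (Suc a) b (x, y)) / x) (at x)"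
          unfolding prod.case
          by (rule DERIV_cong[OF DERIV_mult[OF DERIV_cmult_right[OF pow[OF nz(1)]] D(1)[OF z]]])
             (use nz in \<open>simp add: partials_Suc1 field_simps\<close>)
        show "((\<lambda>t. ?h a b (x, t)) has_real_derivative (real b * ?h a b (x, y) + ?h a (Suc b) (x, y)) / y) (at y)"
          if "a = 0"
          unfolding prod.case
          by (rule DERIV_cong[OF DERIV_mult[OF DERIV_cmult[OF pow[OF nz(2)]] D(2)[OF z]]])
             (use nz that in \<open>simp add: partials_Suc2 field_simps\<close>)
      qed
    qed
  }
qed

section \<open>Oscillatory integrals in one variable\<close>

text \<open>Slow variation on multiplicative scales. The bound is required in both directions, because the
  weights are powers of \<open>fstar f\<close> with exponents of either sign.\<close>
definition moderate :: "nat \<Rightarrow> real \<Rightarrow> (real \<Rightarrow> real) \<Rightarrow> bool" where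
  "moderate M R w \<longleftrightarrow> (\<forall>x\<in>{0<..<R}. w x > 0) \<and> (\<forall>x x'. 0 < x \<and> x \<le> x' \<and> x' < R \<longrightarrow>
     w x' \<le> (x' / x) ^ M * w x \<and> w x \<le> (x' / x) ^ M * w x')"

text \<open>The one-variable form of \<open>symb\<close>, with complex values, since partial Fourier integrals
  are complex.\<close>
fun sym1 :: "nat \<Rightarrow> real \<Rightarrow> real \<Rightarrow> (real \<Rightarrow> real) \<Rightarrow> (real \<Rightarrow> complex) \<Rightarrow> bool" where
  "sym1 0 R K w h \<longleftrightarrow> continuous_on {0<..<R} h \<and> (\<forall>x\<in>{0<..<R}. norm (h x) \<le> K * w x)"
| "sym1 (Suc n) R K w h \<longleftrightarrow> continuous_on {0<..<R} h \<and> (\<forall>x\<in>{0<..<R}. norm (h x) \<le> K * w x) \<and>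
     (\<exists>h1. (\<forall>x\<in>{0<..<R}. (h has_vector_derivative h1 x / of_real x) (at x)) \<and> sym1 n R K w h1)"

lemma sym1_cont: "sym1 n R K w h \<Longrightarrow> continuous_on {0<..<R} h"
  by (cases n) auto

lemma sym1_bound: "sym1 n R K w h \<Longrightarrow> x \<in> {0<..<R} \<Longrightarrow> norm (h x) \<le> K * w x"
  by (cases n) auto

lemma sym1_SucI:
  assumes "continuous_on {0<..<R} h" "\<And>x. x \<in> {0<..<R} \<Longrightarrow> norm (h x) \<le> K * w x"
    "\<And>x. x \<in> {0<..<R} \<Longrightarrow> (h has_vector_derivative h1 x / of_real x) (at x)" "sym1 n R K w h1"
  shows "sym1 (Suc n) R K w h"
  unfolding sym1.simps using assms by blast

lemma sym1_SucE:
  assumes "sym1 (Suc n) R K w h"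
  obtains h1 where "\<And>x. x \<in> {0<..<R} \<Longrightarrow> (h has_vector_derivative h1 x / of_real x) (at x)" "sym1 n R K w h1"
  using assms unfolding sym1.simps by blast

lemma sym1_Suc_imp: "sym1 (Suc n) R K w h \<Longrightarrow> sym1 n R K w h"
proof (induction n arbitrary: h)
  case (Suc n)
  show ?case unfolding sym1.simps(2)[of n]
    using Suc.prems[unfolded sym1.simps(2)[of "Suc n"]] Suc.IH by blast
qed auto

lemma sym1_diff_scaled:
  assumes "sym1 n R K w h" "sym1 n R K w g"
  shows "sym1 n R ((1 + real m) * K) w (\<lambda>x. g x - of_nat m * h x)"
  using assms
proof (induction n arbitrary: h g)
  have bd: "norm (g x - of_nat m * h x) \<le> (1 + real m) * K * w x"
    if "sym1 n R K w h" "sym1 n R K w g" "x \<in> {0<..<R}" for n h g x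
  proof -
    have "norm (g x - of_nat m * h x) \<le> norm (g x) + real m * norm (h x)"
      using norm_triangle_ineq4[of "g x" "of_nat m * h x"] by (simp add: norm_mult)
    also have "\<dots> \<le> K * w x + real m * (K * w x)"
      by (intro add_mono mult_left_mono sym1_bound[OF that(1,3)] sym1_bound[OF that(2,3)]) auto
    finally show ?thesis by (simp add: algebra_simps)
  qed
  {
    case 0
    then show ?case using bd[OF 0] by (auto intro!: continuous_intros)
  next
    case (Suc n)
    obtain h1 where h1: "\<And>x. x \<in> {0<..<R} \<Longrightarrow> (h has_vector_derivative h1 x / of_real x) (at x)" "sym1 n R K w h1"
      using sym1_SucE[OF Suc.prems(1)] by blast
    obtain g1 where g1: "\<And>x. x \<in> {0<..<R} \<Longrightarrow> (g has_vector_derivative g1 x / of_real x) (at x)" "sym1 n R K w g1"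
      using sym1_SucE[OF Suc.prems(2)] by blast
    show ?case
    proof (rule sym1_SucI[OF _ bd[OF Suc.prems] _ Suc.IH[OF h1(2) g1(2)]])
      show "continuous_on {0<..<R} (\<lambda>x. g x - of_nat m * h x)"
        using sym1_cont Suc.prems by (intro continuous_intros) blast+
      fix x assume x: "x \<in> {0<..<R}"
      show "((\<lambda>x. g x - of_nat m * h x) has_vector_derivative (g1 x - of_nat m * h1 x) / of_real x) (at x)"
        using has_vector_derivative_diff[OF g1(1)[OF x] has_vector_derivative_mult_right[OF h1(1)[OF x], of "of_nat m"]]
        by (simp add: diff_divide_distrib)
    qed
  }
qed

text \<open>Functions that vanish on an interval have derivative zero there, including its closed left end
  point: this keeps the condition on the support when a function is replaced by a derivative.\<close>
lemma vector_derivative_zero_right: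
  fixes h :: "real \<Rightarrow> 'a::real_normed_vector"
  assumes D: "(h has_vector_derivative D) (at x)" and z: "\<And>t. x \<le> t \<Longrightarrow> t < b \<Longrightarrow> h t = 0" and "x < b"
  shows "D = 0"
proof -
  have "((\<lambda>y. norm ((h y - h x) - (y - x) *\<^sub>R D) / norm (y - x)) \<longlongrightarrow> 0) (at x within {x<..})"
    using has_vector_derivative_at_within[OF D, of "{x<..}"]
    unfolding has_vector_derivative_def has_derivative_iff_norm by auto
  moreover have "\<forall>\<^sub>F y in at_right x. norm ((h y - h x) - (y - x) *\<^sub>R D) / norm (y - x) = norm D"
    using eventually_at_right_real[OF \<open>x < b\<close>]
    by eventually_elim (use z \<open>x < b\<close> in \<open>auto simp: norm_minus_commute\<close>)
  ultimately have "((\<lambda>y. norm D) \<longlongrightarrow> 0) (at_right x)"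
    using tendsto_cong by fastforce
  then show "D = 0" by (simp add: tendsto_const_iff)
qed

lemma sym1_deriv_vanishes:
  assumes h1: "\<And>x. x \<in> {0<..<R} \<Longrightarrow> (h has_vector_derivative h1 x / complex_of_real x) (at x)"
    and van: "\<And>x. \<delta> \<le> x \<Longrightarrow> x < R \<Longrightarrow> h x = 0" and x: "0 < \<delta>" "\<delta> \<le> x" "x < R"
  shows "h1 x = 0"
proof -
  have "h1 x / complex_of_real x = 0"
    by (rule vector_derivative_zero_right[OF h1, where b = R]) (use van x in auto)
  then show ?thesis using x by simp
qed

definition expi :: "real \<Rightarrow> real \<Rightarrow> complex" where
  "expi l x = exp (- \<i> * of_real (l * x))"

lemma norm_expi [simp]: "norm (expi l x) = 1"
  by (simp add: expi_def norm_exp_eq_Re)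

lemma expi_deriv: "(expi l has_vector_derivative (- \<i> * of_real l * expi l x)) (at x)"
  unfolding expi_def has_vector_derivative_complex_iff
  by (auto intro!: derivative_eq_intros simp: Re_exp Im_exp has_real_derivative_iff_has_vector_derivative[symmetric])

lemma continuous_on_expi [continuous_intros]: "continuous_on S (expi l)"
  unfolding expi_def by (intro continuous_intros)

text \<open>The tail of the oscillatory integral, by induction on the number \<open>n\<close> of derivatives
  left. One integration by parts trades a derivative for a power of \<open>1 / x\<close>,
  \<open>h\<close> being replaced by \<open>h1 - m * h\<close>, and the boundary term at \<open>1 /
  \<bar>l\<bar>\<close> has the size of the claimed bound. Once all derivatives are spent, \<open>n
  + m \<ge> M + 2\<close> says that the power \<open>1 / x ^ m\<close> outweighs the possible growth
  \<open>x ^ M\<close> of the weight by \<open>1 / x ^ 2\<close>, which is integrable.\<close>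
lemma oscillatory_tail_bound:
  assumes "n + m \<ge> M + 2"
  shows "\<exists>C\<ge>0. \<forall>K w h R \<delta> l. moderate M R w \<longrightarrow> l \<noteq> 0 \<longrightarrow> 1 / \<bar>l\<bar> \<le> \<delta> \<longrightarrow> \<delta> < R \<longrightarrow> sym1 n R K w h \<longrightarrow>
    (\<forall>x. \<delta> \<le> x \<longrightarrow> x < R \<longrightarrow> h x = 0) \<longrightarrow>
    norm (integral {1 / \<bar>l\<bar>..\<delta>} (\<lambda>x. h x / of_real x ^ m * expi l x)) \<le> C * K * w (1 / \<bar>l\<bar>) * \<bar>l\<bar> ^ m / \<bar>l\<bar>"
  using assms
proof (induction n arbitrary: m)
  case 0
  show ?case
  proof (intro exI[of _ 1] conjI allI impI)
    fix K w h R \<delta> l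
    assume w: "moderate M R w" and l: "l \<noteq> 0" "1 / \<bar>l\<bar> \<le> \<delta>" "\<delta> < R" and h: "sym1 0 R K w h"
    define a where "a = 1 / \<bar>l\<bar>"
    have a: "a > 0" "a \<le> \<delta>" "\<bar>l\<bar> = 1 / a" using l by (auto simp: a_def)
    have sub: "{a..\<delta>} \<subseteq> {0<..<R}" using a l by auto
    have K: "K \<ge> 0"
      using order_trans[OF norm_ge_zero sym1_bound[OF h, of a]] w a l unfolding moderate_def
      by (auto simp: zero_le_mult_iff) (smt (verit, best) greaterThanLessThan_iff)
    have wa: "w a > 0" using w a l by (auto simp: moderate_def)
    have "norm (integral {a..\<delta>} (\<lambda>x. h x / of_real x ^ m * expi l x)) \<le> integral {a..\<delta>} (\<lambda>x. K * w a * a ^ 2 / a ^ m * x powr (-2))"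
    proof (rule integral_norm_bound_integral)
      show "(\<lambda>x. h x / of_real x ^ m * expi l x) integrable_on {a..\<delta>}"
        using continuous_on_subset[OF sym1_cont[OF h] sub] sub
        by (intro integrable_continuous_interval continuous_intros) auto
      show "(\<lambda>x. K * w a * a ^ 2 / a ^ m * x powr (-2)) integrable_on {a..\<delta>}"
        using a by (intro integrable_continuous_interval continuous_intros) auto
      fix x assume x: "x \<in> {a..\<delta>}"
      have x0: "x > 0" using x a by auto
      have "norm (h x) \<le> K * w x" using sym1_bound[OF h] x sub by blast
      also have "\<dots> \<le> K * ((x / a) ^ M * w a)"
        using w x a l K unfolding moderate_def by (intro mult_left_mono) auto
      finally have 1: "norm (h x) \<le> K * w a * (x / a) ^ M" by (simp add: mult_ac)
      have "(x / a) ^ M * (x / a) ^ 2 \<le> (x / a) ^ m"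
        using x a 0 by (subst power_add[symmetric], intro power_increasing) auto
      then have 2: "(x / a) ^ M / x ^ m \<le> a ^ 2 / a ^ m * (1 / x ^ 2)"
        using x0 a by (simp add: power_divide field_simps)
      have "norm (h x / of_real x ^ m * expi l x) = norm (h x) / x ^ m"
        using x0 by (simp add: norm_mult norm_divide norm_power)
      also have "\<dots> \<le> K * w a * (x / a) ^ M / x ^ m" using 1 x0 by (intro divide_right_mono) auto
      also have "\<dots> = K * w a * ((x / a) ^ M / x ^ m)" by simp
      also have "\<dots> \<le> K * w a * (a ^ 2 / a ^ m * (1 / x ^ 2))"
        using 2 K wa by (intro mult_left_mono) auto
      finally show "norm (h x / of_real x ^ m * expi l x) \<le> K * w a * a ^ 2 / a ^ m * x powr (-2)"
        using x0 by (simp add: powr_minus powr_numeral divide_inverse mult_ac)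
    qed
    also have "\<dots> = K * w a * a ^ 2 / a ^ m * integral {a..\<delta>} (\<lambda>x. x powr (-2))"
      by (simp add: integral_mult_right)
    also have "integral {a..\<delta>} (\<lambda>x. x powr (-2)) = 1 / a - 1 / \<delta>"
    proof (rule integral_unique)
      have "((\<lambda>x. x powr (-2)) has_integral (- (1 / \<delta>)) - (- (1 / a))) {a..\<delta>}"
        by (rule fundamental_theorem_of_calculus[OF a(2)])
           (use a in \<open>auto intro!: derivative_eq_intros simp: has_real_derivative_iff_has_vector_derivative[symmetric] powr_minus powr_numeral power2_eq_square field_simps\<close>)
      then show "((\<lambda>x. x powr (-2)) has_integral 1 / a - 1 / \<delta>) {a..\<delta>}" by simp
    qed
    also have "K * w a * a ^ 2 / a ^ m * (1 / a - 1 / \<delta>) \<le> K * w a * a ^ 2 / a ^ m * (1 / a)"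
      using a K wa by (intro mult_left_mono) simp_all
    also have "\<dots> = 1 * K * w a * \<bar>l\<bar> ^ m / \<bar>l\<bar>" using a by (simp add: a(3) power_divide power2_eq_square)
    finally show "norm (integral {1 / \<bar>l\<bar>..\<delta>} (\<lambda>x. h x / of_real x ^ m * expi l x)) \<le> 1 * K * w (1 / \<bar>l\<bar>) * \<bar>l\<bar> ^ m / \<bar>l\<bar>"
      by (simp add: a_def)
  qed auto
next
  case (Suc n)
  then obtain C where C: "C \<ge> 0" "\<And>K w h R \<delta> l. moderate M R w \<Longrightarrow> l \<noteq> 0 \<Longrightarrow> 1 / \<bar>l\<bar> \<le> \<delta> \<Longrightarrow> \<delta> < R \<Longrightarrow> sym1 n R K w h \<Longrightarrow>
    (\<And>x. \<delta> \<le> x \<Longrightarrow> x < R \<Longrightarrow> h x = 0) \<Longrightarrow>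
    norm (integral {1 / \<bar>l\<bar>..\<delta>} (\<lambda>x. h x / of_real x ^ Suc m * expi l x)) \<le> C * K * w (1 / \<bar>l\<bar>) * \<bar>l\<bar> ^ Suc m / \<bar>l\<bar>"
    using Suc.IH[of "Suc m"] by auto
  show ?case
  proof (intro exI[of _ "1 + C * (1 + real m)"] conjI allI impI)
    fix K w h R \<delta> l
    assume w: "moderate M R w" and l: "l \<noteq> 0" "1 / \<bar>l\<bar> \<le> \<delta>" "\<delta> < R" and h: "sym1 (Suc n) R K w h"
      and van: "\<forall>x. \<delta> \<le> x \<longrightarrow> x < R \<longrightarrow> h x = 0"
    define a where "a = 1 / \<bar>l\<bar>"
    have a: "a > 0" "a \<le> \<delta>" "\<bar>l\<bar> = 1 / a" using l by (auto simp: a_def)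
    have sub: "{a..\<delta>} \<subseteq> {0<..<R}" using a l by auto
    obtain h1 where h1: "\<And>x. x \<in> {0<..<R} \<Longrightarrow> (h has_vector_derivative h1 x / of_real x) (at x)" "sym1 n R K w h1"
      using sym1_SucE[OF h] by blast
    define g where "g x = h1 x - of_nat m * h x" for x
    have g: "sym1 n R ((1 + real m) * K) w g"
      unfolding g_def by (rule sym1_diff_scaled[OF sym1_Suc_imp[OF h] h1(2)])
    have van1: "g x = 0" if "\<delta> \<le> x" "x < R" for x
      using sym1_deriv_vanishes[OF h1(1), of R \<delta> x] van that a by (simp add: g_def)
    have IH: "norm (integral {a..\<delta>} (\<lambda>x. g x / of_real x ^ Suc m * expi l x))
        \<le> C * ((1 + real m) * K) * w a * \<bar>l\<bar> ^ Suc m / \<bar>l\<bar>"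
      unfolding a_def by (rule C(2)[OF w l g van1])
    have "C * ((1 + real m) * K) * w a * \<bar>l\<bar> ^ Suc m / \<bar>l\<bar> = C * (1 + real m) * K * w a * \<bar>l\<bar> ^ m"
      using l by simp
    note IH = IH[unfolded this]
    let ?P = "\<lambda>x. h x / of_real x ^ m * expi l x"
    let ?I = "\<lambda>x. g x / of_real x ^ Suc m * expi l x"
    have int: "?P integrable_on {a..\<delta>}" "?I integrable_on {a..\<delta>}"
      using continuous_on_subset[OF sym1_cont[OF h] sub] continuous_on_subset[OF sym1_cont[OF g] sub] sub
      by (intro integrable_continuous_interval continuous_intros; auto)+
    \<comment> \<open>The integration by parts: \<open>?P\<close> has derivative \<open>?I - \<i> * l *
      ?P\<close>.\<close>
    have "((\<lambda>x. ?I x - \<i> * of_real l * ?P x) has_integral ?P \<delta> - ?P a) {a..\<delta>}"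
    proof (rule fundamental_theorem_of_calculus[OF a(2)])
      fix x assume x: "x \<in> {a..\<delta>}"
      then have x0: "x > 0" "x \<in> {0<..<R}" using a sub by auto
      have "((\<lambda>x. inverse (x ^ m)) has_real_derivative - (real m / x ^ Suc m)) (at x)"
        by (rule DERIV_cong[OF DERIV_inverse_fun[OF DERIV_pow]])
           (use x0 in \<open>cases m; simp add: field_simps power2_eq_square\<close>)+
      then have "((\<lambda>x. complex_of_real (inverse (x ^ m))) has_vector_derivative complex_of_real (- (real m / x ^ Suc m))) (at x)"
        by (intro has_vector_derivative_of_real) (simp add: has_real_derivative_iff_has_vector_derivative)
      note D = has_vector_derivative_mult[OF has_vector_derivative_mult[OF h1(1)[OF x0(2)] this] expi_deriv[of l]]
      have eq1: "h t * complex_of_real (inverse (t ^ m)) * expi l t = ?P t" for t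
        by (simp add: divide_inverse)
      have eq2: "h x * complex_of_real (inverse (x ^ m)) * (- \<i> * of_real l * expi l x) +
          (h x * complex_of_real (- (real m / x ^ Suc m)) + h1 x / of_real x * complex_of_real (inverse (x ^ m))) * expi l x
        = ?I x - \<i> * of_real l * ?P x"
        by (simp add: g_def divide_inverse algebra_simps)
      show "(?P has_vector_derivative ?I x - \<i> * of_real l * ?P x) (at x within {a..\<delta>})"
        by (rule has_vector_derivative_at_within) (rule D[unfolded eq1 eq2])
    qed
    then have "integral {a..\<delta>} (\<lambda>x. ?I x - \<i> * of_real l * ?P x) = ?P \<delta> - ?P a" by (rule integral_unique)
    then have "integral {a..\<delta>} ?I - \<i> * of_real l * integral {a..\<delta>} ?P = ?P \<delta> - ?P a"
      by (subst (asm) integral_diff[OF int(2) integrable_on_mult_right[OF int(1)]])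
         (simp only: integral_mult_right)
    moreover have "?P \<delta> = 0" using van a l by simp
    ultimately have "\<i> * of_real l * integral {a..\<delta>} ?P = integral {a..\<delta>} ?I + ?P a"
      by (simp add: algebra_simps)
    then have "norm (\<i> * of_real l * integral {a..\<delta>} ?P) = norm (integral {a..\<delta>} ?I + ?P a)"
      by (rule arg_cong)
    moreover have "norm (\<i> * of_real l * z) = \<bar>l\<bar> * norm z" for z by (simp add: norm_mult)
    ultimately have "\<bar>l\<bar> * norm (integral {a..\<delta>} ?P) = norm (integral {a..\<delta>} ?I + ?P a)"
      by (simp only:)
    also have "\<dots> \<le> norm (integral {a..\<delta>} ?I) + norm (?P a)" by (rule norm_triangle_ineq)
    also have "norm (?P a) \<le> K * w a * \<bar>l\<bar> ^ m"
      using sym1_bound[OF h, of a] a l by (auto simp: norm_mult norm_divide norm_power power_divide a(3) divide_right_mono)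
    finally have "\<bar>l\<bar> * norm (integral {a..\<delta>} ?P) \<le> (1 + C * (1 + real m)) * K * w a * \<bar>l\<bar> ^ m"
      using IH by (simp add: algebra_simps)
    then show "norm (integral {1 / \<bar>l\<bar>..\<delta>} ?P) \<le> (1 + C * (1 + real m)) * K * w (1 / \<bar>l\<bar>) * \<bar>l\<bar> ^ m / \<bar>l\<bar>"
      using l by (simp add: a_def pos_le_divide_eq mult_ac)
  qed (use C in auto)
qed

lemma moderate_pos: "moderate M R w \<Longrightarrow> 0 < x \<Longrightarrow> x < R \<Longrightarrow> w x > 0"
  by (simp add: moderate_def)

lemma moderate_upper: "moderate M R w \<Longrightarrow> 0 < x \<Longrightarrow> x \<le> x' \<Longrightarrow> x' < R \<Longrightarrow> w x' \<le> (x' / x) ^ M * w x"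
  by (simp add: moderate_def)

lemma moderate_lower: "moderate M R w \<Longrightarrow> 0 < x \<Longrightarrow> x \<le> x' \<Longrightarrow> x' < R \<Longrightarrow> w x \<le> (x' / x) ^ M * w x'"
  by (simp add: moderate_def)

text \<open>On \<open>{a/2<..<a}\<close> the weight is at least \<open>w a / 2 ^ M\<close>.\<close>
lemma moderate_le_average:
  assumes w: "moderate M R w" and a: "0 < a" "a < R" and int: "set_integrable lborel {0<..<a} w"
  shows "a * w a \<le> 2 ^ Suc M * (LINT x:{0<..<a}|lborel. w x)"
proof -
  have sub: "set_integrable lborel {a/2<..<a} w"
    by (rule set_integrable_subset[OF int]) (use a in auto)
  have "(a / 2) * (w a / 2 ^ M) = (LINT x:{a/2<..<a}|lborel. w a / 2 ^ M)"
    using a by (simp add: set_integral_const)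
  also have "\<dots> \<le> (LINT x:{a/2<..<a}|lborel. w x)"
  proof (rule set_integral_mono[OF _ sub])
    show "set_integrable lborel {a/2<..<a} (\<lambda>x. w a / 2 ^ M)"
      unfolding set_integrable_def using a by (intro integrable_scaleR_left integrable_real_indicator) auto
    fix x assume x: "x \<in> {a/2<..<a}"
    then have x0: "0 < x" using a by auto
    have "w a \<le> (a / x) ^ M * w x" by (rule moderate_upper[OF w]) (use x x0 a in auto)
    also have "\<dots> \<le> 2 ^ M * w x"
      using x x0 a moderate_pos[OF w x0] by (intro mult_right_mono power_mono) (auto simp: field_simps)
    finally show "w a / 2 ^ M \<le> w x" by (simp add: divide_le_eq mult.commute)
  qed
  also have "\<dots> \<le> (LINT x:{0<..<a}|lborel. w x)"
  proof -
    have "(LINT x|lborel. indicator {a/2<..<a} x *\<^sub>R w x) \<le> (LINT x|lborel. indicator {0<..<a} x *\<^sub>R w x)"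
    proof (rule integral_mono)
      show "integrable lborel (\<lambda>x. indicator {a/2<..<a} x *\<^sub>R w x)" "integrable lborel (\<lambda>x. indicator {0<..<a} x *\<^sub>R w x)"
        using sub int by (simp_all add: set_integrable_def)
      show "indicator {a/2<..<a} x *\<^sub>R w x \<le> indicator {0<..<a} x *\<^sub>R w x" for x
        using a moderate_pos[OF w, of x] by (auto simp: indicator_def)
    qed
    then show ?thesis by (simp add: set_lebesgue_integral_def)
  qed
  finally show ?thesis by (simp add: field_simps)
qed

lemma set_borel_measurable_continuous_on_open:
  fixes f :: "'a::euclidean_space \<Rightarrow> 'b::real_normed_vector"
  assumes "open A" "continuous_on A f"
  shows "set_borel_measurable lborel A f"
  unfolding set_borel_measurable_def
  using borel_measurable_continuous_on_indicator[OF _ assms(2)] assms(1) by simp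

text \<open>The side of the part of the dual box inside a box of side \<open>\<delta>\<close>, with \<open>1 /
  0\<close> read as infinity.\<close>
definition cutoff :: "real \<Rightarrow> real \<Rightarrow> real" where
  "cutoff \<delta> l = (if l = 0 then \<delta> else min \<delta> (1 / \<bar>l\<bar>))"

lemma cutoff_bounds: "0 < \<delta> \<Longrightarrow> 0 < cutoff \<delta> l" "cutoff \<delta> l \<le> \<delta>"
  by (auto simp: cutoff_def)

text \<open>The integral is split at \<open>1 / \<bar>l\<bar>\<close>. On the left absolute values suffice,
  and the tail bound \<open>w a * a\<close> with \<open>a = 1 / \<bar>l\<bar>\<close> is at most a
  multiple of the integral of \<open>w\<close> up to \<open>a\<close>. The function lives on a
  larger interval than its support, so that no boundary term arises at \<open>\<delta>\<close>.\<close>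
lemma oscillatory_bound_1d:
  "\<exists>C\<ge>0. \<forall>K w h R \<delta> l. moderate M R w \<longrightarrow> 0 < \<delta> \<longrightarrow> \<delta> < R \<longrightarrow> set_integrable lborel {0<..<\<delta>} w \<longrightarrow>
     sym1 (M + 2) R K w h \<longrightarrow> (\<forall>x. \<delta> \<le> x \<longrightarrow> x < R \<longrightarrow> h x = 0) \<longrightarrow>
     set_integrable lborel {0<..<\<delta>} (\<lambda>x. h x * expi l x) \<and>
     norm (LINT x:{0<..<\<delta>}|lborel. h x * expi l x)
       \<le> C * K * (LINT x:{0<..<cutoff \<delta> l}|lborel. w x)"
proof -
  obtain C where C: "C \<ge> 0" "\<And>K w h R \<delta> l. moderate M R w \<Longrightarrow> l \<noteq> 0 \<Longrightarrow> 1 / \<bar>l\<bar> \<le> \<delta> \<Longrightarrow> \<delta> < R \<Longrightarrow> sym1 (M + 2) R K w h \<Longrightarrow>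
    (\<And>x. \<delta> \<le> x \<Longrightarrow> x < R \<Longrightarrow> h x = 0) \<Longrightarrow>
    norm (integral {1 / \<bar>l\<bar>..\<delta>} (\<lambda>x. h x * expi l x)) \<le> C * K * w (1 / \<bar>l\<bar>) / \<bar>l\<bar>"
    using oscillatory_tail_bound[of M "M + 2" 0] by auto
  let ?C = "1 + C * 2 ^ Suc M"
  show ?thesis
  proof (intro exI[of _ ?C] conjI allI impI)
    fix K w h R \<delta> l
    assume w: "moderate M R w" and \<delta>: "0 < \<delta>" "\<delta> < R" and wint: "set_integrable lborel {0<..<\<delta>} w"
      and h: "sym1 (M + 2) R K w h" and van: "\<forall>x. \<delta> \<le> x \<longrightarrow> x < R \<longrightarrow> h x = 0"
    let ?f = "\<lambda>x. h x * expi l x"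
    have K: "K \<ge> 0"
    proof -
      have "0 \<le> K * w \<delta>" using order_trans[OF norm_ge_zero sym1_bound[OF h, of \<delta>]] \<delta> by auto
      then show ?thesis using moderate_pos[OF w \<delta>] by (simp add: zero_le_mult_iff)
    qed
    have Kw: "set_integrable lborel {0<..<b} (\<lambda>x. K * w x)" if "b \<le> \<delta>" for b
      by (intro set_integrable_mult_right set_integrable_subset[OF wint]) (use that in auto)
    have intb: "set_integrable lborel {0<..<b} ?f" if "b \<le> \<delta>" for b
    proof (rule set_integrable_bound[OF Kw[OF that]])
      have "continuous_on {0<..<b} ?f"
        by (intro continuous_intros continuous_on_subset[OF sym1_cont[OF h]]) (use that \<delta> in auto)
      then show "set_borel_measurable lborel {0<..<b} ?f"
        by (rule set_borel_measurable_continuous_on_open[OF open_greaterThanLessThan])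
      show "AE x in lborel. x \<in> {0<..<b} \<longrightarrow> norm (?f x) \<le> norm (K * w x)"
        using sym1_bound[OF h] that \<delta> by (auto simp: norm_mult intro!: AE_I2 order_trans[OF _ abs_ge_self])
    qed
    then show "set_integrable lborel {0<..<\<delta>} ?f" by simp
    have main: "norm (LINT x:{0<..<b}|lborel. ?f x) \<le> K * (LINT x:{0<..<b}|lborel. w x)" if "b \<le> \<delta>" for b
    proof -
      have "norm (LINT x:{0<..<b}|lborel. ?f x) \<le> (LINT x:{0<..<b}|lborel. norm (?f x))"
        by (rule set_integral_norm_bound[OF intb[OF that]])
      also have "\<dots> \<le> (LINT x:{0<..<b}|lborel. K * w x)"
        by (rule set_integral_mono[OF set_integrable_norm[OF intb[OF that]] Kw[OF that]])
           (use sym1_bound[OF h] that \<delta> in \<open>auto simp: norm_mult\<close>)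
      finally show ?thesis by simp
    qed
    have w0: "(LINT x:{0<..<b}|lborel. w x) \<ge> 0" if "b \<le> \<delta>" for b
      unfolding set_lebesgue_integral_def
      by (rule integral_nonneg_AE, rule AE_I2) (use moderate_pos[OF w] that \<delta> in \<open>auto simp: indicator_def intro: less_imp_le\<close>)
    show "norm (LINT x:{0<..<\<delta>}|lborel. ?f x)
       \<le> ?C * K * (LINT x:{0<..<cutoff \<delta> l}|lborel. w x)"
    proof (cases "l = 0 \<or> \<delta> \<le> 1 / \<bar>l\<bar>")
      case True
      then have eq: "cutoff \<delta> l = \<delta>" by (auto simp: cutoff_def)
      have "0 \<le> C * 2 ^ Suc M * K * (LINT x:{0<..<\<delta>}|lborel. w x)" using C K w0[of \<delta>] by simp
      then show ?thesis unfolding eq using main[of \<delta>] by (simp add: algebra_simps)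
    next
      case False
      define a where "a = 1 / \<bar>l\<bar>"
      have a: "0 < a" "a < \<delta>" using False by (auto simp: a_def)
      have eq: "cutoff \<delta> l = a" using False by (auto simp: a_def cutoff_def)
      have tail_int: "set_integrable lborel {a..\<delta>} ?f"
        unfolding set_integrable_def
        by (intro borel_integrable_compact continuous_intros continuous_on_subset[OF sym1_cont[OF h]])
           (use a \<delta> in auto)
      have "(LINT x:{0<..<\<delta>}|lborel. ?f x) = (LINT x:{0<..<a} \<union> {a..\<delta>}|lborel. ?f x)"
        unfolding set_lebesgue_integral_def
        by (rule Bochner_Integration.integral_cong) (use a \<delta> van in \<open>auto simp: indicator_def\<close>)
      also have "\<dots> = (LINT x:{0<..<a}|lborel. ?f x) + integral {a..\<delta>} ?f"
        unfolding set_borel_integral_eq_integral(2)[OF tail_int, symmetric]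
        by (rule set_integral_Un[OF _ intb tail_int]) (use a in auto)
      finally have "norm (LINT x:{0<..<\<delta>}|lborel. ?f x) \<le> norm (LINT x:{0<..<a}|lborel. ?f x) + norm (integral {a..\<delta>} ?f)"
        by (simp add: norm_triangle_ineq)
      also have "\<dots> \<le> K * (LINT x:{0<..<a}|lborel. w x) + C * K * (a * w a)"
      proof (rule add_mono)
        show "norm (integral {a..\<delta>} ?f) \<le> C * K * (a * w a)"
          using C(2)[OF w _ _ \<delta>(2) h, of l] van False a unfolding a_def by simp
      qed (use main[of a] a in simp)
      also have "\<dots> \<le> K * (LINT x:{0<..<a}|lborel. w x) + C * K * (2 ^ Suc M * (LINT x:{0<..<a}|lborel. w x))"
      proof -
        have "set_integrable lborel {0<..<a} w"
          by (rule set_integrable_subset[OF wint]) (use a in auto)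
        from moderate_le_average[OF w _ _ this] show ?thesis
          using C(1) K a \<delta> by (intro add_left_mono mult_left_mono) auto
      qed
      finally show ?thesis unfolding eq by (simp add: algebra_simps)
    qed
  qed (use C in auto)
qed

section \<open>Oscillatory integrals in two variables\<close>

definition obox :: "real \<Rightarrow> (real \<times> real) set" where
  "obox R = {0<..<R} \<times> {0<..<R}"

lemma open_obox: "open (obox r)"
  by (simp add: obox_def open_Times)

lemma symb_section:
  assumes "symb b n (obox R) K w h" "y \<in> {0<..<R}"
  shows "sym1 n R K (\<lambda>x. w (x, y)) (\<lambda>x. of_real (h (x, y)))"
  using assms(1)
proof (induction n arbitrary: b h)
  have cont: "continuous_on {0<..<R} (\<lambda>x. complex_of_real (h (x, y)))" if "continuous_on (obox R) h" for h
  proof -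
    have "continuous_on {0<..<R} (\<lambda>x. h (x, y))"
      by (rule continuous_on_compose2[OF that]) (use assms(2) in \<open>auto simp: obox_def intro!: continuous_intros\<close>)
    then show ?thesis by (intro continuous_intros)
  qed
  {
    case 0
    then show ?case using assms(2) cont[of h] by (auto simp: obox_def)
  next
    case (Suc n)
    obtain h1 where h1: "\<And>x y. (x, y) \<in> obox R \<Longrightarrow> ((\<lambda>t. h (t, y)) has_real_derivative h1 (x, y) / x) (at x)"
      "symb False n (obox R) K w h1" using symb_deriv1[OF Suc.prems] by blast
    show ?case
    proof (rule sym1_SucI[OF cont[OF symb_cont[OF Suc.prems]] _ _ Suc.IH[OF h1(2)]])
      fix x assume x: "x \<in> {0<..<R}"
      then have xy: "(x, y) \<in> obox R" using assms(2) by (auto simp: obox_def)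
      show "norm (complex_of_real (h (x, y))) \<le> K * w (x, y)"
        using symb_bound[OF Suc.prems xy] by simp
      show "((\<lambda>x. complex_of_real (h (x, y))) has_vector_derivative of_real (h1 (x, y)) / of_real x) (at x)"
        unfolding of_real_divide[symmetric] by (rule has_vector_derivative_of_real[OF h1(1)[OF xy]])
    qed
  }
qed

lemma vector_derivative_from_quotient:
  fixes f :: "real \<Rightarrow> 'a::real_normed_vector"
  assumes "((\<lambda>y. (f y - f x) /\<^sub>R (y - x)) \<longlongrightarrow> D) (at x)"
  shows "(f has_vector_derivative D) (at x)"
  unfolding has_vector_derivative_def has_derivative_iff_norm
proof
  have "((\<lambda>y. norm ((f y - f x) /\<^sub>R (y - x) - D)) \<longlongrightarrow> 0) (at x)"
    using assms by (simp add: tendsto_norm_zero_iff LIM_zero_iff)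
  moreover have "\<forall>\<^sub>F y in at x. norm ((f y - f x) /\<^sub>R (y - x) - D) = norm (f y - f x - (y - x) *\<^sub>R D) / norm (y - x)"
    unfolding eventually_at_filter
  proof (rule always_eventually, intro allI impI)
    fix y assume "y \<noteq> x" 
    then have "f y - f x - (y - x) *\<^sub>R D = (y - x) *\<^sub>R ((f y - f x) /\<^sub>R (y - x) - D)"
      by (simp add: scaleR_diff_right)
    then show "norm ((f y - f x) /\<^sub>R (y - x) - D) = norm (f y - f x - (y - x) *\<^sub>R D) / norm (y - x)"
      using \<open>y \<noteq> x\<close> by simp
  qed
  ultimately show "((\<lambda>y. norm (f y - f x - (y - x) *\<^sub>R D) / norm (y - x)) \<longlongrightarrow> 0) (at x)"
    by (rule Lim_transform_eventually)
qed (rule bounded_linear_scaleR_left)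

definition ptrans :: "real \<Rightarrow> real \<Rightarrow> (real \<times> real \<Rightarrow> real) \<Rightarrow> real \<Rightarrow> complex" where
  "ptrans \<delta> l h y = (LINT x:{0<..<\<delta>}|lborel. of_real (h (x, y)) * expi l x)"

text \<open>Differentiation under the integral sign. For \<open>y\<close> between \<open>y0 / 2\<close> and
  \<open>2 * y0\<close> the weight \<open>w (x, y)\<close> is at most \<open>2 ^ M * w (x,
  y0)\<close>, so the difference quotients have a common integrable majorant.\<close>
lemma ptrans_deriv:
  assumes \<delta>: "0 < \<delta>" "\<delta> < R" and y0: "y0 \<in> {0<..<R}"
    and wy: "\<And>x. x \<in> {0<..<R} \<Longrightarrow> moderate M R (\<lambda>y. w (x, y))"
    and wint: "\<And>y. y \<in> {0<..<R} \<Longrightarrow> set_integrable lborel {0<..<\<delta>} (\<lambda>x. w (x, y))"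
    and cont: "continuous_on (obox R) h" "continuous_on (obox R) h2"
    and bd: "\<And>z. z \<in> obox R \<Longrightarrow> \<bar>h z\<bar> \<le> K * w z" "\<And>z. z \<in> obox R \<Longrightarrow> \<bar>h2 z\<bar> \<le> K * w z"
    and D: "\<And>x y. (x, y) \<in> obox R \<Longrightarrow> ((\<lambda>t. h (x, t)) has_real_derivative h2 (x, y) / y) (at y)"
  shows "(ptrans \<delta> l h has_vector_derivative ptrans \<delta> l h2 y0 / of_real y0) (at y0)"
proof (rule vector_derivative_from_quotient, unfold tendsto_at_iff_sequentially, intro allI impI)
  fix X assume X: "\<forall>i. X i \<in> UNIV - {y0}" "X \<longlonglongrightarrow> y0"
  define b where "b = min (2 * y0) R"
  let ?J = "{y0/2<..<b}"
  have J: "?J \<subseteq> {0<..<R}" "y0 \<in> ?J" using y0 by (auto simp: b_def)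
  have "\<forall>\<^sub>F i in sequentially. X i \<in> ?J"
    by (rule topological_tendstoD[OF X(2) open_greaterThanLessThan J(2)])
  then obtain N where N: "\<And>i. i \<ge> N \<Longrightarrow> X i \<in> ?J" by (auto simp: eventually_sequentially)
  have XJ: "X (i + N) \<in> ?J" for i by (rule N) simp
  have XR: "X (i + N) \<in> {0<..<R}" for i using J(1) XJ by (rule subsetD)
  have meas: "set_borel_measurable lborel {0<..<\<delta>} (\<lambda>x. complex_of_real (g (x, y)) * expi l x)"
    if "continuous_on (obox R) g" "y \<in> {0<..<R}" for g y
  proof -
    have "continuous_on {0<..<\<delta>} (\<lambda>x. g (x, y))"
      by (rule continuous_on_compose2[OF that(1)]) (use that(2) \<delta> in \<open>auto simp: obox_def intro!: continuous_intros\<close>)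
    then show ?thesis
      by (intro set_borel_measurable_continuous_on_open[OF open_greaterThanLessThan] continuous_intros)
  qed
  have int: "set_integrable lborel {0<..<\<delta>} (\<lambda>x. complex_of_real (h (x, y)) * expi l x)" if "y \<in> {0<..<R}" for y
    by (rule set_integrable_bound[OF set_integrable_mult_right[OF wint[OF that], of K] meas[OF cont(1) that]])
       (use bd(1) that \<delta> in \<open>auto simp: norm_mult obox_def intro!: AE_I2 order_trans[OF _ abs_ge_self]\<close>)
  define L where "L = K * (2 ^ M * (2 / y0))"
  have "(\<lambda>i. LINT x|lborel. indicator {0<..<\<delta>} x *\<^sub>R (complex_of_real ((h (x, X (i + N)) - h (x, y0)) / (X (i + N) - y0)) * expi l x))
    \<longlonglongrightarrow> (LINT x|lborel. indicator {0<..<\<delta>} x *\<^sub>R (complex_of_real (h2 (x, y0) / y0) * expi l x))"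
  proof (rule integral_dominated_convergence)
    show "integrable lborel (\<lambda>x. indicator {0<..<\<delta>} x *\<^sub>R (L * w (x, y0)))"
      using set_integrable_mult_right[OF wint[OF y0], of L] by (simp add: set_integrable_def)
    show "(\<lambda>x. indicator {0<..<\<delta>} x *\<^sub>R (complex_of_real (h2 (x, y0) / y0) * expi l x)) \<in> borel_measurable lborel"
      using meas[OF continuous_on_divide[OF cont(2) continuous_on_const[of _ y0]] y0] y0
      by (simp add: set_borel_measurable_def)
    have "set_borel_measurable lborel {0<..<\<delta>} (\<lambda>x. complex_of_real ((h (x, X (i + N)) - h (x, y0)) / (X (i + N) - y0)) * expi l x)" for i
    proof -
      have Xi: "X (i + N) \<in> {0<..<R}" by (rule XR)
      have "set_integrable lborel {0<..<\<delta>} (\<lambda>x. complex_of_real (1 / (X (i + N) - y0)) *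
         (complex_of_real (h (x, X (i + N))) * expi l x - complex_of_real (h (x, y0)) * expi l x))"
        by (rule set_integrable_mult_right) (rule set_integral_diff(1)[OF int[OF Xi] int[OF y0]])
      moreover have "complex_of_real (1 / (X (i + N) - y0)) *
         (complex_of_real (h (x, X (i + N))) * expi l x - complex_of_real (h (x, y0)) * expi l x)
         = complex_of_real ((h (x, X (i + N)) - h (x, y0)) / (X (i + N) - y0)) * expi l x" for x
        by (simp add: left_diff_distrib diff_divide_distrib)
      ultimately show ?thesis
        unfolding set_borel_measurable_def set_integrable_def by (simp only: borel_measurable_integrable)
    qed
    then show "(\<lambda>x. indicator {0<..<\<delta>} x *\<^sub>R (complex_of_real ((h (x, X (i + N)) - h (x, y0)) / (X (i + N) - y0)) * expi l x)) \<in> borel_measurable lborel" for i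
      by (simp add: set_borel_measurable_def)
    show "AE x in lborel. (\<lambda>i. indicator {0<..<\<delta>} x *\<^sub>R (complex_of_real ((h (x, X (i + N)) - h (x, y0)) / (X (i + N) - y0)) * expi l x))
        \<longlonglongrightarrow> indicator {0<..<\<delta>} x *\<^sub>R (complex_of_real (h2 (x, y0) / y0) * expi l x)"
    proof (rule AE_I2)
      fix x :: real
      show "(\<lambda>i. indicator {0<..<\<delta>} x *\<^sub>R (complex_of_real ((h (x, X (i + N)) - h (x, y0)) / (X (i + N) - y0)) * expi l x))
        \<longlonglongrightarrow> indicator {0<..<\<delta>} x *\<^sub>R (complex_of_real (h2 (x, y0) / y0) * expi l x)"
      proof (cases "x \<in> {0<..<\<delta>}")
        case True
        then have "(x, y0) \<in> obox R" using \<delta> y0 by (auto simp: obox_def)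
        from D[OF this] have "((\<lambda>y. (h (x, y) - h (x, y0)) / (y - y0)) \<longlongrightarrow> h2 (x, y0) / y0) (at y0)"
          by (simp add: has_field_derivative_iff)
        then have "((\<lambda>y. (h (x, y) - h (x, y0)) / (y - y0)) \<circ> X) \<longlonglongrightarrow> h2 (x, y0) / y0"
          using X unfolding tendsto_at_iff_sequentially by blast
        then have "(\<lambda>i. (h (x, X (i + N)) - h (x, y0)) / (X (i + N) - y0)) \<longlonglongrightarrow> h2 (x, y0) / y0"
          unfolding o_def by (rule LIMSEQ_ignore_initial_segment)
        then show ?thesis
          by (rule tendsto_scaleR[OF tendsto_const tendsto_mult[OF tendsto_of_real tendsto_const]])
      qed simp
    qed
    show "AE x in lborel. norm (indicator {0<..<\<delta>} x *\<^sub>R (complex_of_real ((h (x, X (i + N)) - h (x, y0)) / (X (i + N) - y0)) * expi l x))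
        \<le> indicator {0<..<\<delta>} x *\<^sub>R (L * w (x, y0))" for i
    proof (rule AE_I2)
      fix x :: real
      show "norm (indicator {0<..<\<delta>} x *\<^sub>R (complex_of_real ((h (x, X (i + N)) - h (x, y0)) / (X (i + N) - y0)) * expi l x))
        \<le> indicator {0<..<\<delta>} x *\<^sub>R (L * w (x, y0))"
      proof (cases "x \<in> {0<..<\<delta>}")
        case True
        then have x: "x \<in> {0<..<R}" using \<delta> by auto
        have w0: "w (x, y0) > 0" using moderate_pos[OF wy[OF x]] y0 by simp
        have K: "K \<ge> 0"
          using order_trans[OF abs_ge_zero bd(1)[of "(x, y0)"]] x y0 w0 by (auto simp: obox_def zero_le_mult_iff)
        have "norm (h (x, X (i + N)) - h (x, y0)) \<le> L * w (x, y0) * norm (X (i + N) - y0)"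
        proof (rule field_differentiable_bound[of ?J "\<lambda>t. h (x, t)" "\<lambda>t. h2 (x, t) / t"])
          fix t assume t: "t \<in> ?J"
          then have xt: "(x, t) \<in> obox R" "t > 0" "t < R" using x J by (auto simp: obox_def)
          show "((\<lambda>t. h (x, t)) has_field_derivative h2 (x, t) / t) (at t within ?J)"
            using D[OF xt(1)] by (rule has_field_derivative_at_within)
          have "w (x, t) \<le> 2 ^ M * w (x, y0)"
          proof (cases "t \<le> y0")
            case True
            have "w (x, t) \<le> (y0 / t) ^ M * w (x, y0)"
              by (rule moderate_lower[OF wy[OF x]]) (use xt True y0 in auto)
            also have "\<dots> \<le> 2 ^ M * w (x, y0)"
              using t xt y0 w0 by (intro mult_right_mono power_mono) (auto simp: field_simps)
            finally show ?thesis .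
          next
            case False
            have "w (x, t) \<le> (t / y0) ^ M * w (x, y0)"
              by (rule moderate_upper[OF wy[OF x]]) (use xt False y0 in auto)
            also have "\<dots> \<le> 2 ^ M * w (x, y0)"
              using t xt y0 w0 by (intro mult_right_mono power_mono) (auto simp: field_simps b_def)
            finally show ?thesis .
          qed
          then have "\<bar>h2 (x, t)\<bar> \<le> K * (2 ^ M * w (x, y0))"
            using bd(2)[OF xt(1)] K by (meson mult_left_mono order_trans)
          moreover have "1 / t \<le> 2 / y0" using t y0 xt by (auto simp: field_simps)
          ultimately have "\<bar>h2 (x, t)\<bar> * (1 / t) \<le> K * (2 ^ M * w (x, y0)) * (2 / y0)"
            using xt by (intro mult_mono) auto
          then show "norm (h2 (x, t) / t) \<le> L * w (x, y0)" using xt by (simp add: L_def mult_ac)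
        qed (use XJ J in auto)
        then have "\<bar>(h (x, X (i + N)) - h (x, y0)) / (X (i + N) - y0)\<bar> \<le> L * w (x, y0)"
          using X(1)[rule_format, of "i + N"] by (simp add: divide_le_eq)
        then show ?thesis using True by (simp only: norm_scaleR norm_mult norm_of_real norm_expi) simp
      qed simp
    qed
  qed
  moreover have "(LINT x|lborel. indicator {0<..<\<delta>} x *\<^sub>R (complex_of_real ((h (x, X (i + N)) - h (x, y0)) / (X (i + N) - y0)) * expi l x))
     = (ptrans \<delta> l h (X (i + N)) - ptrans \<delta> l h y0) /\<^sub>R (X (i + N) - y0)" for i
  proof -
    have Xi: "X (i + N) \<in> {0<..<R}" by (rule XR)
    have "ptrans \<delta> l h (X (i + N)) - ptrans \<delta> l h y0
       = (LINT x:{0<..<\<delta>}|lborel. complex_of_real (h (x, X (i + N))) * expi l x - complex_of_real (h (x, y0)) * expi l x)"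
      unfolding ptrans_def by (rule set_integral_diff(2)[OF int[OF Xi] int[OF y0], symmetric])
    moreover have "indicator {0<..<\<delta>} x *\<^sub>R (complex_of_real ((h (x, X (i + N)) - h (x, y0)) / (X (i + N) - y0)) * expi l x)
      = inverse (X (i + N) - y0) *\<^sub>R (indicator {0<..<\<delta>} x *\<^sub>R
          (complex_of_real (h (x, X (i + N))) * expi l x - complex_of_real (h (x, y0)) * expi l x))" for x
      by (simp add: scaleR_conv_of_real divide_inverse algebra_simps)
    ultimately show ?thesis
      unfolding set_lebesgue_integral_def by (simp only: integral_scaleR_right)
  qed
  moreover have "(LINT x|lborel. indicator {0<..<\<delta>} x *\<^sub>R (complex_of_real (h2 (x, y0) / y0) * expi l x)) = ptrans \<delta> l h2 y0 / of_real y0"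
    by (simp add: ptrans_def set_lebesgue_integral_def scaleR_conv_of_real flip: integral_divide_zero)
  ultimately have "(\<lambda>i. (ptrans \<delta> l h (X (i + N)) - ptrans \<delta> l h y0) /\<^sub>R (X (i + N) - y0)) \<longlonglongrightarrow> ptrans \<delta> l h2 y0 / of_real y0"
    by simp
  then show "((\<lambda>y. (ptrans \<delta> l h y - ptrans \<delta> l h y0) /\<^sub>R (y - y0)) \<circ> X) \<longlonglongrightarrow> ptrans \<delta> l h2 y0 / of_real y0"
    unfolding o_def by (rule LIMSEQ_offset)
qed

lemma lborel_set_Fubini:
  fixes f :: "real \<times> real \<Rightarrow> 'a::{banach, second_countable_topology}"
  assumes "set_integrable lborel (A \<times> B) f"
  shows "AE y\<in>B in lborel. set_integrable lborel A (\<lambda>x. f (x, y))"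
    and "set_integrable lborel B (\<lambda>y. LINT x:A|lborel. f (x, y))"
    and "(LINT z:A \<times> B|lborel. f z) = (LINT y:B|lborel. LINT x:A|lborel. f (x, y))"
proof -
  let ?g = "\<lambda>x y. indicator (A \<times> B) (x, y) *\<^sub>R f (x, y)"
  have g: "?g x y = indicator B y *\<^sub>R (indicator A x *\<^sub>R f (x, y))" for x y
    by (auto simp: indicator_def)
  have int: "integrable (lborel \<Otimes>\<^sub>M lborel) (case_prod ?g)"
    using assms by (simp add: set_integrable_def lborel_prod case_prod_unfold)
  have "AE y in lborel. integrable lborel (\<lambda>x. ?g x y)"
    by (rule lborel_pair.AE_integrable_snd[OF int])
  then show "AE y\<in>B in lborel. set_integrable lborel A (\<lambda>x. f (x, y))"
    by eventually_elim (auto simp: set_integrable_def g)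
  have inner: "(LINT x|lborel. ?g x y) = indicator B y *\<^sub>R (LINT x:A|lborel. f (x, y))" for y
    unfolding g set_lebesgue_integral_def by (rule integral_scaleR_right)
  show "set_integrable lborel B (\<lambda>y. LINT x:A|lborel. f (x, y))"
    using lborel_pair.integrable_snd[OF int] unfolding set_integrable_def inner .
  have "(LINT y|lborel. LINT x|lborel. ?g x y) = integral\<^sup>L (lborel \<Otimes>\<^sub>M lborel) (case_prod ?g)"
    using lborel_pair.integral_snd[OF int] by (simp add: case_prod_unfold)
  then show "(LINT z:A \<times> B|lborel. f z) = (LINT y:B|lborel. LINT x:A|lborel. f (x, y))"
    unfolding inner by (simp add: set_lebesgue_integral_def lborel_prod case_prod_unfold)
qed

text \<open>The Euler derivative in \<open>y\<close> of the partial Fourier integral is the partial Fourier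
  integral of the Euler derivative, and each of them is bounded by the one-dimensional estimate,
  which needs \<open>M + 2\<close> derivatives in \<open>x\<close>. One extra derivative in
  \<open>y\<close> provides continuity of the last function through its differentiability.\<close>
lemma ptrans_sym1:
  assumes C: "\<And>K w h R \<delta> l. moderate M R w \<Longrightarrow> 0 < \<delta> \<Longrightarrow> \<delta> < R \<Longrightarrow> set_integrable lborel {0<..<\<delta>} w \<Longrightarrow>
     sym1 (M + 2) R K w h \<Longrightarrow> (\<And>x. \<delta> \<le> x \<Longrightarrow> x < R \<Longrightarrow> h x = 0) \<Longrightarrow>
     norm (LINT x:{0<..<\<delta>}|lborel. h x * expi l x) \<le> C * K * (LINT x:{0<..<cutoff \<delta> l}|lborel. w x)"
    and \<delta>: "0 < \<delta>" "\<delta> < R"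
    and wx: "\<And>y. y \<in> {0<..<R} \<Longrightarrow> moderate M R (\<lambda>x. w (x, y))"
    and wy: "\<And>x. x \<in> {0<..<R} \<Longrightarrow> moderate M R (\<lambda>y. w (x, y))"
    and wint: "\<And>y. y \<in> {0<..<R} \<Longrightarrow> set_integrable lborel {0<..<\<delta>} (\<lambda>x. w (x, y))"
    and h: "symb True (n + Suc (M + 2)) (obox R) K w h"
    and van: "\<And>x y. (x, y) \<in> obox R \<Longrightarrow> \<delta> \<le> x \<Longrightarrow> h (x, y) = 0"
  shows "sym1 n R (C * K) (\<lambda>y. LINT x:{0<..<cutoff \<delta> l}|lborel. w (x, y)) (ptrans \<delta> l h)"
  using h van
proof (induction n arbitrary: h)
  have bd: "norm (ptrans \<delta> l h y) \<le> C * K * (LINT x:{0<..<cutoff \<delta> l}|lborel. w (x, y))"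
    if h: "symb True m (obox R) K w h" and m: "M + 2 \<le> m" and y: "y \<in> {0<..<R}"
      and van: "\<And>x y. (x, y) \<in> obox R \<Longrightarrow> \<delta> \<le> x \<Longrightarrow> h (x, y) = 0" for h m y
    unfolding ptrans_def
  proof (rule C[OF wx[OF y] \<delta> wint[OF y] symb_section[OF symb_le[OF h m] y]])
    show "complex_of_real (h (x, y)) = 0" if "\<delta> \<le> x" "x < R" for x
      using van[of x y] that y \<delta> by (simp add: obox_def)
  qed
  have diff: "\<exists>h2. symb True m (obox R) K w h2 \<and>
      (\<forall>y\<in>{0<..<R}. (ptrans \<delta> l h has_vector_derivative ptrans \<delta> l h2 y / of_real y) (at y)) \<and>
      (\<forall>x y. (x, y) \<in> obox R \<longrightarrow> \<delta> \<le> x \<longrightarrow> h2 (x, y) = 0)"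
    if h: "symb True (Suc m) (obox R) K w h"
      and van: "\<And>x y. (x, y) \<in> obox R \<Longrightarrow> \<delta> \<le> x \<Longrightarrow> h (x, y) = 0" for h m
  proof -
    obtain h2 where h2: "\<And>x y. (x, y) \<in> obox R \<Longrightarrow> ((\<lambda>t. h (x, t)) has_real_derivative h2 (x, y) / y) (at y)"
      "symb True m (obox R) K w h2" using symb_deriv2[OF h] by blast
    have "h2 (x, y) = 0" if xy: "(x, y) \<in> obox R" "\<delta> \<le> x" for x y
    proof -
      have y: "0 < y" "y < R" using xy by (auto simp: obox_def)
      have "h2 (x, y) / y = 0"
        by (rule vector_derivative_zero_right[where h = "\<lambda>t. h (x, t)" and b = R and x = y])
           (use h2(1)[OF xy(1)] van xy y in \<open>auto simp: has_real_derivative_iff_has_vector_derivative obox_def\<close>)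
      then show ?thesis using y by simp
    qed
    moreover have "(ptrans \<delta> l h has_vector_derivative ptrans \<delta> l h2 y / of_real y) (at y)" if "y \<in> {0<..<R}" for y
      by (rule ptrans_deriv[OF \<delta> that wy wint symb_cont[OF h] symb_cont[OF h2(2)] symb_bound[OF h] symb_bound[OF h2(2)] h2(1)])
    ultimately show ?thesis using h2(2) by blast
  qed
  have cont: "continuous_on {0<..<R} (ptrans \<delta> l h)" 
    if "\<forall>y\<in>{0<..<R}. (ptrans \<delta> l h has_vector_derivative g y) (at y)" for h g
    using that by (intro continuous_at_imp_continuous_on ballI) (auto intro: has_vector_derivative_continuous)
  {
    case 0
    have h': "symb True (Suc (M + 2)) (obox R) K w h" using 0(1) by (simp only: add_0)
    obtain h2 where h2: "\<forall>y\<in>{0<..<R}. (ptrans \<delta> l h has_vector_derivative ptrans \<delta> l h2 y / of_real y) (at y)"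
      using diff[OF h' 0(2)] by blast
    show ?case using cont[OF h2] bd[OF h' _ _ 0(2)] by simp
  next
    case (Suc n)
    have h': "symb True (Suc (n + Suc (M + 2))) (obox R) K w h" using Suc.prems(1) by (simp only: add_Suc)
    obtain h2 where h2: "symb True (n + Suc (M + 2)) (obox R) K w h2"
      "\<forall>y\<in>{0<..<R}. (ptrans \<delta> l h has_vector_derivative ptrans \<delta> l h2 y / of_real y) (at y)"
      "\<forall>x y. (x, y) \<in> obox R \<longrightarrow> \<delta> \<le> x \<longrightarrow> h2 (x, y) = 0"
      using diff[OF h' Suc.prems(2)] by blast
    show ?case
      by (rule sym1_SucI[OF cont[OF h2(2)] bd[OF h' _ _ Suc.prems(2)] _ Suc.IH[OF h2(1)]]) (use h2 in auto)
  }
qed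

text \<open>The weight for the second application of the one-dimensional bound is moderate with the same
  exponent, as the comparison in \<open>y\<close> may be integrated over \<open>x\<close>.\<close>
lemma moderate_integral:
  assumes \<mu>: "0 < \<mu>" "\<mu> < R"
    and wx: "\<And>y. y \<in> {0<..<R} \<Longrightarrow> moderate M R (\<lambda>x. w (x, y))"
    and wy: "\<And>x. x \<in> {0<..<R} \<Longrightarrow> moderate M R (\<lambda>y. w (x, y))"
    and wint: "\<And>y. y \<in> {0<..<R} \<Longrightarrow> set_integrable lborel {0<..<\<mu>} (\<lambda>x. w (x, y))"
  shows "moderate M R (\<lambda>y. LINT x:{0<..<\<mu>}|lborel. w (x, y))"
  unfolding moderate_def
proof (intro conjI ballI allI impI)
  fix y assume y: "y \<in> {0<..<R}"
  have "0 < \<mu> * w (\<mu>, y)" using moderate_pos[OF wx[OF y]] \<mu> by simp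
  also have "\<dots> \<le> 2 ^ Suc M * (LINT x:{0<..<\<mu>}|lborel. w (x, y))"
    by (rule moderate_le_average[OF wx[OF y] \<mu> wint[OF y]])
  finally show "0 < (LINT x:{0<..<\<mu>}|lborel. w (x, y))" by (simp add: zero_less_mult_iff)
next
  fix y y' assume yy: "0 < y \<and> y \<le> y' \<and> y' < R"
  then have y: "y \<in> {0<..<R}" "y' \<in> {0<..<R}" by auto
  have "(LINT x:{0<..<\<mu>}|lborel. w (x, y')) \<le> (LINT x:{0<..<\<mu>}|lborel. (y' / y) ^ M * w (x, y))"
    by (rule set_integral_mono[OF wint[OF y(2)] set_integrable_mult_right[OF wint[OF y(1)]]])
       (rule moderate_upper[OF wy], use yy \<mu> in auto)
  then show "(LINT x:{0<..<\<mu>}|lborel. w (x, y')) \<le> (y' / y) ^ M * (LINT x:{0<..<\<mu>}|lborel. w (x, y))" by simp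
  have "(LINT x:{0<..<\<mu>}|lborel. w (x, y)) \<le> (LINT x:{0<..<\<mu>}|lborel. (y' / y) ^ M * w (x, y'))"
    by (rule set_integral_mono[OF wint[OF y(1)] set_integrable_mult_right[OF wint[OF y(2)]]])
       (rule moderate_lower[OF wy], use yy \<mu> in auto)
  then show "(LINT x:{0<..<\<mu>}|lborel. w (x, y)) \<le> (y' / y) ^ M * (LINT x:{0<..<\<mu>}|lborel. w (x, y'))" by simp
qed

lemma AE_interval_witness:
  fixes \<delta> :: real
  assumes "AE y\<in>{0<..<\<delta>} in lborel. Q y" "0 < \<delta>"
  obtains y where "y \<in> {0<..<\<delta>}" "Q y"
proof -
  have "\<exists>y\<in>{0<..<\<delta>}. Q y"
  proof (rule ccontr)
    assume no: "\<not> ?thesis"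
    have "AE y in lborel. y \<notin> {0<..<\<delta>}" using assms(1) by eventually_elim (use no in blast)
    then have "emeasure lborel {0<..<\<delta>} = 0"
      by (subst (asm) AE_iff_measurable[of "{0<..<\<delta>}"]) auto
    then show False using assms(2) by simp
  qed
  then show thesis using that by blast
qed

text \<open>By Fubini almost every section is integrable, and by moderation in \<open>y\<close> all sections
  are comparable to one of them.\<close>
lemma sections_integrable:
  assumes \<delta>: "0 < \<delta>" "\<delta> < R"
    and wx: "\<And>y. y \<in> {0<..<R} \<Longrightarrow> moderate M R (\<lambda>x. w (x, y))"
    and wy: "\<And>x. x \<in> {0<..<R} \<Longrightarrow> moderate M R (\<lambda>y. w (x, y))"
    and cont: "continuous_on (obox R) w"
    and wint: "set_integrable lborel (obox \<delta>) w" and y: "y \<in> {0<..<R}"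
  shows "set_integrable lborel {0<..<\<delta>} (\<lambda>x. w (x, y))"
proof -
  obtain y1 where y1: "y1 \<in> {0<..<\<delta>}" "set_integrable lborel {0<..<\<delta>} (\<lambda>x. w (x, y1))"
    using AE_interval_witness[OF lborel_set_Fubini(1)[OF wint[unfolded obox_def]] \<delta>(1)] by blast
  define k where "k = (max y y1 / min y y1) ^ M"
  have kb: "w (x, y) \<le> k * w (x, y1)" if "x \<in> {0<..<\<delta>}" for x
  proof -
    have x: "x \<in> {0<..<R}" using that \<delta> by auto
    show ?thesis
    proof (cases "y \<le> y1")
      case True
      then show ?thesis using moderate_lower[OF wy[OF x], of y y1] y y1 \<delta> by (simp add: k_def)
    next
      case False
      then show ?thesis using moderate_upper[OF wy[OF x], of y1 y] y y1 \<delta> by (simp add: k_def)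
    qed
  qed
  show ?thesis
  proof (rule set_integrable_bound[OF set_integrable_mult_right[OF y1(2), of k]])
    have "continuous_on {0<..<\<delta>} (\<lambda>x. w (x, y))"
      by (rule continuous_on_compose2[OF cont]) (use y \<delta> in \<open>auto simp: obox_def intro!: continuous_intros\<close>)
    then show "set_borel_measurable lborel {0<..<\<delta>} (\<lambda>x. w (x, y))"
      by (rule set_borel_measurable_continuous_on_open[OF open_greaterThanLessThan])
    show "AE x in lborel. x \<in> {0<..<\<delta>} \<longrightarrow> norm (w (x, y)) \<le> norm (k * w (x, y1))"
    proof (intro AE_I2 impI)
      fix x assume x: "x \<in> {0<..<\<delta>}"
      then have "w (x, y) > 0" using moderate_pos[OF wx[OF y], of x] \<delta> by auto
      then show "norm (w (x, y)) \<le> norm (k * w (x, y1))" using kb[OF x] by simp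
    qed
  qed
qed

text \<open>The one-dimensional bound is applied in \<open>x\<close> for each \<open>y\<close> and then in
  \<open>y\<close> to the partial Fourier integral. The second application consumes \<open>M +
  2\<close> derivatives in \<open>y\<close>, and the first, under all of these, \<open>M + 2\<close>
  derivatives in \<open>x\<close>; with the extra one for continuity this makes \<open>2 * M +
  5\<close>.\<close>
lemma oscillatory_bound_2d:
  "\<exists>C\<ge>0. \<forall>K w h R \<delta> l1 l2. 0 < \<delta> \<longrightarrow> \<delta> < R \<longrightarrow>
     (\<forall>y\<in>{0<..<R}. moderate M R (\<lambda>x. w (x, y))) \<longrightarrow> (\<forall>x\<in>{0<..<R}. moderate M R (\<lambda>y. w (x, y))) \<longrightarrow>
     continuous_on (obox R) w \<longrightarrow> set_integrable lborel (obox \<delta>) w \<longrightarrow>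
     symb True (2 * M + 5) (obox R) K w h \<longrightarrow>
     (\<forall>x y. (x, y) \<in> obox R \<longrightarrow> \<delta> \<le> x \<or> \<delta> \<le> y \<longrightarrow> h (x, y) = 0) \<longrightarrow>
     set_integrable lborel (obox \<delta>) (\<lambda>z. of_real (h z) * expi l1 (fst z) * expi l2 (snd z)) \<and>
     norm (LINT z:obox \<delta>|lborel. of_real (h z) * expi l1 (fst z) * expi l2 (snd z))
       \<le> C * K * (LINT z:{0<..<cutoff \<delta> l1} \<times> {0<..<cutoff \<delta> l2}|lborel. w z)"
proof -
  obtain C where C: "C \<ge> 0" "\<And>K w h R \<delta> l. moderate M R w \<Longrightarrow> 0 < \<delta> \<Longrightarrow> \<delta> < R \<Longrightarrow> set_integrable lborel {0<..<\<delta>} w \<Longrightarrow>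
     sym1 (M + 2) R K w h \<Longrightarrow> (\<And>x. \<delta> \<le> x \<Longrightarrow> x < R \<Longrightarrow> h x = 0) \<Longrightarrow>
     norm (LINT x:{0<..<\<delta>}|lborel. h x * expi l x) \<le> C * K * (LINT x:{0<..<cutoff \<delta> l}|lborel. w x)"
    using oscillatory_bound_1d[of M] by blast
  show ?thesis
  proof (rule exI[of _ "C * C"], intro conjI allI impI)
    fix K :: real and w h :: "real \<times> real \<Rightarrow> real" and R \<delta> l1 l2 :: real
    assume \<delta>: "0 < \<delta>" "\<delta> < R"
      and wx: "\<forall>y\<in>{0<..<R}. moderate M R (\<lambda>x. w (x, y))" and wy: "\<forall>x\<in>{0<..<R}. moderate M R (\<lambda>y. w (x, y))"
      and cont: "continuous_on (obox R) w" and wint: "set_integrable lborel (obox \<delta>) w"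
      and h: "symb True (2 * M + 5) (obox R) K w h"
      and van: "\<forall>x y. (x, y) \<in> obox R \<longrightarrow> \<delta> \<le> x \<or> \<delta> \<le> y \<longrightarrow> h (x, y) = 0"
    let ?F = "\<lambda>z. complex_of_real (h z) * expi l1 (fst z) * expi l2 (snd z)"
    let ?\<mu> = "cutoff \<delta> l1" and ?\<nu> = "cutoff \<delta> l2"
    have \<mu>: "0 < ?\<mu>" "?\<mu> < R" "?\<mu> \<le> \<delta>" and \<nu>: "0 < ?\<nu>" "?\<nu> \<le> \<delta>"
      using cutoff_bounds(1)[OF \<delta>(1), of l1] cutoff_bounds(2)[of \<delta> l1]
        cutoff_bounds(1)[OF \<delta>(1), of l2] cutoff_bounds(2)[of \<delta> l2] \<delta> by auto
    have sub: "obox \<delta> \<subseteq> obox R" using \<delta> by (auto simp: obox_def)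
    have sec: "set_integrable lborel {0<..<\<delta>} (\<lambda>x. w (x, y))" if "y \<in> {0<..<R}" for y
      using sections_integrable[OF \<delta> _ _ cont wint that] wx wy by blast
    have sec\<mu>: "set_integrable lborel {0<..<?\<mu>} (\<lambda>x. w (x, y))" if "y \<in> {0<..<R}" for y
      by (rule set_integrable_subset[OF sec[OF that]]) (use \<mu> in auto)
    show Fint: "set_integrable lborel (obox \<delta>) ?F"
    proof (rule set_integrable_bound[OF set_integrable_mult_right[OF wint, of K]])
      have "continuous_on (obox \<delta>) ?F"
        by (intro continuous_intros continuous_on_subset[OF symb_cont[OF h] sub]
            continuous_on_compose2[OF continuous_on_expi[of UNIV]]) auto
      then show "set_borel_measurable lborel (obox \<delta>) ?F"
        by (rule set_borel_measurable_continuous_on_open[OF open_obox])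
      show "AE z in lborel. z \<in> obox \<delta> \<longrightarrow> norm (?F z) \<le> norm (K * w z)"
      proof (intro AE_I2 impI)
        fix z assume "z \<in> obox \<delta>"
        then have "\<bar>h z\<bar> \<le> K * w z" using symb_bound[OF h] sub by blast
        then show "norm (?F z) \<le> norm (K * w z)" by (simp add: norm_mult)
      qed
    qed
    let ?W = "\<lambda>y. LINT x:{0<..<?\<mu>}|lborel. w (x, y)"
    have "sym1 (M + 2) R (C * K) ?W (ptrans \<delta> l1 h)"
    proof (rule ptrans_sym1[OF C(2) \<delta> _ _ sec])
      have "2 * M + 5 = M + 2 + Suc (M + 2)" by simp
      then show "symb True (M + 2 + Suc (M + 2)) (obox R) K w h" using h by (simp only:)
    qed (use wx wy van in auto)
    moreover have "moderate M R ?W"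
      by (rule moderate_integral[OF \<mu>(1,2) _ _ sec\<mu>]) (use wx wy in auto)
    moreover have wint\<mu>: "set_integrable lborel ({0<..<?\<mu>} \<times> {0<..<b}) w" if "b \<le> \<delta>" for b
      by (rule set_integrable_subset[OF wint]) (use \<mu> that in \<open>auto simp: obox_def open_Times intro!: borel_open\<close>)
    moreover have "ptrans \<delta> l1 h y = 0" if "\<delta> \<le> y" "y < R" for y
    proof -
      have "ptrans \<delta> l1 h y = (LINT x:{0<..<\<delta>}|lborel. 0)"
        unfolding ptrans_def
        by (rule set_lebesgue_integral_cong) (use van that \<delta> in \<open>auto simp: obox_def\<close>)
      then show ?thesis by simp
    qed
    ultimately have "norm (LINT y:{0<..<\<delta>}|lborel. ptrans \<delta> l1 h y * expi l2 y) \<le> C * (C * K) * (LINT y:{0<..<?\<nu>}|lborel. ?W y)"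
      using lborel_set_Fubini(2)[OF wint\<mu>[OF order_refl]] by (intro C(2)[OF _ \<delta>]) auto
    also have "(LINT y:{0<..<?\<nu>}|lborel. ?W y) = (LINT z:{0<..<?\<mu>} \<times> {0<..<?\<nu>}|lborel. w z)"
      by (rule lborel_set_Fubini(3)[OF wint\<mu>[OF \<nu>(2)], symmetric])
    also have "(LINT y:{0<..<\<delta>}|lborel. ptrans \<delta> l1 h y * expi l2 y) = (LINT z:obox \<delta>|lborel. ?F z)"
      unfolding obox_def lborel_set_Fubini(3)[OF Fint[unfolded obox_def]] ptrans_def by simp
    finally show "norm (LINT z:obox \<delta>|lborel. ?F z) \<le> C * C * K * (LINT z:{0<..<?\<mu>} \<times> {0<..<?\<nu>}|lborel. w z)"
      by (simp add: mult.assoc)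
  qed (use C in simp)
qed

section \<open>Growth exponents\<close>

lemma continuous_on_Max_image:
  fixes f :: "'i \<Rightarrow> real \<Rightarrow> real"
  assumes "finite L" "L \<noteq> {}" "\<And>i. i \<in> L \<Longrightarrow> continuous_on S (f i)"
  shows "continuous_on S (\<lambda>u. Max ((\<lambda>i. f i u) ` L))"
  using assms
proof (induction L rule: finite_ne_induct)
  case (insert i L)
  then have "continuous_on S (\<lambda>u. max (f i u) (Max ((\<lambda>i. f i u) ` L)))"
    by (intro continuous_on_max) auto
  then show ?case using insert by simp
qed simp

text \<open>A maximum of finitely many affine functions with slopes \<open>\<alpha>\<close>, at least one of
  them positive, restricted to \<open>u \<ge> 0\<close>, attains its minimum \<open>m\<close> on a
  compact interval from \<open>p\<close> to \<open>q\<close>. Some line rises from height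
  \<open>m\<close> at \<open>q\<close>, and some line falls to height \<open>m\<close> at
  \<open>p\<close> unless \<open>p = 0\<close>: these two lines bound the maximum from below on
  either side of the interval.\<close>
lemma max_affine_minimum:
  fixes \<alpha> \<beta> :: "'i \<Rightarrow> real"
  assumes L: "finite L" and up: "i0 \<in> L" "\<alpha> i0 > 0"
  obtains m p q iq where "0 \<le> p" "p \<le> q" 
    "\<And>u. u \<ge> 0 \<Longrightarrow> \<exists>i\<in>L. \<alpha> i * u + \<beta> i \<ge> m"
    "\<And>u i. p \<le> u \<Longrightarrow> u \<le> q \<Longrightarrow> i \<in> L \<Longrightarrow> \<alpha> i * u + \<beta> i \<le> m"
    "iq \<in> L" "\<alpha> iq > 0" "\<alpha> iq * q + \<beta> iq = m"
    "p = 0 \<or> (\<exists>i\<in>L. \<alpha> i < 0 \<and> \<alpha> i * p + \<beta> i = m)"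
proof -
  define G where "G u = Max ((\<lambda>i. \<alpha> i * u + \<beta> i) ` L)" for u
  have ne: "L \<noteq> {}" using up by auto
  have Gge: "\<alpha> i * u + \<beta> i \<le> G u" if "i \<in> L" for i u
    unfolding G_def using L that by (intro Max_ge) auto
  have Gin: "\<exists>i\<in>L. G u = \<alpha> i * u + \<beta> i" for u
  proof -
    have "G u \<in> (\<lambda>i. \<alpha> i * u + \<beta> i) ` L" unfolding G_def using L ne by (intro Max_in) auto
    then show ?thesis by auto
  qed
  have Gle: "G u \<le> c \<longleftrightarrow> (\<forall>i\<in>L. \<alpha> i * u + \<beta> i \<le> c)" for u c
    unfolding G_def using L ne by (subst Max_le_iff) auto
  have cont: "continuous_on S G" for S
    unfolding G_def by (intro continuous_on_Max_image L ne continuous_intros)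
  define B where "B = max 0 ((G 0 - \<beta> i0) / \<alpha> i0)"
  have B: "G u \<ge> G 0" if "u \<ge> B" for u
  proof -
    have "(G 0 - \<beta> i0) / \<alpha> i0 \<le> u" using that by (simp add: B_def)
    then have "G 0 \<le> \<alpha> i0 * u + \<beta> i0" using up by (simp add: divide_le_eq mult.commute)
    then show ?thesis using Gge[OF up(1), of u] by linarith
  qed
  obtain u0 where u0: "u0 \<in> {0..B}" "\<And>u. u \<in> {0..B} \<Longrightarrow> G u0 \<le> G u"
    using continuous_attains_inf[of "{0..B}" G] cont by (auto simp: B_def)
  define m where "m = G u0"
  have m: "m \<le> G u" if "u \<ge> 0" for u
  proof (cases "u \<le> B")
    case False
    have "m \<le> G 0" using u0(2)[of 0] by (simp add: m_def B_def)
    then show ?thesis using B[of u] False by linarith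
  qed (use u0(2) that in \<open>auto simp: m_def\<close>)
  define T where "T = {u \<in> {0..}. G u \<le> m}"
  have u0T: "u0 \<in> T" using u0 by (auto simp: T_def m_def)
  have closed: "closed T"
  proof -
    have "T = {0..} \<inter> {u. G u \<le> m}" by (auto simp: T_def)
    then show ?thesis using cont[of UNIV] by (simp add: closed_Int closed_Collect_le)
  qed
  have bdb: "bdd_below T" by (rule bdd_belowI[of _ 0]) (auto simp: T_def)
  have bda: "bdd_above T"
  proof (rule bdd_aboveI[of _ "(m - \<beta> i0) / \<alpha> i0"])
    fix u assume "u \<in> T"
    then have "\<alpha> i0 * u + \<beta> i0 \<le> m" using Gge[OF up(1), of u] by (auto simp: T_def)
    then show "u \<le> (m - \<beta> i0) / \<alpha> i0" using up by (simp add: pos_le_divide_eq mult.commute)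
  qed
  define p where "p = Inf T"
  define q where "q = Sup T"
  have p: "p \<in> T" unfolding p_def using closed_contains_Inf[OF _ bdb closed] u0T by auto
  have q: "q \<in> T" unfolding q_def using closed_contains_Sup[OF _ bda closed] u0T by auto
  have pq: "p \<le> q" unfolding p_def using q bdb by (rule cInf_lower)
  have between: "\<alpha> i * u + \<beta> i \<le> m" if u: "p \<le> u" "u \<le> q" and i: "i \<in> L" for u i
  proof -
    have "\<alpha> i * p + \<beta> i \<le> m" "\<alpha> i * q + \<beta> i \<le> m"
      using p q i Gle by (auto simp: T_def)
    moreover have "\<alpha> i * u \<le> max (\<alpha> i * p) (\<alpha> i * q)"
      using u by (cases "\<alpha> i \<ge> 0") (auto simp: le_max_iff_disj mult_left_mono mult_left_mono_neg)
    ultimately show ?thesis by linarith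
  qed
  \<comment> \<open>If every line that reaches height \<open>m\<close> at \<open>u\<close> falls, or is
    level, in the direction \<open>sg\<close>, the minimising set extends beyond
    \<open>u\<close> in this direction.\<close>
  have extend: "\<exists>\<eta>>0. \<forall>i\<in>L. \<alpha> i * (u + sg * \<eta>) + \<beta> i \<le> m"
    if u: "\<And>i. i \<in> L \<Longrightarrow> \<alpha> i * u + \<beta> i \<le> m" and dir: "\<And>i. i \<in> L \<Longrightarrow> \<alpha> i * u + \<beta> i = m \<Longrightarrow> sg * \<alpha> i \<le> 0" for u sg
  proof -
    have "\<forall>i\<in>L. \<forall>\<^sub>F \<eta> in at_right 0. \<alpha> i * (u + sg * \<eta>) + \<beta> i \<le> m"
    proof
      fix i assume i: "i \<in> L"
      show "\<forall>\<^sub>F \<eta> in at_right 0. \<alpha> i * (u + sg * \<eta>) + \<beta> i \<le> m"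
      proof (cases "\<alpha> i * u + \<beta> i = m")
        case True
        have "\<alpha> i * (u + sg * \<eta>) + \<beta> i \<le> m" if "\<eta> > 0" for \<eta>
          using mult_nonpos_nonneg[OF dir[OF i True], of \<eta>] True that by (simp add: algebra_simps)
        then show ?thesis by (intro eventually_at_rightI[of 0 1]) auto
      next
        case False
        then have lt: "\<alpha> i * (u + sg * 0) + \<beta> i < m" using u[OF i] by simp
        have "((\<lambda>\<eta>. \<alpha> i * (u + sg * \<eta>) + \<beta> i) \<longlongrightarrow> \<alpha> i * (u + sg * 0) + \<beta> i) (at_right 0)"
          by (intro tendsto_intros)
        from order_tendstoD(2)[OF this lt] show ?thesis by eventually_elim simp
      qed
    qed
    then have "\<forall>\<^sub>F \<eta> in at_right 0. \<forall>i\<in>L. \<alpha> i * (u + sg * \<eta>) + \<beta> i \<le> m"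
      using L by (simp add: eventually_ball_finite_distrib)
    moreover have "\<forall>\<^sub>F \<eta> in at_right (0::real). \<eta> > 0" by (rule eventually_at_right_less)
    ultimately have "\<forall>\<^sub>F \<eta> in at_right 0. \<eta> > 0 \<and> (\<forall>i\<in>L. \<alpha> i * (u + sg * \<eta>) + \<beta> i \<le> m)"
      by (rule eventually_conj[rotated])
    then show ?thesis using eventually_happens[of _ "at_right (0::real)"] trivial_limit_at_right_real by blast
  qed
  have "\<exists>i\<in>L. \<alpha> i > 0 \<and> \<alpha> i * q + \<beta> i = m"
  proof (rule ccontr)
    assume "\<not> ?thesis"
    then obtain \<eta> where \<eta>: "\<eta> > 0" "\<forall>i\<in>L. \<alpha> i * (q + 1 * \<eta>) + \<beta> i \<le> m"
      using extend[of q 1] between pq by fastforce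
    then have "q + \<eta> \<in> T" using q by (auto simp: T_def Gle)
    then have "q + \<eta> \<le> q" unfolding q_def using bda by (rule cSup_upper)
    then show False using \<eta> by simp
  qed
  then obtain iq where iq: "iq \<in> L" "\<alpha> iq > 0" "\<alpha> iq * q + \<beta> iq = m" by blast
  have left: "p = 0 \<or> (\<exists>i\<in>L. \<alpha> i < 0 \<and> \<alpha> i * p + \<beta> i = m)"
  proof (rule ccontr)
    assume no: "\<not> ?thesis"
    then have p0: "p > 0" using p by (auto simp: T_def)
    obtain \<eta> where \<eta>: "\<eta> > 0" "\<forall>i\<in>L. \<alpha> i * (p + - 1 * \<eta>) + \<beta> i \<le> m"
      using extend[of p "-1"] between[OF order_refl pq] no by fastforce
    define t where "t = min \<eta> p"
    have t: "0 < t" "t \<le> p" "t \<le> \<eta>" using \<eta> p0 by (auto simp: t_def)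
    have "\<alpha> i * (p - t) + \<beta> i \<le> m" if i: "i \<in> L" for i
    proof (cases "\<alpha> i \<ge> 0")
      case True
      have "\<alpha> i * (p - t) \<le> \<alpha> i * p" using True t by (intro mult_left_mono) auto
      then show ?thesis using between[OF order_refl pq i] by linarith
    next
      case False
      have "\<alpha> i * (p - t) \<le> \<alpha> i * (p + - 1 * \<eta>)" using False t by (intro mult_left_mono_neg) auto
      then show ?thesis using \<eta> i by fastforce
    qed
    then have "p - t \<in> T" using t by (auto simp: T_def Gle)
    then have "p \<le> p - t" unfolding p_def using bdb by (rule cInf_lower)
    then show False using t by simp
  qed
  show thesis
  proof (rule that[of p q m iq])
    show "\<exists>i\<in>L. m \<le> \<alpha> i * u + \<beta> i" if "u \<ge> 0" for u using m[OF that] Gin[of u] by auto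
  qed (use p pq between iq left in \<open>auto simp: T_def\<close>)
qed

lemma power_integral_01:
  fixes a :: real
  assumes "a > -1" "0 \<le> c"
  shows "set_integrable lborel {0<..<c} (\<lambda>s. s powr a)" "(LINT s:{0<..<c}|lborel. s powr a) = c powr (a + 1) / (a + 1)"
proof -
  have hi: "((\<lambda>x. x powr a) has_integral (c powr (a + 1) / (a + 1))) {0..c}"
    by (rule has_integral_powr_from_0) (use assms in auto)
  have "(\<lambda>x. x powr a) absolutely_integrable_on {0..c}"
    by (rule nonnegative_absolutely_integrable_1) (use hi in auto)
  then have L: "set_integrable lebesgue {0<..<c} (\<lambda>x. x powr a)"
    by (rule set_integrable_subset) auto
  then show I: "set_integrable lborel {0<..<c} (\<lambda>s. s powr a)"
    unfolding set_integrable_def by (subst (asm) integrable_completion) auto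
  have "((\<lambda>x. x powr a) has_integral (c powr (a + 1) / (a + 1))) {0<..<c}"
    using hi by (simp add: has_integral_Icc_iff_Ioo)
  then show "(LINT s:{0<..<c}|lborel. s powr a) = c powr (a + 1) / (a + 1)"
    using set_borel_integral_eq_integral(2)[OF I] by (simp add: integral_unique)
qed

text \<open>Compared with \<open>1 / x\<close>, whose integral down to \<open>\<eta>\<close> is unbounded as
  \<open>\<eta>\<close> tends to 0.\<close>
lemma powr_not_integrable:
  fixes a \<delta> :: real
  assumes "set_integrable lborel {0<..<\<delta>} (\<lambda>s. s powr a)" "0 < \<delta>"
  shows "a > -1"
proof (rule ccontr)
  assume "\<not> a > -1"
  then have a: "a \<le> -1" by simp
  define I where "I = (LINT s:{0<..<\<delta>}|lborel. s powr a)"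
  define \<delta>' where "\<delta>' = min \<delta> 1 / 2"
  have \<delta>': "0 < \<delta>'" "\<delta>' < \<delta>" "\<delta>' < 1" using assms by (auto simp: \<delta>'_def)
  have bound: "ln \<delta>' - ln \<eta> \<le> I" if \<eta>: "0 < \<eta>" "\<eta> < \<delta>'" for \<eta>
  proof -
    have "((\<lambda>x. 1 / x) has_integral ln \<delta>' - ln \<eta>) {\<eta>..\<delta>'}"
      by (rule fundamental_theorem_of_calculus)
         (use \<eta> in \<open>auto intro!: derivative_eq_intros simp: has_real_derivative_iff_has_vector_derivative[symmetric]\<close>)
    then have "ln \<delta>' - ln \<eta> = integral {\<eta>..\<delta>'} (\<lambda>x. 1 / x)" by (simp add: integral_unique)
    also have "\<dots> = (LINT x:{\<eta>..\<delta>'}|lborel. 1 / x)"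
      by (rule set_borel_integral_eq_integral(2)[symmetric], unfold set_integrable_def, rule borel_integrable_compact)
         (use \<eta> in \<open>auto intro!: continuous_intros\<close>)
    also have "\<dots> \<le> I"
      unfolding I_def set_lebesgue_integral_def
    proof (rule integral_mono)
      show "integrable lborel (\<lambda>x. indicator {\<eta>..\<delta>'} x *\<^sub>R (1 / x))"
        by (rule borel_integrable_compact) (use \<eta> in \<open>auto intro!: continuous_intros\<close>)
      show "integrable lborel (\<lambda>x. indicator {0<..<\<delta>} x *\<^sub>R x powr a)"
        using assms by (simp add: set_integrable_def)
      fix x :: real
      have "1 / x \<le> x powr a" if x: "x \<in> {\<eta>..\<delta>'}"
      proof -
        have "x powr (-1) \<le> x powr a"
          using a x \<eta> \<delta>' by (intro powr_mono') auto
        then show ?thesis using x \<eta> by (simp add: powr_minus divide_inverse)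
      qed
      then show "indicator {\<eta>..\<delta>'} x *\<^sub>R (1 / x) \<le> indicator {0<..<\<delta>} x *\<^sub>R x powr a"
        using \<eta> \<delta>' by (auto simp: indicator_def)
    qed
    finally show ?thesis .
  qed
  \<comment> \<open>Chosen so that \<open>ln \<delta>' - ln \<eta>\<close> exceeds the integral by 1.\<close>
  define \<eta> where "\<eta> = \<delta>' * exp (- (\<bar>I\<bar> + 1))"
  have "0 < \<eta>" "\<eta> < \<delta>'" using \<delta>' by (auto simp: \<eta>_def)
  from bound[OF this] \<delta>' show False by (simp add: \<eta>_def ln_mult)
qed

text \<open>For positive variables, where absolute values may be left out; \<open>weight\<close> is the
  version for all variables.\<close>
definition monomial_sum :: "(nat \<times> nat) set \<Rightarrow> real \<Rightarrow> real \<Rightarrow> real" where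
  "monomial_sum P r s = (\<Sum>(a, b)\<in>P. r ^ a * s ^ b)"

lemma monomial_le_sum:
  assumes "finite P" "(a, b) \<in> P" "0 \<le> r" "0 \<le> s"
  shows "r ^ a * s ^ b \<le> monomial_sum P r s"
proof -
  have "(\<lambda>(a, b). r ^ a * s ^ b) (a, b) \<le> monomial_sum P r s"
    unfolding monomial_sum_def by (rule member_le_sum) (use assms in auto)
  then show ?thesis by simp
qed

lemma monomial_sum_le:
  assumes "\<And>a b. (a, b) \<in> P \<Longrightarrow> r ^ a * s ^ b \<le> c"
  shows "monomial_sum P r s \<le> real (card P) * c"
  unfolding monomial_sum_def by (rule sum_bounded_above) (use assms in auto)

lemma monomial_sum_pos:
  assumes "finite P" "P \<noteq> {}" "0 < r" "0 < s"
  shows "monomial_sum P r s > 0"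
  unfolding monomial_sum_def by (rule sum_pos) (use assms in auto)

lemma continuous_on_monomial_sum: "continuous_on S (\<lambda>s. monomial_sum P r s)"
  unfolding monomial_sum_def case_prod_unfold by (intro continuous_intros)

lemma measurable_monomial_weight:
  "(\<lambda>s. monomial_sum P r s powr t) \<in> borel_measurable borel"
  using continuous_on_monomial_sum[of UNIV P r] by (intro powr_real_measurable borel_measurable_continuous_onI) auto

lemma set_integral_pos_mono_set:
  fixes f :: "'a \<Rightarrow> real"
  assumes "set_integrable M B f" "A \<in> sets M" "A \<subseteq> B" "\<And>x. x \<in> B \<Longrightarrow> f x \<ge> 0"
  shows "(LINT x:A|M. f x) \<le> (LINT x:B|M. f x)"
  unfolding set_lebesgue_integral_def
proof (rule integral_mono)
  show "integrable M (\<lambda>x. indicator B x *\<^sub>R f x)" "integrable M (\<lambda>x. indicator A x *\<^sub>R f x)"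
    using assms(1) set_integrable_subset[OF assms(1), of A] assms(2,3) by (simp_all add: set_integrable_def)
  show "indicator A x *\<^sub>R f x \<le> indicator B x *\<^sub>R f x" for x
    using assms(3) assms(4)[of x] by (auto simp: indicator_def)
qed

lemma inverse_integral:
  fixes A B :: real
  assumes "0 < A" "A \<le> B"
  shows "set_integrable lborel {A..B} (\<lambda>x. 1 / x)" "(LINT x:{A..B}|lborel. 1 / x) = ln B - ln A"
proof -
  show I: "set_integrable lborel {A..B} (\<lambda>x. 1 / x)"
    unfolding set_integrable_def by (rule borel_integrable_compact) (use assms in \<open>auto intro!: continuous_intros\<close>)
  have "((\<lambda>x. 1 / x) has_integral ln B - ln A) {A..B}"
    by (rule fundamental_theorem_of_calculus)
       (use assms in \<open>auto intro!: derivative_eq_intros simp: has_real_derivative_iff_has_vector_derivative[symmetric]\<close>)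
  then show "(LINT x:{A..B}|lborel. 1 / x) = ln B - ln A"
    using set_borel_integral_eq_integral(2)[OF I] by (simp add: integral_unique)
qed

lemma tail_power_integral:
  fixes B k :: real
  assumes "0 < B" "B \<le> 1" "k > 0"
  shows "set_integrable lborel {B..1} (\<lambda>x. x powr (- k - 1))" "(LINT x:{B..1}|lborel. x powr (- k - 1)) \<le> B powr (- k) / k"
proof -
  show I: "set_integrable lborel {B..1} (\<lambda>x. x powr (- k - 1))"
    unfolding set_integrable_def by (rule borel_integrable_compact) (use assms in \<open>auto intro!: continuous_intros\<close>)
  have "((\<lambda>x. x powr (- k - 1)) has_integral - (1 powr (- k) / k) - - (B powr (- k) / k)) {B..1}"
    by (rule fundamental_theorem_of_calculus)
       (use assms in \<open>auto intro!: derivative_eq_intros simp: has_real_derivative_iff_has_vector_derivative[symmetric]\<close>)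
  then show "(LINT x:{B..1}|lborel. x powr (- k - 1)) \<le> B powr (- k) / k"
    using set_borel_integral_eq_integral(2)[OF I] assms by (simp add: integral_unique)
qed

text \<open>For \<open>s = r powr u\<close> the weight times \<open>s\<close> is comparable to
  \<open>r\<close> to the power of the maximum over the exponents \<open>(a, b)\<close> of \<open>(1
  - \<rho> * b) * u - \<rho> * a\<close>. With \<open>m\<close>, \<open>p\<close>, \<open>q\<close>
  as in \<open>max_affine_minimum\<close>, the weight is comparable to \<open>r powr m / s\<close>
  for \<open>s\<close> between \<open>A = r powr q\<close> and \<open>B = r powr p\<close>, which
  contributes \<open>r powr m * (q - p) * \<bar>ln r\<bar>\<close>, and \<open>s\<close> times the
  weight decays like a power on either side, which contributes at most a multiple of \<open>r powr
  m\<close>. The logarithm is present exactly if \<open>p < q\<close>. The hypothesis on \<open>(a0,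
  b0)\<close> is integrability of the weight in \<open>s\<close> near 0.\<close>
lemma growth_two_sided_pos:
  assumes P: "finite P" and \<rho>: "\<rho> > 0" and ab: "(a0, b0) \<in> P" "\<rho> * real b0 < 1"
  shows "\<exists>m. \<exists>d\<in>{0, 1::nat}. \<exists>c1>0. \<exists>c2>0. \<forall>r. 0 < r \<and> r < 1 / 2 \<longrightarrow>
     set_integrable lborel {0<..<1} (\<lambda>s. monomial_sum P r s powr (- \<rho>)) \<and>
     c1 * r powr m * \<bar>ln r\<bar> ^ d \<le> (LINT s:{0<..<1}|lborel. monomial_sum P r s powr (- \<rho>)) \<and>
     (LINT s:{0<..<1}|lborel. monomial_sum P r s powr (- \<rho>)) \<le> c2 * r powr m * \<bar>ln r\<bar> ^ d"
proof -
  define \<alpha> \<beta> where "\<alpha> = (\<lambda>v::nat \<times> nat. 1 - \<rho> * real (snd v))" and "\<beta> = (\<lambda>v::nat \<times> nat. - \<rho> * real (fst v))"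
  have "\<alpha> (a0, b0) > 0" using ab by (simp add: \<alpha>_def)
  from max_affine_minimum[OF P ab(1), of \<alpha> \<beta>, OF this]
  obtain m p q iq where pq: "0 \<le> p" "p \<le> q"
    and ge: "\<And>u. u \<ge> 0 \<Longrightarrow> \<exists>i\<in>P. \<alpha> i * u + \<beta> i \<ge> m"
    and le: "\<And>u i. p \<le> u \<Longrightarrow> u \<le> q \<Longrightarrow> i \<in> P \<Longrightarrow> \<alpha> i * u + \<beta> i \<le> m"
    and iq: "iq \<in> P" "\<alpha> iq > 0" "\<alpha> iq * q + \<beta> iq = m"
    and ip: "p = 0 \<or> (\<exists>i\<in>P. \<alpha> i < 0 \<and> \<alpha> i * p + \<beta> i = m)" by metis
  \<comment> \<open>The slopes, up to sign, of the rising line at \<open>q\<close> and of the falling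
    line at \<open>p\<close>; the value 1 for \<open>p = 0\<close> is arbitrary, since
    then \<open>B = 1\<close>.\<close>
  define \<kappa> where "\<kappa> = \<alpha> iq"
  define \<kappa>' where "\<kappa>' = (if p = 0 then 1 else - \<alpha> (SOME i. i \<in> P \<and> \<alpha> i < 0 \<and> \<alpha> i * p + \<beta> i = m))"
  have \<kappa>: "\<kappa> > 0" using iq by (simp add: \<kappa>_def)
  have ip': "\<kappa>' > 0" "p \<noteq> 0 \<Longrightarrow> \<exists>i\<in>P. \<alpha> i = - \<kappa>' \<and> - \<kappa>' * p + \<beta> i = m"
  proof -
    have "\<kappa>' > 0 \<and> (p \<noteq> 0 \<longrightarrow> (\<exists>i\<in>P. \<alpha> i = - \<kappa>' \<and> - \<kappa>' * p + \<beta> i = m))"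
    proof (cases "p = 0")
      case False
      then have "\<exists>i. i \<in> P \<and> \<alpha> i < 0 \<and> \<alpha> i * p + \<beta> i = m" using ip by blast
      from someI_ex[OF this] show ?thesis using False by (auto simp: \<kappa>'_def)
    qed (simp add: \<kappa>'_def)
    then show "\<kappa>' > 0" "p \<noteq> 0 \<Longrightarrow> \<exists>i\<in>P. \<alpha> i = - \<kappa>' \<and> - \<kappa>' * p + \<beta> i = m" by auto
  qed
  define N where "N = real (card P)"
  have N: "N > 0" using P ab by (auto simp: N_def card_gt_0_iff)
  define w where "w r s = monomial_sum P r s powr (- \<rho>)" for r s
  \<comment> \<open>Along \<open>s = r powr u\<close> this is \<open>r powr (\<alpha> i * u + \<beta> i)
    / s\<close>, so the lines are compared at \<open>u\<close>.\<close>
  have line: "(r ^ fst i * s ^ snd i) powr (- \<rho>) = r powr (\<beta> i) * s powr (\<alpha> i - 1)" if "0 < r" "0 < s" for r s i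
    using that by (simp add: powr_mult powr_powr powr_realpow[symmetric] \<alpha>_def \<beta>_def mult.commute)
  have wle: "w r s \<le> r powr (\<beta> i) * s powr (\<alpha> i - 1)" if rs: "0 < r" "0 < s" and i: "i \<in> P" for r s i
    unfolding w_def line[OF rs, symmetric] using rs i \<rho> monomial_le_sum[OF P, of "fst i" "snd i" r s]
    by (intro powr_mono2') auto
  have wge: "N powr (- \<rho>) * c \<le> w r s" if rs: "0 < r" "0 < s"
    and c: "\<And>i. i \<in> P \<Longrightarrow> c \<le> r powr (\<beta> i) * s powr (\<alpha> i - 1)" and c0: "c > 0" for r s c
  proof -
    have "monomial_sum P r s \<le> N * c powr (- 1 / \<rho>)"
      unfolding N_def
    proof (rule monomial_sum_le)
      fix a b assume ab: "(a, b) \<in> P"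
      have x0: "r ^ a * s ^ b > 0" using rs by simp
      have "c \<le> (r ^ a * s ^ b) powr (- \<rho>)" using c[OF ab] line[OF rs, of "(a, b)"] by simp
      then have "((r ^ a * s ^ b) powr (- \<rho>)) powr (- 1 / \<rho>) \<le> c powr (- 1 / \<rho>)"
        using \<rho> c0 by (intro powr_mono2') auto
      then show "r ^ a * s ^ b \<le> c powr (- 1 / \<rho>)" using \<rho> x0 by (simp add: powr_powr)
    qed
    then have "(N * c powr (- 1 / \<rho>)) powr (- \<rho>) \<le> w r s"
      unfolding w_def using monomial_sum_pos[OF P _ rs] ab \<rho> by (intro powr_mono2') auto
    then show ?thesis using N c0 \<rho> by (simp add: powr_mult powr_powr)
  qed
  define C0 where "C0 = 1 / \<kappa> + 1 / \<kappa>'"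
  have C0: "C0 > 0" using \<kappa> ip' by (auto simp: C0_def intro: add_pos_pos)
  have main: "set_integrable lborel {0<..<1} (w r) \<and>
      (LINT s:{0<..<1}|lborel. w r s) \<le> r powr m * (C0 + (q - p) * \<bar>ln r\<bar>) \<and>
      N powr (- \<rho>) * r powr m * (q - p) * \<bar>ln r\<bar> \<le> (LINT s:{0<..<1}|lborel. w r s) \<and>
      N powr (- \<rho>) * r powr m / 2 \<le> (LINT s:{0<..<1}|lborel. w r s)" if r: "0 < r" "r < 1 / 2" for r
  proof -
    define A B where "A = r powr q" and "B = r powr p"
    have A: "0 < A" "A \<le> B" "B \<le> 1"
      using r pq powr_mono'[of p q r] powr_mono'[of 0 p r] by (auto simp: A_def B_def)
    have lnAB: "ln B - ln A = (q - p) * \<bar>ln r\<bar>"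
      using r by (simp add: A_def B_def algebra_simps)
    have U1: "w r s \<le> r powr (m - \<kappa> * q) * s powr (\<kappa> - 1)" if "0 < s" for s
    proof -
      have "\<beta> iq = m - \<kappa> * q" using iq(3) by (simp add: \<kappa>_def)
      then show ?thesis using wle[OF r(1) that iq(1)] by (simp add: \<kappa>_def)
    qed
    have U2: "w r s \<le> r powr (m + \<kappa>' * p) * s powr (- \<kappa>' - 1)" if s: "0 < s" "p \<noteq> 0" for s
    proof -
      obtain i where i: "i \<in> P" "\<alpha> i = - \<kappa>'" "- \<kappa>' * p + \<beta> i = m" using ip'(2)[OF s(2)] by blast
      have "\<beta> i = m + \<kappa>' * p" using i(3) by simp
      then show ?thesis using wle[OF r(1) s(1) i(1)] i(2) by simp
    qed
    have ru: "\<exists>u\<ge>0. s = r powr u" if "0 < s" "s \<le> 1" for s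
    proof (intro exI conjI)
      show "ln s / ln r \<ge> 0" using that r by (auto intro!: divide_nonpos_neg)
      show "s = r powr (ln s / ln r)" using that r by (simp add: powr_def)
    qed
    have rline: "r powr (\<beta> i) * s powr (\<alpha> i - 1) = r powr (\<alpha> i * u + \<beta> i) / s" if "s = r powr u" for s u i
      using r by (simp add: that powr_powr powr_add[symmetric] powr_diff[symmetric] algebra_simps)
    have U3: "w r s \<le> r powr m * (1 / s)" if s: "0 < s" "s \<le> 1" for s
    proof -
      obtain u where u: "u \<ge> 0" "s = r powr u" using ru[OF s] by blast
      obtain i where i: "i \<in> P" "\<alpha> i * u + \<beta> i \<ge> m" using ge[OF u(1)] by blast
      have "w r s \<le> r powr (\<alpha> i * u + \<beta> i) / s" using wle[OF r(1) s(1) i(1)] rline[OF u(2)] by simp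
      also have "\<dots> \<le> r powr m / s" using i r s by (intro divide_right_mono powr_mono') auto
      finally show ?thesis by simp
    qed
    have L1: "N powr (- \<rho>) * (r powr m * (1 / s)) \<le> w r s" if s: "A \<le> s" "s \<le> B" for s
    proof (rule wge[OF r(1)])
      have s0: "0 < s" "s \<le> 1" using A s by auto
      then show "0 < s" "0 < r powr m * (1 / s)" using r by auto
      obtain u where u: "u \<ge> 0" "s = r powr u" using ru[OF s0] by blast
      have "p \<le> u" "u \<le> q"
        using s r powr_less_mono'[of r q u] powr_less_mono'[of r u p] unfolding u(2) A_def B_def
        by (auto simp: not_less[symmetric])
      then have "r powr m / s \<le> r powr (\<alpha> i * u + \<beta> i) / s" if "i \<in> P" for i
        using le[OF _ _ that, of u] r s0 by (intro divide_right_mono powr_mono') auto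
      then show "r powr m * (1 / s) \<le> r powr \<beta> i * s powr (\<alpha> i - 1)" if "i \<in> P" for i
        using that rline[OF u(2)] by simp
    qed
    have w0: "w r s \<ge> 0" for s by (simp add: w_def)
    have wm: "(\<lambda>s. indicator X s *\<^sub>R w r s) \<in> borel_measurable lborel" if "X \<in> sets borel" for X
      using measurable_monomial_weight[of P r "- \<rho>"] that unfolding w_def by simp
    have int: "set_integrable lborel {0<..<1} (w r)"
    proof (rule set_integrable_bound[OF set_integrable_mult_right[OF power_integral_01(1)[of "\<kappa> - 1" 1], of "r powr (m - \<kappa> * q)"]])
      show "AE x in lborel. x \<in> {0<..<1} \<longrightarrow> norm (w r x) \<le> norm (r powr (m - \<kappa> * q) * x powr (\<kappa> - 1))"
        using U1 w0 by (auto intro!: AE_I2)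
    qed (use \<kappa> wm in \<open>auto simp: set_borel_measurable_def\<close>)
    have sub: "set_integrable lborel X (w r)" if "X \<subseteq> {0<..<1}" "X \<in> sets borel" for X
      by (rule set_integrable_subset[OF int]) (use that in auto)
    define f1 f2 f3 where "f1 = (\<lambda>s. indicator {0<..<A} s *\<^sub>R (r powr (m - \<kappa> * q) * s powr (\<kappa> - 1)))"
      and "f2 = (\<lambda>s. indicator {A..B} s *\<^sub>R (r powr m * (1 / s)))"
      and "f3 = (\<lambda>s. indicator {B..1} s *\<^sub>R (r powr (m + \<kappa>' * p) * s powr (- \<kappa>' - 1)))"
    have If: "integrable lborel f1" "integrable lborel f2" "integrable lborel f3"
      unfolding f1_def f2_def f3_def
      using set_integrable_mult_right[OF power_integral_01(1)[of "\<kappa> - 1" A], of "r powr (m - \<kappa> * q)"]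
        set_integrable_mult_right[OF inverse_integral(1)[OF A(1,2)], of "r powr m"]
        set_integrable_mult_right[OF tail_power_integral(1)[of B \<kappa>'], of "r powr (m + \<kappa>' * p)"] A \<kappa> ip'
      unfolding set_integrable_def by auto
    have I1: "integral\<^sup>L lborel f1 = r powr m / \<kappa>"
    proof -
      have "integral\<^sup>L lborel f1 = r powr (m - \<kappa> * q) * (LINT s:{0<..<A}|lborel. s powr (\<kappa> - 1))"
        unfolding f1_def set_lebesgue_integral_def[symmetric] by (rule set_integral_mult_right)
      also have "\<dots> = r powr (m - \<kappa> * q) * (A powr \<kappa> / \<kappa>)" using power_integral_01(2)[of "\<kappa> - 1" A] A \<kappa> by simp
      also have "\<dots> = r powr m / \<kappa>"
        using r by (simp add: A_def powr_powr powr_diff mult.commute)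
      finally show ?thesis .
    qed
    have I2: "integral\<^sup>L lborel f2 = r powr m * ((q - p) * \<bar>ln r\<bar>)"
    proof -
      have "integral\<^sup>L lborel f2 = r powr m * (LINT s:{A..B}|lborel. 1 / s)"
        unfolding f2_def set_lebesgue_integral_def[symmetric] by (rule set_integral_mult_right)
      then show ?thesis using inverse_integral(2)[OF A(1,2)] lnAB by simp
    qed
    have I3: "integral\<^sup>L lborel f3 \<le> r powr m / \<kappa>'"
    proof -
      have "integral\<^sup>L lborel f3 = r powr (m + \<kappa>' * p) * (LINT s:{B..1}|lborel. s powr (- \<kappa>' - 1))"
        unfolding f3_def set_lebesgue_integral_def[symmetric] by (rule set_integral_mult_right)
      also have "\<dots> \<le> r powr (m + \<kappa>' * p) * (B powr (- \<kappa>') / \<kappa>')"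
        using tail_power_integral(2)[of B \<kappa>'] A ip' by (intro mult_left_mono) auto
      also have "\<dots> = r powr m / \<kappa>'"
        using r by (simp add: B_def powr_powr powr_add powr_minus mult.commute)
      finally show ?thesis .
    qed
    have "(LINT s:{0<..<1}|lborel. w r s) \<le> integral\<^sup>L lborel (\<lambda>s. f1 s + f2 s + f3 s)"
      unfolding set_lebesgue_integral_def
    proof (rule integral_mono)
      show "integrable lborel (\<lambda>s. indicator {0<..<1} s *\<^sub>R w r s)" using int by (simp add: set_integrable_def)
      show "integrable lborel (\<lambda>s. f1 s + f2 s + f3 s)" using If by simp
      fix s :: real
      have nn: "f1 s \<ge> 0" "f2 s \<ge> 0" "f3 s \<ge> 0"
        using A by (auto simp: f1_def f2_def f3_def indicator_def)
      show "indicator {0<..<1} s *\<^sub>R w r s \<le> f1 s + f2 s + f3 s"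
      proof (cases "s \<in> {0<..<1}")
        case True
        then consider "s < A" | "A \<le> s" "s \<le> B" | "B < s" by linarith
        then show ?thesis
        proof cases
          case 1
          then have "w r s \<le> f1 s" using U1[of s] True by (simp add: f1_def)
          then show ?thesis using nn True by simp
        next
          case 2
          then have "w r s \<le> f2 s" using U3[of s] True by (simp add: f2_def)
          then show ?thesis using nn True by simp
        next
          case 3
          then have "p \<noteq> 0" using True r by (auto simp: B_def)
          then have "w r s \<le> f3 s" using U2[of s] True 3 by (simp add: f3_def)
          then show ?thesis using nn True by simp
        qed
      qed (use nn in simp)
    qed
    also have "\<dots> = integral\<^sup>L lborel f1 + integral\<^sup>L lborel f2 + integral\<^sup>L lborel f3"
      using If by (simp add: Bochner_Integration.integral_add)
    also have "\<dots> \<le> r powr m * (C0 + (q - p) * \<bar>ln r\<bar>)"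
      using I1 I2 I3 by (simp add: C0_def algebra_simps)
    finally have upper: "(LINT s:{0<..<1}|lborel. w r s) \<le> r powr m * (C0 + (q - p) * \<bar>ln r\<bar>)" .
    have low1: "N powr (- \<rho>) * r powr m * (q - p) * \<bar>ln r\<bar> \<le> (LINT s:{0<..<1}|lborel. w r s)"
    proof -
      have "N powr (- \<rho>) * r powr m * (q - p) * \<bar>ln r\<bar> = N powr (- \<rho>) * integral\<^sup>L lborel f2"
        unfolding I2 by simp
      also have "\<dots> = integral\<^sup>L lborel (\<lambda>s. N powr (- \<rho>) * f2 s)" by simp
      also have "\<dots> \<le> (LINT s|lborel. indicator {0<..<1} s *\<^sub>R w r s)"
      proof (rule integral_mono_AE)
        show "integrable lborel (\<lambda>s. N powr (- \<rho>) * f2 s)" using If by simp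
        show "integrable lborel (\<lambda>s. indicator {0<..<1} s *\<^sub>R w r s)" using int by (simp add: set_integrable_def)
        show "AE s in lborel. N powr (- \<rho>) * f2 s \<le> indicator {0<..<1} s *\<^sub>R w r s"
          using AE_lborel_singleton[of 1]
        proof eventually_elim
          case (elim s)
          then show ?case using L1[of s] A w0[of s] by (auto simp: f2_def indicator_def)
        qed
      qed
      finally show ?thesis by (simp add: set_lebesgue_integral_def)
    qed
    \<comment> \<open>The weight decreases in \<open>s\<close>, so on \<open>{A/2<..<A}\<close> it is at
      least its value at \<open>A\<close>.\<close>
    have low2: "N powr (- \<rho>) * r powr m / 2 \<le> (LINT s:{0<..<1}|lborel. w r s)"
    proof -
      have sA: "{A/2<..<A} \<subseteq> {0<..<1}" using A by auto
      have "N powr (- \<rho>) * r powr m / 2 = (LINT s:{A/2<..<A}|lborel. N powr (- \<rho>) * (r powr m * (1 / A)))"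
        using A by (simp add: set_integral_const)
      also have "\<dots> \<le> (LINT s:{A/2<..<A}|lborel. w r s)"
      proof (rule set_integral_mono[OF _ sub[OF sA]])
        show "set_integrable lborel {A/2<..<A} (\<lambda>s. N powr (- \<rho>) * (r powr m * (1 / A)))"
          unfolding set_integrable_def using A by (intro integrable_scaleR_left integrable_real_indicator) auto
        fix s assume s: "s \<in> {A/2<..<A}"
        then have s0: "0 < s" using A by auto
        have "monomial_sum P r s \<le> monomial_sum P r A"
          unfolding monomial_sum_def case_prod_unfold
          by (intro sum_mono mult_left_mono power_mono) (use s s0 r in auto)
        then have "w r A \<le> w r s"
          unfolding w_def using monomial_sum_pos[OF P _ r(1) s0] ab \<rho> by (intro powr_mono2') auto
        then show "N powr (- \<rho>) * (r powr m * (1 / A)) \<le> w r s"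
          using L1[of A] A by auto
      qed auto
      also have "\<dots> \<le> (LINT s:{0<..<1}|lborel. w r s)"
        by (rule set_integral_pos_mono_set[OF int _ sA]) (use w0 in auto)
      finally show ?thesis .
    qed
    show ?thesis using int upper low1 low2 by blast
  qed
  have Np: "N powr (- \<rho>) > 0" using N by simp
  show ?thesis
  proof (cases "p = q")
    case True
    show ?thesis
    proof (rule exI[of _ m], rule bexI[of _ "0::nat"], rule exI[of _ "N powr (- \<rho>) / 2"], rule conjI[rotated],
        rule exI[of _ C0], intro conjI allI impI)
      fix r :: real assume "0 < r \<and> r < 1 / 2"
      then have M: "set_integrable lborel {0<..<1} (w r)"
        "(LINT s:{0<..<1}|lborel. w r s) \<le> r powr m * (C0 + (q - p) * \<bar>ln r\<bar>)"
        "N powr (- \<rho>) * r powr m / 2 \<le> (LINT s:{0<..<1}|lborel. w r s)" using main[of r] by auto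
      show "set_integrable lborel {0<..<1} (\<lambda>s. monomial_sum P r s powr (- \<rho>))"
        "N powr (- \<rho>) / 2 * r powr m * \<bar>ln r\<bar> ^ 0 \<le> (LINT s:{0<..<1}|lborel. monomial_sum P r s powr (- \<rho>))"
        "(LINT s:{0<..<1}|lborel. monomial_sum P r s powr (- \<rho>)) \<le> C0 * r powr m * \<bar>ln r\<bar> ^ 0"
        using M True by (simp_all add: w_def[abs_def] mult.commute)
    qed (use Np C0 in auto)
  next
    case False
    then have pq': "q - p > 0" using pq by simp
    show ?thesis
    proof (rule exI[of _ m], rule bexI[of _ "1::nat"], rule exI[of _ "N powr (- \<rho>) * (q - p)"], rule conjI[rotated],
        rule exI[of _ "C0 / ln 2 + (q - p)"], intro conjI allI impI)
      fix r :: real assume r: "0 < r \<and> r < 1 / 2"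
      then have M: "set_integrable lborel {0<..<1} (w r)"
        "(LINT s:{0<..<1}|lborel. w r s) \<le> r powr m * (C0 + (q - p) * \<bar>ln r\<bar>)"
        "N powr (- \<rho>) * r powr m * (q - p) * \<bar>ln r\<bar> \<le> (LINT s:{0<..<1}|lborel. w r s)" using main[of r] by auto
      have "ln r \<le> ln (1 / 2)" using r by (subst ln_le_cancel_iff) auto
      then have "\<bar>ln r\<bar> \<ge> ln 2" by (simp add: ln_div)
      then have "C0 / ln 2 * ln 2 \<le> C0 / ln 2 * \<bar>ln r\<bar>" using C0 by (intro mult_left_mono) auto
      then have "C0 + (q - p) * \<bar>ln r\<bar> \<le> (C0 / ln 2 + (q - p)) * \<bar>ln r\<bar>" by (simp add: algebra_simps)
      then have "r powr m * (C0 + (q - p) * \<bar>ln r\<bar>) \<le> r powr m * ((C0 / ln 2 + (q - p)) * \<bar>ln r\<bar>)"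
        by (rule mult_left_mono) auto
      then show "set_integrable lborel {0<..<1} (\<lambda>s. monomial_sum P r s powr (- \<rho>))"
        "N powr (- \<rho>) * (q - p) * r powr m * \<bar>ln r\<bar> ^ 1 \<le> (LINT s:{0<..<1}|lborel. monomial_sum P r s powr (- \<rho>))"
        "(LINT s:{0<..<1}|lborel. monomial_sum P r s powr (- \<rho>)) \<le> (C0 / ln 2 + (q - p)) * r powr m * \<bar>ln r\<bar> ^ 1"
        using M by (simp_all add: w_def[abs_def] mult_ac)
    qed (use Np C0 pq' in \<open>auto intro: add_pos_pos\<close>)
  qed
qed

text \<open>Now the weight is a nonnegative power of the monomial sum, and the monomial with the least power
  of \<open>r\<close> determines the order; no logarithm arises.\<close>
lemma growth_two_sided_nonpos:
  assumes P: "finite P" "P \<noteq> {}" and \<rho>: "\<rho> \<le> 0"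
  shows "\<exists>m. \<exists>c1>0. \<exists>c2>0. \<forall>r. 0 < r \<and> r < 1 / 2 \<longrightarrow>
     set_integrable lborel {0<..<1} (\<lambda>s. monomial_sum P r s powr (- \<rho>)) \<and>
     c1 * r powr m \<le> (LINT s:{0<..<1}|lborel. monomial_sum P r s powr (- \<rho>)) \<and>
     (LINT s:{0<..<1}|lborel. monomial_sum P r s powr (- \<rho>)) \<le> c2 * r powr m"
proof -
  obtain a0 b0 where ab: "(a0, b0) \<in> P" "\<And>a b. (a, b) \<in> P \<Longrightarrow> a0 \<le> a"
  proof -
    have "Min (fst ` P) \<in> fst ` P" using P by (intro Min_in) auto
    then obtain b where "(Min (fst ` P), b) \<in> P" by force
    moreover have "Min (fst ` P) \<le> a" if "(a, b) \<in> P" for a b using P that by (intro Min_le) force+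
    ultimately show thesis using that by blast
  qed
  define \<sigma> where "\<sigma> = - \<rho>"
  have \<sigma>: "\<sigma> \<ge> 0" using \<rho> by (simp add: \<sigma>_def)
  define N where "N = real (card P)"
  have N: "N > 0" using P by (auto simp: N_def card_gt_0_iff)
  define m where "m = \<sigma> * real a0"
  define k where "k = \<sigma> * real b0"
  have k: "k \<ge> 0" using \<sigma> by (simp add: k_def)
  have main: "set_integrable lborel {0<..<1} (\<lambda>s. monomial_sum P r s powr \<sigma>) \<and>
     1 / (k + 1) * r powr m \<le> (LINT s:{0<..<1}|lborel. monomial_sum P r s powr \<sigma>) \<and>
     (LINT s:{0<..<1}|lborel. monomial_sum P r s powr \<sigma>) \<le> N powr \<sigma> * r powr m" if r: "0 < r" "r < 1 / 2" for r
  proof -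
    have up: "monomial_sum P r s powr \<sigma> \<le> N powr \<sigma> * r powr m" if s: "s \<in> {0<..<1}" for s
    proof -
      have "monomial_sum P r s \<le> N * r ^ a0"
        unfolding N_def
      proof (rule monomial_sum_le)
        fix a b assume "(a, b) \<in> P"
        then have "r ^ a * s ^ b \<le> r ^ a0 * 1"
          using ab(2) r s by (intro mult_mono power_decreasing power_le_one) auto
        then show "r ^ a * s ^ b \<le> r ^ a0" by simp
      qed
      then have "monomial_sum P r s powr \<sigma> \<le> (N * r ^ a0) powr \<sigma>"
        using monomial_sum_pos[OF P r(1), of s] s \<sigma> by (intro powr_mono2) auto
      then show ?thesis using r N by (simp add: powr_mult powr_powr powr_realpow[symmetric] m_def mult.commute)
    qed
    have low: "r powr m * s powr k \<le> monomial_sum P r s powr \<sigma>" if s: "s \<in> {0<..<1}" for s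
    proof -
      have "(r ^ a0 * s ^ b0) powr \<sigma> \<le> monomial_sum P r s powr \<sigma>"
        using monomial_le_sum[OF P(1) ab(1), of r s] r s \<sigma> by (intro powr_mono2) auto
      then show ?thesis using r s by (simp add: powr_mult powr_powr powr_realpow[symmetric] m_def k_def mult.commute)
    qed
    have const: "set_integrable lborel {0<..<1} (\<lambda>s::real. c)" for c :: real
      unfolding set_integrable_def by (intro integrable_scaleR_left integrable_real_indicator) auto
    have int: "set_integrable lborel {0<..<1} (\<lambda>s. monomial_sum P r s powr \<sigma>)"
    proof (rule set_integrable_bound[OF const[of "N powr \<sigma> * r powr m"]])
      show "set_borel_measurable lborel {0<..<1} (\<lambda>s. monomial_sum P r s powr \<sigma>)"
        unfolding set_borel_measurable_def using measurable_monomial_weight[of P r \<sigma>] by simp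
    qed (use up in auto)
    have "(LINT s:{0<..<1}|lborel. monomial_sum P r s powr \<sigma>) \<le> (LINT s:{0<..<1::real}|lborel. N powr \<sigma> * r powr m)"
      by (rule set_integral_mono[OF int const up])
    also have "\<dots> = N powr \<sigma> * r powr m" by (simp add: set_integral_const)
    finally have 1: "(LINT s:{0<..<1}|lborel. monomial_sum P r s powr \<sigma>) \<le> N powr \<sigma> * r powr m" .
    have "1 / (k + 1) * r powr m = r powr m * (LINT s:{0<..<1}|lborel. s powr k)"
      using power_integral_01(2)[of k 1] k by simp
    also have "\<dots> = (LINT s:{0<..<1}|lborel. r powr m * s powr k)" by simp
    also have "\<dots> \<le> (LINT s:{0<..<1}|lborel. monomial_sum P r s powr \<sigma>)"
      using power_integral_01(1)[of k 1] k by (intro set_integral_mono[OF _ int low] set_integrable_mult_right) auto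
    finally show ?thesis using int 1 by blast
  qed
  have "1 / (k + 1) > 0" "N powr \<sigma> > 0" using k N by auto
  then show ?thesis using main unfolding \<sigma>_def by blast
qed

lemma growth_two_sided:
  assumes P: "finite P" and ab: "(a0, b0) \<in> P" "\<rho> * real b0 < 1"
  obtains m d c1 c2 where "d \<in> {0, 1::nat}" "c1 > 0" "c2 > 0"
    "\<And>r. 0 < r \<Longrightarrow> r < 1 / 2 \<Longrightarrow> set_integrable lborel {0<..<1} (\<lambda>s. monomial_sum P r s powr (- \<rho>))"
    "\<And>r. 0 < r \<Longrightarrow> r < 1 / 2 \<Longrightarrow> c1 * r powr m * \<bar>ln r\<bar> ^ d \<le> (LINT s:{0<..<1}|lborel. monomial_sum P r s powr (- \<rho>))"
    "\<And>r. 0 < r \<Longrightarrow> r < 1 / 2 \<Longrightarrow> (LINT s:{0<..<1}|lborel. monomial_sum P r s powr (- \<rho>)) \<le> c2 * r powr m * \<bar>ln r\<bar> ^ d"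
proof (cases "\<rho> > 0")
  case True
  from growth_two_sided_pos[OF P True ab]
  obtain m d c1 c2 where "d \<in> {0, 1::nat}" "c1 > 0" "c2 > 0" and *: "\<And>r. 0 < r \<and> r < 1 / 2 \<Longrightarrow>
     set_integrable lborel {0<..<1} (\<lambda>s. monomial_sum P r s powr (- \<rho>)) \<and>
     c1 * r powr m * \<bar>ln r\<bar> ^ d \<le> (LINT s:{0<..<1}|lborel. monomial_sum P r s powr (- \<rho>)) \<and>
     (LINT s:{0<..<1}|lborel. monomial_sum P r s powr (- \<rho>)) \<le> c2 * r powr m * \<bar>ln r\<bar> ^ d" by blast
  then show thesis by (intro that[of d c1 c2 m]) auto
next
  case False
  then have "\<rho> \<le> 0" "P \<noteq> {}" using ab by auto
  from growth_two_sided_nonpos[OF P this(2,1)]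
  obtain m c1 c2 where "c1 > 0" "c2 > 0" and *: "\<And>r. 0 < r \<and> r < 1 / 2 \<Longrightarrow>
     set_integrable lborel {0<..<1} (\<lambda>s. monomial_sum P r s powr (- \<rho>)) \<and>
     c1 * r powr m \<le> (LINT s:{0<..<1}|lborel. monomial_sum P r s powr (- \<rho>)) \<and>
     (LINT s:{0<..<1}|lborel. monomial_sum P r s powr (- \<rho>)) \<le> c2 * r powr m" by blast
  then show thesis by (intro that[of 0 c1 c2 m]) auto
qed

definition weight :: "(nat \<times> nat) set \<Rightarrow> real \<Rightarrow> real \<Rightarrow> real \<Rightarrow> real" where
  "weight P \<rho> r s = (\<Sum>(a, b)\<in>P. \<bar>r\<bar> ^ a * \<bar>s\<bar> ^ b) powr (- \<rho>)"

lemma weight_eq: "0 < r \<Longrightarrow> 0 < s \<Longrightarrow> weight P \<rho> r s = monomial_sum P r s powr (- \<rho>)"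
  by (simp add: weight_def monomial_sum_def)

lemma measurable_weight_section: "(\<lambda>s. weight P \<rho> r s) \<in> borel_measurable borel"
  unfolding weight_def case_prod_unfold
  by (intro powr_real_measurable borel_measurable_continuous_onI continuous_intros)

lemma lebesgue_Icc_integral:
  fixes g :: "real \<Rightarrow> real"
  assumes "g \<in> borel_measurable borel"
  shows "(LINT s:{0..b}|lebesgue. g s) = (LINT s:{0<..<b}|lborel. g s)"
proof -
  have "(LINT s:{0..b}|lebesgue. g s) = (LINT s:{0..b}|lborel. g s)"
    unfolding set_lebesgue_integral_def by (rule integral_completion) (use assms in simp)
  also have "\<dots> = (LINT s:{0<..<b}|lborel. g s)"
    unfolding set_lebesgue_integral_def
  proof (rule integral_cong_AE)
    show "AE s in lborel. indicator {0..b} s *\<^sub>R g s = indicator {0<..<b} s *\<^sub>R g s"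
      using AE_lborel_singleton[of 0] AE_lborel_singleton[of b]
      by eventually_elim (auto simp: indicator_def)
  qed (use assms in auto)
  finally show ?thesis .
qed

text \<open>The exponents do not depend on the upper limit \<open>r0\<close> of integration, because rescaling
  \<open>s\<close> changes the weight by a bounded factor.\<close>
lemma growth_pair_exists:
  assumes P: "finite P" and ab: "(a0, b0) \<in> P" "\<rho> * real b0 < 1"
  shows "\<exists>p. is_growth_pair (weight P \<rho>) p"
proof -
  from growth_two_sided[OF P ab] obtain m d c1 c2 where d: "d \<in> {0, 1::nat}" and c: "c1 > 0" "c2 > 0"
    and int: "\<And>r. 0 < r \<Longrightarrow> r < 1 / 2 \<Longrightarrow> set_integrable lborel {0<..<1} (\<lambda>s. monomial_sum P r s powr (- \<rho>))"
    and lo: "\<And>r. 0 < r \<Longrightarrow> r < 1 / 2 \<Longrightarrow> c1 * r powr m * \<bar>ln r\<bar> ^ d \<le> (LINT s:{0<..<1}|lborel. monomial_sum P r s powr (- \<rho>))"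
    and hi: "\<And>r. 0 < r \<Longrightarrow> r < 1 / 2 \<Longrightarrow> (LINT s:{0<..<1}|lborel. monomial_sum P r s powr (- \<rho>)) \<le> c2 * r powr m * \<bar>ln r\<bar> ^ d"
    by metis
  have "is_growth_pair (weight P \<rho>) (- m, d)"
    unfolding is_growth_pair_def prod.case
  proof (intro conjI allI impI d)
    fix r0 :: real assume r0: "0 < r0 \<and> r0 < 1 / 2"
    have P0: "P \<noteq> {}" using ab by auto
    obtain D where D: "\<And>a b. (a, b) \<in> P \<Longrightarrow> b \<le> D"
    proof -
      have "finite (snd ` P)" using P by simp
      then obtain D where "\<forall>n\<in>snd ` P. n \<le> D" using finite_nat_set_iff_bounded_le by blast
      then show thesis using that by force
    qed
    \<comment> \<open>Shrinking the interval for \<open>s\<close> from length 1 to length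
      \<open>r0\<close> costs only the constant factor \<open>r0 * k\<close>.\<close>
    define k where "k = min 1 ((r0 ^ D) powr (- \<rho>))"
    have k: "k > 0" using r0 by (simp add: k_def)
    have shrink: "k * monomial_sum P r s powr (- \<rho>) \<le> monomial_sum P r (r0 * s) powr (- \<rho>)" if rs: "0 < r" "0 < s" for r s
    proof (cases "\<rho> > 0")
      case True
      have "monomial_sum P r (r0 * s) \<le> monomial_sum P r s"
        unfolding monomial_sum_def case_prod_unfold
        by (intro sum_mono mult_left_mono power_mono) (use rs r0 in \<open>auto simp: mult_le_cancel_right1\<close>)
      then have "monomial_sum P r s powr (- \<rho>) \<le> monomial_sum P r (r0 * s) powr (- \<rho>)"
        using monomial_sum_pos[OF P P0, of r "r0 * s"] rs r0 True by (intro powr_mono2') auto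
      moreover have "k * monomial_sum P r s powr (- \<rho>) \<le> 1 * monomial_sum P r s powr (- \<rho>)"
        by (intro mult_right_mono) (auto simp: k_def)
      ultimately show ?thesis by simp
    next
      case False
      have "r0 ^ D * monomial_sum P r s \<le> monomial_sum P r (r0 * s)"
        unfolding monomial_sum_def sum_distrib_left
      proof (rule sum_mono)
        fix v assume v: "v \<in> P"
        obtain a b where v': "v = (a, b)" by (cases v)
        have "r0 ^ D * (r ^ a * s ^ b) \<le> r0 ^ b * (r ^ a * s ^ b)"
          using D[of a b] v v' r0 rs by (intro mult_right_mono power_decreasing) auto
        then show "r0 ^ D * (case v of (a, b) \<Rightarrow> r ^ a * s ^ b) \<le> (case v of (a, b) \<Rightarrow> r ^ a * (r0 * s) ^ b)"
          by (simp add: v' power_mult_distrib mult_ac)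
      qed
      then have "(r0 ^ D * monomial_sum P r s) powr (- \<rho>) \<le> monomial_sum P r (r0 * s) powr (- \<rho>)"
        using monomial_sum_pos[OF P P0 rs] r0 False by (intro powr_mono2) auto
      moreover have "(r0 ^ D * monomial_sum P r s) powr (- \<rho>) = (r0 ^ D) powr (- \<rho>) * monomial_sum P r s powr (- \<rho>)"
        using monomial_sum_pos[OF P P0 rs] r0 by (simp add: powr_mult)
      moreover have "k * monomial_sum P r s powr (- \<rho>) \<le> (r0 ^ D) powr (- \<rho>) * monomial_sum P r s powr (- \<rho>)"
        by (intro mult_right_mono) (auto simp: k_def)
      ultimately show ?thesis by linarith
    qed
    show "\<exists>c1>0. \<exists>c2>0. \<forall>r. 0 < r \<and> r < r0 \<longrightarrow>
          c1 * r powr (- (- m)) * \<bar>ln r\<bar> ^ d \<le> (LINT s:{0..r0}|lebesgue. weight P \<rho> r s) \<and>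
          (LINT s:{0..r0}|lebesgue. weight P \<rho> r s) \<le> c2 * r powr (- (- m)) * \<bar>ln r\<bar> ^ d"
    proof (rule exI[of _ "r0 * k * c1"], intro conjI exI[of _ c2] allI impI)
      fix r assume "0 < r \<and> r < r0"
      then have r: "0 < r" "r < 1 / 2" using r0 by auto
      let ?w = "\<lambda>s. monomial_sum P r s powr (- \<rho>)"
      have eq: "(LINT s:{0..r0}|lebesgue. weight P \<rho> r s) = (LINT s:{0<..<r0}|lborel. ?w s)"
        unfolding lebesgue_Icc_integral[OF measurable_weight_section]
        by (rule set_lebesgue_integral_cong) (use r in \<open>auto simp: weight_eq\<close>)
      have "(LINT s:{0<..<r0}|lborel. ?w s) \<le> (LINT s:{0<..<1}|lborel. ?w s)"
        by (rule set_integral_pos_mono_set[OF int[OF r]]) (use r0 in auto)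
      then show "(LINT s:{0..r0}|lebesgue. weight P \<rho> r s) \<le> c2 * r powr (- (- m)) * \<bar>ln r\<bar> ^ d"
        using hi[OF r] by (simp add: eq)
      have intr: "integrable lborel (\<lambda>s. indicator {0<..<r0} s *\<^sub>R ?w s)"
        unfolding set_integrable_def[symmetric]
        by (rule set_integrable_subset[OF int[OF r]]) (use r0 in auto)
      have ind: "indicator {0<..<r0} (r0 * s) = (indicator {0<..<1} s :: real)" for s
        using r0 by (auto simp: indicator_def zero_less_mult_iff)
      have "(LINT s:{0<..<r0}|lborel. ?w s) = r0 * (LINT s|lborel. indicator {0<..<1} s *\<^sub>R ?w (r0 * s))"
        unfolding set_lebesgue_integral_def
        using lborel_integral_real_affine[of r0 "\<lambda>s. indicator {0<..<r0} s *\<^sub>R ?w s" 0] r0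
        by (simp add: ind)
      moreover have "k * (LINT s:{0<..<1}|lborel. ?w s) \<le> (LINT s|lborel. indicator {0<..<1} s *\<^sub>R ?w (r0 * s))"
        unfolding set_lebesgue_integral_def integral_mult_right_zero[symmetric]
      proof (rule integral_mono)
        show "integrable lborel (\<lambda>s. k * (indicator {0<..<1} s *\<^sub>R ?w s))"
          using int[OF r] by (simp add: set_integrable_def)
        show "integrable lborel (\<lambda>s. indicator {0<..<1} s *\<^sub>R ?w (r0 * s))"
          using lborel_integrable_real_affine[OF intr, of r0 0] r0 by (simp add: ind)
        show "k * (indicator {0<..<1} s *\<^sub>R ?w s) \<le> indicator {0<..<1} s *\<^sub>R ?w (r0 * s)" for s
          using shrink[OF r(1), of s] by (auto simp: indicator_def)
      qed
      moreover have "k * (c1 * r powr m * \<bar>ln r\<bar> ^ d) \<le> k * (LINT s:{0<..<1}|lborel. ?w s)"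
        using lo[OF r] k by (intro mult_left_mono) auto
      ultimately have "r0 * (k * (c1 * r powr m * \<bar>ln r\<bar> ^ d)) \<le> (LINT s:{0<..<r0}|lborel. ?w s)"
        using r0 by (simp add: mult_left_mono)
      then show "r0 * k * c1 * r powr (- (- m)) * \<bar>ln r\<bar> ^ d \<le> (LINT s:{0..r0}|lebesgue. weight P \<rho> r s)"
        by (simp add: eq mult_ac)
    qed (use k c r0 in auto)
  qed
  then show ?thesis by blast
qed

text \<open>A power of \<open>r\<close> beats a logarithm, so domination of one rate by another orders the
  pairs lexicographically, and two rates that dominate each other have the same pair.\<close>
lemma growth_rate_order:
  fixes c1 c2 \<epsilon> \<epsilon>' :: real
  assumes c: "c1 > 0" and d: "d \<in> {0, 1::nat}" "d' \<in> {0, 1::nat}"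
    and le: "\<And>r. 0 < r \<Longrightarrow> r < 1 / 4 \<Longrightarrow> c1 * r powr (- \<epsilon>) * \<bar>ln r\<bar> ^ d \<le> c2 * r powr (- \<epsilon>') * \<bar>ln r\<bar> ^ d'"
  shows "\<epsilon> < \<epsilon>' \<or> \<epsilon> = \<epsilon>' \<and> d \<le> d'"
proof (rule ccontr)
  assume neg: "\<not> ?thesis"
  have small: "\<forall>\<^sub>F r in at_right 0. 0 < r \<and> r < (1 / 4 :: real)"
    by (rule eventually_at_rightI[of 0 "1/4"]) auto
  have "\<epsilon> > \<epsilon>' \<or> \<epsilon> = \<epsilon>' \<and> d = 1 \<and> d' = 0" using neg d by (cases "\<epsilon>' < \<epsilon>") auto
  then consider "\<epsilon> > \<epsilon>'" | "\<epsilon> = \<epsilon>'" "d = 1" "d' = 0" by blast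
  then show False
  proof cases
    case 1
    define \<eta> where "\<eta> = \<epsilon> - \<epsilon>'"
    have \<eta>: "\<eta> > 0" using 1 by (simp add: \<eta>_def)
    define K where "K = (ln 4) ^ d * c1"
    have K: "K > 0" using c by (simp add: K_def)
    have "\<forall>\<^sub>F r in at_right 0. K \<le> \<bar>c2\<bar> * (1 + 2 / \<eta>) * r powr (\<eta> / 2)"
      using small
    proof eventually_elim
      case (elim r)
      then have r: "0 < r" "r < 1" by auto
      have l4: "ln 4 \<le> \<bar>ln r\<bar>"
      proof -
        have "ln r \<le> ln (1 / 4)" using elim by (subst ln_le_cancel_iff) auto
        then show ?thesis by (simp add: ln_div)
      qed
      have lu: "\<bar>ln r\<bar> ^ d' \<le> (1 + 2 / \<eta>) * r powr (- \<eta> / 2)"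
      proof (cases "d' = 0")
        case True
        have "1 \<le> r powr (- \<eta> / 2)" using r \<eta> powr_mono'[of "- \<eta> / 2" 0 r] by simp
        then have "1 * 1 \<le> (1 + 2 / \<eta>) * r powr (- \<eta> / 2)" using \<eta> by (intro mult_mono) auto
        then show ?thesis using True by simp
      next
        case False
        have "ln (1 / r) \<le> (1 / r) powr (\<eta> / 2) / (\<eta> / 2)"
          by (rule ln_powr_bound) (use r \<eta> in auto)
        then have "\<bar>ln r\<bar> \<le> 2 / \<eta> * r powr (- \<eta> / 2)"
          using r by (simp add: ln_div powr_divide powr_minus_divide field_simps)
        also have "\<dots> \<le> (1 + 2 / \<eta>) * r powr (- \<eta> / 2)" by (intro mult_right_mono) auto
        finally show ?thesis using False d by simp
      qed
      have "K * r powr (- \<epsilon>) \<le> c1 * r powr (- \<epsilon>) * \<bar>ln r\<bar> ^ d"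
        using mult_left_mono[OF power_mono[OF l4, of d], of "c1 * r powr (- \<epsilon>)"] c by (simp add: K_def mult_ac)
      also have "\<dots> \<le> c2 * r powr (- \<epsilon>') * \<bar>ln r\<bar> ^ d'" by (rule le) (use elim in auto)
      also have "\<dots> \<le> \<bar>c2\<bar> * r powr (- \<epsilon>') * ((1 + 2 / \<eta>) * r powr (- \<eta> / 2))"
        using lu by (intro mult_mono) auto
      finally have "K * r powr (- \<epsilon>) * r powr \<epsilon> \<le> \<bar>c2\<bar> * r powr (- \<epsilon>') * ((1 + 2 / \<eta>) * r powr (- \<eta> / 2)) * r powr \<epsilon>"
        by (rule mult_right_mono) auto
      then have "K * (r powr (- \<epsilon>) * r powr \<epsilon>) \<le> \<bar>c2\<bar> * (1 + 2 / \<eta>) * (r powr (- \<epsilon>') * r powr (- \<eta> / 2) * r powr \<epsilon>)"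
        by (simp only: mult_ac)
      moreover have "r powr (- \<epsilon>') * r powr (- \<eta> / 2) * r powr \<epsilon> = r powr (\<eta> / 2)"
        by (simp add: powr_add[symmetric] \<eta>_def field_simps)
      moreover have "r powr (- \<epsilon>) * r powr \<epsilon> = 1" using r by (simp add: powr_add[symmetric])
      ultimately show ?case by simp
    qed
    moreover have "((\<lambda>r. \<bar>c2\<bar> * (1 + 2 / \<eta>) * r powr (\<eta> / 2)) \<longlongrightarrow> \<bar>c2\<bar> * (1 + 2 / \<eta>) * 0) (at_right 0)"
    proof (rule tendsto_mult[OF tendsto_const tendsto_zero_powrI[OF _ tendsto_const]])
      show "((\<lambda>r. r) \<longlongrightarrow> (0::real)) (at_right 0)" by (rule tendsto_ident_at)
      show "\<forall>\<^sub>F r in at_right 0. 0 \<le> (r::real)" by (rule eventually_at_rightI[of 0 1]) auto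
    qed (use \<eta> in auto)
    ultimately have "K \<le> \<bar>c2\<bar> * (1 + 2 / \<eta>) * 0"
      by (intro tendsto_lowerbound[of _ _ "at_right (0::real)"]) auto
    then show False using K by simp
  next
    case 2
    \<comment> \<open>At this point the logarithm exceeds \<open>c2 / c1\<close>.\<close>
    define r where "r = exp (- (\<bar>c2\<bar> / c1 + 4))"
    have "exp (- (\<bar>c2\<bar> / c1 + 4)) \<le> exp (- 4)" using c by simp
    also have "exp (- 4 :: real) < 1 / 4"
      using exp_ge_add_one_self[of "4::real"] by (simp add: exp_minus field_simps)
    finally have r: "0 < r" "r < 1 / 4" by (auto simp: r_def)
    have "ln r = - (\<bar>c2\<bar> / c1 + 4)" by (simp add: r_def)
    moreover have "\<bar>c2\<bar> / c1 \<ge> 0" using c by simp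
    ultimately have "\<bar>ln r\<bar> = \<bar>c2\<bar> / c1 + 4" by linarith
    then have "c1 * (\<bar>c2\<bar> / c1 + 4) * r powr (- \<epsilon>) \<le> c2 * r powr (- \<epsilon>)"
      using le[OF r] 2 by (simp add: mult_ac)
    then have "c1 * (\<bar>c2\<bar> / c1 + 4) \<le> c2" using r by simp
    moreover have "c1 * (\<bar>c2\<bar> / c1 + 4) = \<bar>c2\<bar> + 4 * c1" using c by (simp add: distrib_left)
    ultimately show False using c by linarith
  qed
qed

lemma growth_pair_unique:
  assumes "is_growth_pair h p" "is_growth_pair h p'"
  shows "p = p'"
proof -
  obtain \<epsilon> d \<epsilon>' d' where p: "p = (\<epsilon>, d)" "p' = (\<epsilon>', d')" by (cases p, cases p')
  have 4: "0 < 1 / (4::real) \<and> 1 / (4::real) < 1 / 2" by simp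
  have d: "d \<in> {0, 1}" "d' \<in> {0, 1}" using assms by (auto simp: p is_growth_pair_def)
  obtain c1 c2 where c: "c1 > 0" "\<And>r. 0 < r \<and> r < 1 / 4 \<Longrightarrow>
     c1 * r powr (- \<epsilon>) * \<bar>ln r\<bar> ^ d \<le> (LINT s:{0..1/4}|lebesgue. h r s) \<and>
     (LINT s:{0..1/4}|lebesgue. h r s) \<le> c2 * r powr (- \<epsilon>) * \<bar>ln r\<bar> ^ d"
    using assms(1) 4 unfolding p is_growth_pair_def prod.case by blast
  obtain c1' c2' where c': "c1' > 0" "\<And>r. 0 < r \<and> r < 1 / 4 \<Longrightarrow>
     c1' * r powr (- \<epsilon>') * \<bar>ln r\<bar> ^ d' \<le> (LINT s:{0..1/4}|lebesgue. h r s) \<and>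
     (LINT s:{0..1/4}|lebesgue. h r s) \<le> c2' * r powr (- \<epsilon>') * \<bar>ln r\<bar> ^ d'"
    using assms(2) 4 unfolding p is_growth_pair_def prod.case by blast
  have "\<epsilon> < \<epsilon>' \<or> \<epsilon> = \<epsilon>' \<and> d \<le> d'"
    by (rule growth_rate_order[OF c(1) d, of \<epsilon> c2' \<epsilon>']) (use c(2) c'(2) in fastforce)
  moreover have "\<epsilon>' < \<epsilon> \<or> \<epsilon>' = \<epsilon> \<and> d' \<le> d"
    by (rule growth_rate_order[OF c'(1) d(2,1), of \<epsilon>' c2 \<epsilon>]) (use c(2) c'(2) in fastforce)
  ultimately show ?thesis by (auto simp: p)
qed

text \<open>For fixed \<open>r > 0\<close> the weight is at least a multiple of \<open>s powr (- \<rho> *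
  b0)\<close> near \<open>s = 0\<close>, where \<open>b0\<close> is the least power of
  \<open>s\<close> that occurs.\<close>
lemma integrable_imp_subcritical:
  assumes P: "finite P" "P \<noteq> {}" and r: "0 < r" "r < 1" and \<delta>: "0 < \<delta>" "\<delta> \<le> 1"
    and int: "set_integrable lborel {0<..<\<delta>} (\<lambda>s. weight P \<rho> r s)"
  obtains a0 b0 where "(a0, b0) \<in> P" "\<rho> * real b0 < 1"
proof (cases "\<rho> > 0")
  case False
  obtain a b where "(a, b) \<in> P" using P by auto
  moreover have "\<rho> * real b \<le> 0" using False by (simp add: mult_nonpos_nonneg)
  ultimately show thesis using that[of a b] by simp
next
  case True
  obtain a0 b0 where ab: "(a0, b0) \<in> P" "\<And>a b. (a, b) \<in> P \<Longrightarrow> b0 \<le> b"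
  proof -
    have "Min (snd ` P) \<in> snd ` P" using P by (intro Min_in) auto
    then obtain a where "(a, Min (snd ` P)) \<in> P" by force
    moreover have "Min (snd ` P) \<le> b" if "(a, b) \<in> P" for a b using P that by (intro Min_le) force+
    ultimately show thesis using that by blast
  qed
  define N where "N = real (card P)"
  have N: "N > 0" using P by (auto simp: N_def card_gt_0_iff)
  have "set_integrable lborel {0<..<\<delta>} (\<lambda>s. s powr (- \<rho> * real b0))"
  proof (rule set_integrable_bound[OF set_integrable_mult_right[OF int, of "N powr \<rho>"]])
    show "set_borel_measurable lborel {0<..<\<delta>} (\<lambda>s. s powr (- \<rho> * real b0))"
      unfolding set_borel_measurable_def by simp
    show "AE s in lborel. s \<in> {0<..<\<delta>} \<longrightarrow> norm (s powr (- \<rho> * real b0)) \<le> norm (N powr \<rho> * weight P \<rho> r s)"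
    proof (intro AE_I2 impI)
      fix s assume "s \<in> {0<..<\<delta>}"
      then have s: "0 < s" "s < 1" using \<delta> by auto
      have "monomial_sum P r s \<le> N * s ^ b0"
        unfolding N_def
      proof (rule monomial_sum_le)
        fix a b assume "(a, b) \<in> P"
        then have "r ^ a * s ^ b \<le> 1 * s ^ b0"
          using ab(2) r s by (intro mult_mono power_decreasing power_le_one) auto
        then show "r ^ a * s ^ b \<le> s ^ b0" by simp
      qed
      then have "(N * s ^ b0) powr (- \<rho>) \<le> monomial_sum P r s powr (- \<rho>)"
        using monomial_sum_pos[OF P r(1) s(1)] True by (intro powr_mono2') auto
      moreover have "(N * s ^ b0) powr (- \<rho>) = N powr (- \<rho>) * s powr (- \<rho> * real b0)"
        using s N by (simp add: powr_mult powr_powr powr_realpow[symmetric] mult.commute)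
      ultimately have "N powr \<rho> * (N powr (- \<rho>) * s powr (- \<rho> * real b0)) \<le> N powr \<rho> * weight P \<rho> r s"
        using r s by (intro mult_left_mono) (auto simp: weight_eq)
      moreover have "N powr \<rho> * N powr (- \<rho>) = 1" using N by (simp add: powr_add[symmetric])
      ultimately show "norm (s powr (- \<rho> * real b0)) \<le> norm (N powr \<rho> * weight P \<rho> r s)"
        by (simp add: mult.assoc[symmetric])
    qed
  qed
  from powr_not_integrable[OF this \<delta>(1)] show thesis using that[OF ab(1)] by simp
qed

text \<open>Integrability of \<open>J\<close> forces \<open>\<epsilon> < 1\<close>, so the integral of the
  bound for \<open>J\<close> up to \<open>\<mu>\<close> is of the order \<open>\<mu> powr (1 -
  \<epsilon>) * \<bar>ln \<mu>\<bar> ^ d\<close>, and the cutoff \<open>\<mu>\<close> lies between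
  \<open>\<delta> / (2 + \<bar>l\<bar>)\<close> and \<open>2 / (2 + \<bar>l\<bar>)\<close>.\<close>
lemma cutoff_integral_bound:
  fixes J :: "real \<Rightarrow> real"
  assumes \<delta>: "0 < \<delta>" "\<delta> < 1 / 2" and d: "d \<in> {0, 1::nat}" and c: "c1 > 0" "c2 > 0"
    and lo: "\<And>r. 0 < r \<Longrightarrow> r < \<delta> \<Longrightarrow> c1 * r powr (- \<epsilon>) * \<bar>ln r\<bar> ^ d \<le> J r"
    and hi: "\<And>r. 0 < r \<Longrightarrow> r < \<delta> \<Longrightarrow> J r \<le> c2 * r powr (- \<epsilon>) * \<bar>ln r\<bar> ^ d"
    and int: "set_integrable lborel {0<..<\<delta>} J"
  shows "\<exists>C>0. \<forall>l. (LINT r:{0<..<cutoff \<delta> l}|lborel. J r) \<le> C * (2 + \<bar>l\<bar>) powr (\<epsilon> - 1) * ln (2 + \<bar>l\<bar>) ^ d"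
proof -
  have l2: "ln 2 \<le> \<bar>ln r\<bar>" if "0 < r" "r \<le> \<delta>" for r
  proof -
    have "ln r \<le> ln (1 / 2)" using that \<delta> by (subst ln_le_cancel_iff) auto
    then show ?thesis by (simp add: ln_div)
  qed
  have "set_integrable lborel {0<..<\<delta>} (\<lambda>r. r powr (- \<epsilon>))"
  proof (rule set_integrable_bound[OF set_integrable_mult_right[OF int, of "1 / (c1 * (ln 2) ^ d)"]])
    show "set_borel_measurable lborel {0<..<\<delta>} (\<lambda>r. r powr (- \<epsilon>))"
      unfolding set_borel_measurable_def by simp
    show "AE r in lborel. r \<in> {0<..<\<delta>} \<longrightarrow> norm (r powr (- \<epsilon>)) \<le> norm (1 / (c1 * (ln 2) ^ d) * J r)"
    proof (intro AE_I2 impI)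
      fix r assume "r \<in> {0<..<\<delta>}"
      then have r: "0 < r" "r < \<delta>" by auto
      have "c1 * r powr (- \<epsilon>) * (ln 2) ^ d \<le> c1 * r powr (- \<epsilon>) * \<bar>ln r\<bar> ^ d"
        using l2[of r] r c by (intro mult_left_mono power_mono) auto
      also have "\<dots> \<le> J r" by (rule lo[OF r])
      finally have "r powr (- \<epsilon>) \<le> J r / (c1 * (ln 2) ^ d)"
        using c by (simp add: pos_le_divide_eq mult_ac)
      moreover have "1 / (c1 * (ln 2) ^ d) * J r = J r / (c1 * (ln 2) ^ d)" by simp
      ultimately show "norm (r powr (- \<epsilon>)) \<le> norm (1 / (c1 * (ln 2) ^ d) * J r)"
        unfolding real_norm_def using powr_ge_zero[of r "- \<epsilon>"] by linarith
    qed
  qed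
  from powr_not_integrable[OF this \<delta>(1)] have \<epsilon>: "\<epsilon> < 1" by simp
  \<comment> \<open>A small power \<open>(\<mu> / r) powr \<eta>\<close> absorbs the growth of the
    logarithm from \<open>\<mu>\<close> to \<open>r\<close>; half of the room \<open>1 -
    \<epsilon>\<close> is spent on it.\<close>
  define \<eta> where "\<eta> = (1 - \<epsilon>) / 2"
  have \<eta>: "\<eta> > 0" using \<epsilon> by (simp add: \<eta>_def)
  define L where "L = 1 + 1 / (\<eta> * ln 2)"
  have L: "L \<ge> 1" using \<eta> by (simp add: L_def)
  define G where "G = (1 + \<bar>ln \<delta>\<bar> / ln 2)"
  have G: "G \<ge> 1" by (simp add: G_def)
  define C where "C = c2 * L / \<eta> * 2 powr (1 - \<epsilon>) * G"
  show ?thesis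
  proof (intro exI[of _ C] conjI allI)
    show "C > 0" using c L \<eta> G by (auto simp: C_def)
    fix l :: real
    define \<mu> where "\<mu> = cutoff \<delta> l"
    have \<mu>: "0 < \<mu>" "\<mu> \<le> \<delta>" using cutoff_bounds \<delta> by (auto simp: \<mu>_def)
    have log: "\<bar>ln r\<bar> ^ d \<le> L * \<bar>ln \<mu>\<bar> ^ d * (\<mu> / r) powr \<eta>" if r: "0 < r" "r < \<mu>" for r
    proof -
      have one: "1 \<le> (\<mu> / r) powr \<eta>" using r \<eta> by (intro ge_one_powr_ge_zero) auto
      show ?thesis
      proof (cases "d = 0")
        case True
        have "1 * 1 \<le> L * (\<mu> / r) powr \<eta>" using L one by (intro mult_mono) auto
        then show ?thesis using True by simp
      next
        case False
        have neg: "ln r < 0" "ln \<mu> < 0" using r \<mu> \<delta> by (auto simp: ln_less_zero)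
        have "ln (\<mu> / r) \<le> (\<mu> / r) powr \<eta> / \<eta>" by (rule ln_powr_bound) (use r \<eta> in auto)
        then have "\<bar>ln r\<bar> \<le> \<bar>ln \<mu>\<bar> + (\<mu> / r) powr \<eta> / \<eta>" using r \<mu> neg by (simp add: ln_div)
        also have "\<dots> \<le> \<bar>ln \<mu>\<bar> * (\<mu> / r) powr \<eta> + (\<bar>ln \<mu>\<bar> / ln 2) * ((\<mu> / r) powr \<eta> / \<eta>)"
        proof (rule add_mono)
          show "\<bar>ln \<mu>\<bar> \<le> \<bar>ln \<mu>\<bar> * (\<mu> / r) powr \<eta>" using mult_left_mono[OF one, of "\<bar>ln \<mu>\<bar>"] by simp
          have "1 * ((\<mu> / r) powr \<eta> / \<eta>) \<le> (\<bar>ln \<mu>\<bar> / ln 2) * ((\<mu> / r) powr \<eta> / \<eta>)"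
            using l2[OF \<mu>] \<eta> by (intro mult_right_mono) auto
          then show "(\<mu> / r) powr \<eta> / \<eta> \<le> (\<bar>ln \<mu>\<bar> / ln 2) * ((\<mu> / r) powr \<eta> / \<eta>)" by simp
        qed
        also have "\<dots> = L * \<bar>ln \<mu>\<bar> * (\<mu> / r) powr \<eta>" by (simp add: L_def algebra_simps)
        finally show ?thesis using False d by simp
      qed
    qed
    let ?g = "\<lambda>r. c2 * L * \<bar>ln \<mu>\<bar> ^ d * \<mu> powr \<eta> * r powr (- \<epsilon> - \<eta>)"
    have e1: "- \<epsilon> - \<eta> > -1" "- \<epsilon> - \<eta> + 1 = \<eta>" using \<epsilon> by (auto simp: \<eta>_def field_simps)
    have "(LINT r:{0<..<\<mu>}|lborel. J r) \<le> (LINT r:{0<..<\<mu>}|lborel. ?g r)"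
    proof (rule set_integral_mono)
      show "set_integrable lborel {0<..<\<mu>} J" by (rule set_integrable_subset[OF int]) (use \<mu> in auto)
      show "set_integrable lborel {0<..<\<mu>} ?g"
        by (rule set_integrable_mult_right) (use power_integral_01(1)[OF e1(1), of \<mu>] \<mu> in auto)
      fix r assume "r \<in> {0<..<\<mu>}"
      then have r: "0 < r" "r < \<mu>" "r < \<delta>" using \<mu> by auto
      have "J r \<le> c2 * r powr (- \<epsilon>) * \<bar>ln r\<bar> ^ d" by (rule hi[OF r(1,3)])
      also have "\<dots> \<le> c2 * r powr (- \<epsilon>) * (L * \<bar>ln \<mu>\<bar> ^ d * (\<mu> / r) powr \<eta>)"
        using log[OF r(1,2)] c by (intro mult_left_mono) auto
      also have "\<dots> = ?g r" using r \<mu> by (simp add: powr_divide powr_diff)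
      finally show "J r \<le> ?g r" .
    qed
    also have "\<dots> = c2 * L * \<bar>ln \<mu>\<bar> ^ d * \<mu> powr \<eta> * (\<mu> powr \<eta> / \<eta>)"
      using power_integral_01(2)[OF e1(1), of \<mu>] \<mu> e1(2) by simp
    also have "\<dots> = c2 * L / \<eta> * (\<bar>ln \<mu>\<bar> ^ d * \<mu> powr (1 - \<epsilon>))"
    proof -
      have "\<mu> powr \<eta> * \<mu> powr \<eta> = \<mu> powr (1 - \<epsilon>)" by (simp add: powr_add[symmetric] \<eta>_def)
      then show ?thesis by (simp add: mult_ac)
    qed
    also have "\<dots> \<le> c2 * L / \<eta> * ((G * ln (2 + \<bar>l\<bar>) ^ d) * (2 powr (1 - \<epsilon>) * (2 + \<bar>l\<bar>) powr (\<epsilon> - 1)))"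
    proof (intro mult_left_mono mult_mono)
      have "\<mu> \<le> 2 / (2 + \<bar>l\<bar>)"
      proof (cases "l = 0")
        case False
        have "\<mu> * 2 + \<mu> * \<bar>l\<bar> \<le> \<delta> * 2 + (1 / \<bar>l\<bar>) * \<bar>l\<bar>"
          using False by (intro add_mono mult_right_mono) (auto simp: \<mu>_def cutoff_def)
        then have "\<mu> * (2 + \<bar>l\<bar>) \<le> 2" using \<delta> False by (simp add: distrib_left)
        then show ?thesis by (simp add: pos_le_divide_eq)
      qed (use \<mu> \<delta> in auto)
      then have "\<mu> powr (1 - \<epsilon>) \<le> (2 / (2 + \<bar>l\<bar>)) powr (1 - \<epsilon>)" using \<epsilon> \<mu> by (intro powr_mono2) auto
      also have "\<dots> = 2 powr (1 - \<epsilon>) * (2 + \<bar>l\<bar>) powr - (1 - \<epsilon>)"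
        by (simp only: powr_divide powr_minus_divide) simp
      finally show "\<mu> powr (1 - \<epsilon>) \<le> 2 powr (1 - \<epsilon>) * (2 + \<bar>l\<bar>) powr (\<epsilon> - 1)" by simp
      have "\<delta> / (2 + \<bar>l\<bar>) \<le> \<mu>"
      proof (cases "l = 0")
        case True
        then show ?thesis using \<delta> by (simp add: \<mu>_def cutoff_def)
      next
        case False
        have "\<delta> / (2 + \<bar>l\<bar>) \<le> \<delta> / 1" using \<delta> by (intro divide_left_mono) auto
        moreover have "\<delta> / (2 + \<bar>l\<bar>) \<le> 1 / \<bar>l\<bar>" using \<delta> False by (intro frac_le) auto
        ultimately show ?thesis using False by (simp add: \<mu>_def cutoff_def)
      qed
      then have "ln (\<delta> / (2 + \<bar>l\<bar>)) \<le> ln \<mu>" using \<delta> \<mu> by (subst ln_le_cancel_iff) auto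
      moreover have "ln \<mu> < 0" using \<mu> \<delta> by (auto simp: ln_less_zero)
      moreover have "ln (\<delta> / (2 + \<bar>l\<bar>)) = ln \<delta> - ln (2 + \<bar>l\<bar>)" using \<delta> by (intro ln_divide_pos) auto
      ultimately have "\<bar>ln \<mu>\<bar> \<le> ln (2 + \<bar>l\<bar>) + \<bar>ln \<delta>\<bar>" by linarith
      also have "\<bar>ln \<delta>\<bar> \<le> \<bar>ln \<delta>\<bar> / ln 2 * ln (2 + \<bar>l\<bar>)"
      proof -
        have "\<bar>ln \<delta>\<bar> / ln 2 * ln 2 \<le> \<bar>ln \<delta>\<bar> / ln 2 * ln (2 + \<bar>l\<bar>)" by (intro mult_left_mono) auto
        then show ?thesis by simp
      qed
      finally have ln: "\<bar>ln \<mu>\<bar> \<le> G * ln (2 + \<bar>l\<bar>)" by (simp add: G_def algebra_simps)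
      then show "\<bar>ln \<mu>\<bar> ^ d \<le> G * ln (2 + \<bar>l\<bar>) ^ d" using d G by auto
    qed (use c L \<eta> G in \<open>auto intro!: mult_nonneg_nonneg\<close>)
    also have "\<dots> = C * (2 + \<bar>l\<bar>) powr (\<epsilon> - 1) * ln (2 + \<bar>l\<bar>) ^ d" by (simp add: C_def mult_ac)
    finally show "(LINT r:{0<..<cutoff \<delta> l}|lborel. J r) \<le> C * (2 + \<bar>l\<bar>) powr (\<epsilon> - 1) * ln (2 + \<bar>l\<bar>) ^ d"
      by (simp add: \<mu>_def)
  qed
qed

section \<open>Dilations and reflections\<close>

text \<open>Whichever monotonicity the power has, one of the two inequalities comes from \<open>a \<le>
  b\<close> and the other from \<open>b \<le> t ^ D * a\<close>.\<close>
lemma powr_comparison: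
  fixes a b t :: real
  assumes ab: "0 < a" "a \<le> b" "b \<le> t ^ D * a" and t: "1 \<le> t" and M: "\<bar>\<rho>\<bar> * real D \<le> real M"
  shows "b powr (- \<rho>) \<le> t ^ M * a powr (- \<rho>)" "a powr (- \<rho>) \<le> t ^ M * b powr (- \<rho>)"
proof -
  have b: "0 < b" using ab by linarith
  have tM: "1 \<le> t ^ M" using t by (rule one_le_power)
  have tD: "(t ^ D) powr \<bar>\<rho>\<bar> \<le> t ^ M"
    using t M by (simp add: powr_realpow[symmetric] powr_powr mult.commute powr_mono)
  have big: "x \<le> t ^ M * x" if "0 \<le> x" for x using mult_right_mono[OF tM that] by simp
  have "b powr (- \<rho>) \<le> t ^ M * a powr (- \<rho>) \<and> a powr (- \<rho>) \<le> t ^ M * b powr (- \<rho>)"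
  proof (cases "\<rho> \<ge> 0")
    case True
    have "b powr (- \<rho>) \<le> a powr (- \<rho>)" using ab True by (intro powr_mono2') auto
    moreover have "a powr (- \<rho>) \<le> t ^ M * b powr (- \<rho>)"
    proof -
      have "(t ^ D * a) powr (- \<rho>) \<le> b powr (- \<rho>)" using ab b True by (intro powr_mono2') auto
      then have "(t ^ D) powr (- \<rho>) * a powr (- \<rho>) \<le> b powr (- \<rho>)" using ab t by (simp add: powr_mult)
      then have "(t ^ D) powr \<rho> * ((t ^ D) powr (- \<rho>) * a powr (- \<rho>)) \<le> (t ^ D) powr \<rho> * b powr (- \<rho>)"
        by (rule mult_left_mono) auto
      moreover have "(t ^ D) powr \<rho> * (t ^ D) powr (- \<rho>) = 1" using t by (simp add: powr_add[symmetric])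
      ultimately have "a powr (- \<rho>) \<le> (t ^ D) powr \<rho> * b powr (- \<rho>)" by (simp add: mult.assoc[symmetric])
      also have "\<dots> \<le> t ^ M * b powr (- \<rho>)" using tD True by (intro mult_right_mono) auto
      finally show ?thesis .
    qed
    ultimately show ?thesis using big[of "a powr (- \<rho>)"] by auto
  next
    case False
    have "a powr (- \<rho>) \<le> b powr (- \<rho>)" using ab False by (intro powr_mono2) auto
    moreover have "b powr (- \<rho>) \<le> (t ^ D * a) powr (- \<rho>)" using ab b False by (intro powr_mono2) auto
    moreover have "(t ^ D * a) powr (- \<rho>) = (t ^ D) powr \<bar>\<rho>\<bar> * a powr (- \<rho>)" using ab t False by (simp add: powr_mult)
    moreover have "\<dots> \<le> t ^ M * a powr (- \<rho>)" using tD by (intro mult_right_mono) auto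
    ultimately show ?thesis using big[of "b powr (- \<rho>)"] by auto
  qed
  then show "b powr (- \<rho>) \<le> t ^ M * a powr (- \<rho>)" "a powr (- \<rho>) \<le> t ^ M * b powr (- \<rho>)" by auto
qed

lemma vertex_sum_eq: "vertex_sum S (x, y) = (\<Sum>(a, b)\<in>vertices S. \<bar>x\<bar> ^ a * \<bar>y\<bar> ^ b)"
  by (simp add: vertex_sum_def)

lemma vertex_sum_pos:
  assumes "S \<noteq> {}" "x \<noteq> 0" "y \<noteq> 0"
  shows "vertex_sum S (x, y) > 0"
proof -
  obtain a b where "(a, b) \<in> vertices S"
    by (rule exists_minimising_vertex[of 1 1 S]) (use assms(1) in auto)
  then show ?thesis unfolding vertex_sum_eq
    by (intro sum_pos) (use assms finite_vertices in auto)
qed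

text \<open>Dilating the arguments by factors between 1 and \<open>T\<close> multiplies each monomial by a
  factor between 1 and \<open>T ^ D\<close>.\<close>
lemma vertex_sum_dilate:
  assumes D: "\<And>a b. (a, b) \<in> vertices S \<Longrightarrow> a + b \<le> D" and t: "1 \<le> t" "1 \<le> t'" "t \<le> T" "t' \<le> T"
  shows "vertex_sum S (x, y) \<le> vertex_sum S (t * x, t' * y)"
    and "vertex_sum S (t * x, t' * y) \<le> T ^ D * vertex_sum S (x, y)"
proof -
  have split: "\<bar>t * x\<bar> ^ a * \<bar>t' * y\<bar> ^ b = (t ^ a * t' ^ b) * (\<bar>x\<bar> ^ a * \<bar>y\<bar> ^ b)" for a b
    using t by (simp add: abs_mult power_mult_distrib mult_ac)
  show "vertex_sum S (x, y) \<le> vertex_sum S (t * x, t' * y)"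
    unfolding vertex_sum_eq
  proof (rule sum_mono, clarify)
    fix a b
    have "1 * 1 \<le> t ^ a * t' ^ b" using t by (intro mult_mono one_le_power) auto
    then have "1 * (\<bar>x\<bar> ^ a * \<bar>y\<bar> ^ b) \<le> (t ^ a * t' ^ b) * (\<bar>x\<bar> ^ a * \<bar>y\<bar> ^ b)"
      by (intro mult_right_mono) auto
    then show "\<bar>x\<bar> ^ a * \<bar>y\<bar> ^ b \<le> \<bar>t * x\<bar> ^ a * \<bar>t' * y\<bar> ^ b" unfolding split by simp
  qed
  show "vertex_sum S (t * x, t' * y) \<le> T ^ D * vertex_sum S (x, y)"
    unfolding vertex_sum_eq sum_distrib_left
  proof (rule sum_mono, clarify)
    fix a b assume ab: "(a, b) \<in> vertices S"
    have "t ^ a * t' ^ b \<le> T ^ a * T ^ b" using t by (intro mult_mono power_mono) auto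
    also have "\<dots> \<le> T ^ D" unfolding power_add[symmetric] using D[OF ab] t by (intro power_increasing) auto
    finally have "(t ^ a * t' ^ b) * (\<bar>x\<bar> ^ a * \<bar>y\<bar> ^ b) \<le> T ^ D * (\<bar>x\<bar> ^ a * \<bar>y\<bar> ^ b)"
      by (intro mult_right_mono) auto
    then show "\<bar>t * x\<bar> ^ a * \<bar>t' * y\<bar> ^ b \<le> T ^ D * (\<bar>x\<bar> ^ a * \<bar>y\<bar> ^ b)" unfolding split .
  qed
qed

text \<open>Stretching one variable by a factor \<open>t \<ge> 1\<close> multiplies the vertex sum by a factor
  between 1 and \<open>t ^ D\<close>.\<close>
lemma moderate_vertex_weight:
  assumes D: "\<And>a b. (a, b) \<in> vertices S \<Longrightarrow> a + b \<le> D" and M: "\<bar>\<rho>\<bar> * real D \<le> real M" and S: "S \<noteq> {}"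
  shows "y > 0 \<Longrightarrow> moderate M R (\<lambda>x. vertex_sum S (x, y) powr (- \<rho>))"
    and "x > 0 \<Longrightarrow> moderate M R (\<lambda>y. vertex_sum S (x, y) powr (- \<rho>))"
proof -
  have cmp: "vertex_sum S (t * x, t' * y) powr (- \<rho>) \<le> T ^ M * vertex_sum S (x, y) powr (- \<rho>) \<and>
     vertex_sum S (x, y) powr (- \<rho>) \<le> T ^ M * vertex_sum S (t * x, t' * y) powr (- \<rho>)"
    if "0 < x" "0 < y" "1 \<le> t" "1 \<le> t'" "t \<le> T" "t' \<le> T" for x y t t' T
    using powr_comparison[OF vertex_sum_pos[OF S, of x y] vertex_sum_dilate(1)[OF D] vertex_sum_dilate(2)[OF D] _ M, of t t' T] that
    by auto
  show "moderate M R (\<lambda>x. vertex_sum S (x, y) powr (- \<rho>))" if y: "y > 0"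
    unfolding moderate_def
  proof (intro conjI ballI allI impI)
    fix x x' assume x: "0 < x \<and> x \<le> x' \<and> x' < R"
    then have "x' / x * x = x'" "1 \<le> x' / x" by auto
    then show "vertex_sum S (x', y) powr (- \<rho>) \<le> (x' / x) ^ M * vertex_sum S (x, y) powr (- \<rho>)"
       "vertex_sum S (x, y) powr (- \<rho>) \<le> (x' / x) ^ M * vertex_sum S (x', y) powr (- \<rho>)"
      using cmp[of x y "x' / x" 1 "x' / x"] x y by auto
  next
    show "0 < vertex_sum S (x, y) powr (- \<rho>)" if "x \<in> {0<..<R}" for x
      using vertex_sum_pos[OF S, of x y] that y by simp
  qed
  show "moderate M R (\<lambda>y. vertex_sum S (x, y) powr (- \<rho>))" if x: "x > 0"
    unfolding moderate_def
  proof (intro conjI ballI allI impI)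
    fix y y' assume y: "0 < y \<and> y \<le> y' \<and> y' < R"
    then have "y' / y * y = y'" "1 \<le> y' / y" by auto
    then show "vertex_sum S (x, y') powr (- \<rho>) \<le> (y' / y) ^ M * vertex_sum S (x, y) powr (- \<rho>)"
       "vertex_sum S (x, y) powr (- \<rho>) \<le> (y' / y) ^ M * vertex_sum S (x, y') powr (- \<rho>)"
      using cmp[of x y 1 "y' / y" "y' / y"] x y by auto
  next
    show "0 < vertex_sum S (x, y) powr (- \<rho>)" if "y \<in> {0<..<R}" for y
      using vertex_sum_pos[OF S, of x y] that x by simp
  qed
qed

lemma measurable_vertex_weight: "(\<lambda>z. vertex_sum S z powr t) \<in> borel_measurable borel"
proof -
  have "continuous_on UNIV (vertex_sum S)"
    unfolding vertex_sum_def case_prod_unfold by (intro continuous_intros)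
  then show ?thesis by (intro powr_real_measurable borel_measurable_continuous_onI) auto
qed

lemma continuous_on_vertex_weight:
  assumes "S \<noteq> {}" "\<Omega> \<subseteq> off_axes"
  shows "continuous_on \<Omega> (\<lambda>z. vertex_sum S z powr t)"
proof -
  have "continuous_on \<Omega> (vertex_sum S)"
    unfolding vertex_sum_def case_prod_unfold by (intro continuous_intros)
  moreover have "vertex_sum S z \<noteq> 0" if "z \<in> \<Omega>" for z
    using vertex_sum_pos[OF assms(1), of "fst z" "snd z"] that assms(2) by (fastforce simp: off_axes_def)
  ultimately show ?thesis by (intro continuous_intros) auto
qed

lemma integrable_dilate:
  fixes g :: "real \<times> real \<Rightarrow> real"
  assumes g: "g \<in> borel_measurable borel" and k: "k \<noteq> 0" and int: "integrable lborel (\<lambda>z. g (k *\<^sub>R z))"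
  shows "integrable lborel g"
proof -
  have "integrable (distr lborel borel (\<lambda>z::real \<times> real. 0 + k *\<^sub>R z)) g"
    using int g by (subst integrable_distr_eq) auto
  then have "integrable (density (distr lborel borel (\<lambda>z::real \<times> real. 0 + k *\<^sub>R z)) (\<lambda>_. \<bar>k\<bar> ^ DIM(real \<times> real))) g"
    using g by (subst integrable_density) auto
  then show ?thesis using lborel_affine[OF k, of "0::real \<times> real"] by simp
qed

text \<open>Integrability on a small box carries over to a larger one because a dilation changes the weight by
  a bounded factor. This is why one neighbourhood of the origin serves all \<open>\<rho>\<close>,
  although the neighbourhood on which the power of \<open>f\<close> is assumed to be integrable
  depends on \<open>\<rho>\<close>.\<close>
lemma integrable_obox_enlarge:
  assumes \<eta>: "0 < \<eta>" "\<eta> \<le> \<delta>" and S: "S \<noteq> {}"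
    and int: "set_integrable lborel (obox \<eta>) (\<lambda>z. vertex_sum S z powr (- \<rho>))"
  shows "set_integrable lborel (obox \<delta>) (\<lambda>z. vertex_sum S z powr (- \<rho>))"
proof -
  obtain D where D: "\<And>a b. (a, b) \<in> vertices S \<Longrightarrow> a + b \<le> D" using vertex_degree_bound by blast
  define M where "M = nat \<lceil>\<bar>\<rho>\<bar> * real D\<rceil>"
  have M: "\<bar>\<rho>\<bar> * real D \<le> real M" by (simp add: M_def)
  define k where "k = \<delta> / \<eta>"
  have k: "k \<ge> 1" using \<eta> by (simp add: k_def)
  have ind: "indicator (obox \<delta>) (k *\<^sub>R z) = (indicator (obox \<eta>) z :: real)" for z
  proof -
    have "k * t < \<delta> \<longleftrightarrow> t < \<eta>" "0 < k * t \<longleftrightarrow> 0 < t" for t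
      using \<eta> k by (auto simp: k_def pos_divide_less_eq zero_less_mult_iff zero_less_divide_iff)
    then show ?thesis by (cases z) (auto simp: indicator_def obox_def)
  qed
  show ?thesis
    unfolding set_integrable_def
  proof (rule integrable_dilate[of _ k])
    show "(\<lambda>z. indicator (obox \<delta>) z *\<^sub>R vertex_sum S z powr (- \<rho>)) \<in> borel_measurable borel"
      using measurable_vertex_weight[of S "- \<rho>"] open_obox by simp
    show "integrable lborel (\<lambda>z. indicator (obox \<delta>) (k *\<^sub>R z) *\<^sub>R vertex_sum S (k *\<^sub>R z) powr (- \<rho>))"
      unfolding ind
    proof (rule Bochner_Integration.integrable_bound)
      show "integrable lborel (\<lambda>z. k ^ M * (indicator (obox \<eta>) z *\<^sub>R vertex_sum S z powr (- \<rho>)))"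
        using int by (simp add: set_integrable_def)
      have "(\<lambda>z. vertex_sum S (k *\<^sub>R z) powr (- \<rho>)) \<in> borel_measurable borel"
        using measurable_compose[OF _ measurable_vertex_weight[of S "- \<rho>"], of "\<lambda>z. k *\<^sub>R z" borel] by simp
      then show "(\<lambda>z. indicator (obox \<eta>) z *\<^sub>R vertex_sum S (k *\<^sub>R z) powr (- \<rho>)) \<in> borel_measurable lborel"
        using open_obox by simp
      show "AE z in lborel. norm (indicator (obox \<eta>) z *\<^sub>R vertex_sum S (k *\<^sub>R z) powr (- \<rho>))
          \<le> norm (k ^ M * (indicator (obox \<eta>) z *\<^sub>R vertex_sum S z powr (- \<rho>)))"
      proof (rule AE_I2)
        fix z :: "real \<times> real"
        obtain x y where z: "z = (x, y)" by (cases z)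
        have "vertex_sum S (k * x, k * y) powr (- \<rho>) \<le> k ^ M * vertex_sum S (x, y) powr (- \<rho>)" if "0 < x" "0 < y"
          by (rule powr_comparison(1)[OF vertex_sum_pos[OF S] vertex_sum_dilate[OF D] k M]) (use that k in auto)
        then show "norm (indicator (obox \<eta>) z *\<^sub>R vertex_sum S (k *\<^sub>R z) powr (- \<rho>))
          \<le> norm (k ^ M * (indicator (obox \<eta>) z *\<^sub>R vertex_sum S z powr (- \<rho>)))"
          using k by (auto simp: z indicator_def obox_def)
      qed
    qed
  qed (use k in auto)
qed

definition refl2 :: "real \<Rightarrow> real \<Rightarrow> real \<times> real \<Rightarrow> real \<times> real" where
  "refl2 \<sigma> \<tau> z = (\<sigma> * fst z, \<tau> * snd z)"

lemma measurable_refl2: "refl2 \<sigma> \<tau> \<in> borel_measurable borel"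
  unfolding refl2_def[abs_def] by (intro borel_measurable_continuous_onI continuous_intros)

lemma distr_refl2:
  assumes "\<sigma> \<in> {-1, 1}" "\<tau> \<in> {-1, 1}"
  shows "distr lborel borel (refl2 \<sigma> \<tau>) = lborel"
proof -
  have one: "distr lborel lborel ((*) \<sigma>) = (lborel :: real measure)" if "\<sigma> \<in> {-1, 1}" for \<sigma>
  proof -
    have "distr lborel lborel ((*) \<sigma>) = distr lborel borel ((*) \<sigma>)" by (rule distr_cong) auto
    also have "\<dots> = lborel"
    proof (cases "\<sigma> = 1")
      case True
      then have "(*) \<sigma> = (\<lambda>x. x)" by auto
      then show ?thesis using distr_id2[of borel "lborel :: real measure"] by (simp add: id_def)
    next
      case False
      then have "(*) \<sigma> = uminus" using that by (auto simp: fun_eq_iff)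
      then show ?thesis by (simp only: lborel_distr_uminus)
    qed
    finally show ?thesis .
  qed
  have "lborel \<Otimes>\<^sub>M lborel = distr lborel lborel ((*) \<sigma>) \<Otimes>\<^sub>M distr lborel lborel ((*) \<tau>)"
    using one assms by simp
  also have "\<dots> = distr (lborel \<Otimes>\<^sub>M lborel) (lborel \<Otimes>\<^sub>M lborel) (\<lambda>(x, y). (\<sigma> * x, \<tau> * y))"
    by (rule pair_measure_distr) (use one[OF assms(2)] sigma_finite_lborel in auto)
  also have "(\<lambda>(x, y). (\<sigma> * x, \<tau> * y)) = refl2 \<sigma> \<tau>" by (auto simp: refl2_def)
  finally have "lborel = distr lborel lborel (refl2 \<sigma> \<tau>)" by (simp only: lborel_prod)
  also have "\<dots> = distr lborel borel (refl2 \<sigma> \<tau>)" by (rule distr_cong) auto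
  finally show ?thesis ..
qed

lemma integral_refl2:
  fixes g :: "real \<times> real \<Rightarrow> 'a::{banach, second_countable_topology}"
  assumes s: "\<sigma> \<in> {-1, 1}" "\<tau> \<in> {-1, 1}" and g: "g \<in> borel_measurable borel"
  shows "integrable lborel (\<lambda>z. g (refl2 \<sigma> \<tau> z)) \<longleftrightarrow> integrable lborel g"
    and "integral\<^sup>L lborel (\<lambda>z. g (refl2 \<sigma> \<tau> z)) = integral\<^sup>L lborel g"
proof -
  have m: "refl2 \<sigma> \<tau> \<in> lborel \<rightarrow>\<^sub>M borel" using measurable_refl2 by simp
  show "integrable lborel (\<lambda>z. g (refl2 \<sigma> \<tau> z)) \<longleftrightarrow> integrable lborel g"
    using integrable_distr_eq[OF m g] distr_refl2[OF s] by simp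
  show "integral\<^sup>L lborel (\<lambda>z. g (refl2 \<sigma> \<tau> z)) = integral\<^sup>L lborel g"
    using integral_distr[OF m g] distr_refl2[OF s] by simp
qed

text \<open>Euler derivatives commute with reflections in the axes.\<close>
lemma symb_refl2:
  assumes s: "\<sigma> \<in> {-1, 1}" "\<tau> \<in> {-1, 1}" and h: "symb b n \<Omega> K w h"
    and \<Omega>: "\<And>z. z \<in> \<Omega>' \<Longrightarrow> refl2 \<sigma> \<tau> z \<in> \<Omega>" "\<And>z. z \<in> \<Omega>' \<Longrightarrow> w (refl2 \<sigma> \<tau> z) = w z"
  shows "symb b n \<Omega>' K w (\<lambda>z. h (refl2 \<sigma> \<tau> z))"
  using h
proof (induction n arbitrary: b h)
  have cont: "continuous_on \<Omega>' (\<lambda>z. h (refl2 \<sigma> \<tau> z))" if "continuous_on \<Omega> h" for h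
    by (rule continuous_on_compose2[OF that]) (use \<Omega>(1) in \<open>auto simp: refl2_def[abs_def] intro!: continuous_intros\<close>)
  have bd: "\<bar>h (refl2 \<sigma> \<tau> z)\<bar> \<le> K * w z" if "symb b n \<Omega> K w h" "z \<in> \<Omega>'" for b n h z
    using symb_bound[OF that(1) \<Omega>(1)[OF that(2)]] \<Omega>(2)[OF that(2)] by simp
  {
    case 0
    then show ?case using cont[of h] bd[OF 0] by auto
  next
    case (Suc n)
    obtain h1 where h1: "\<And>x y. (x, y) \<in> \<Omega> \<Longrightarrow> ((\<lambda>t. h (t, y)) has_real_derivative h1 (x, y) / x) (at x)"
      "symb False n \<Omega> K w h1" using symb_deriv1[OF Suc.prems] by blast
    obtain h2 where h2: "\<And>x y. b \<Longrightarrow> (x, y) \<in> \<Omega> \<Longrightarrow> ((\<lambda>t. h (x, t)) has_real_derivative h2 (x, y) / y) (at y)"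
      "b \<Longrightarrow> symb True n \<Omega> K w h2" using Suc.prems by (cases b) auto
    have chain: "((\<lambda>t. k (\<sigma> * t)) has_real_derivative D / t0) (at t0)"
      if "\<sigma> \<in> {-1, 1}" "(k has_real_derivative D / (\<sigma> * t0)) (at (\<sigma> * t0))" for k D and \<sigma> t0 :: real
    proof -
      have "((\<lambda>t. k (\<sigma> * t)) has_real_derivative D / (\<sigma> * t0) * \<sigma>) (at t0)"
        by (rule DERIV_chain'[where f = "\<lambda>t. \<sigma> * t" and g = k, THEN DERIV_cong])
           (use that(2) in \<open>auto intro!: derivative_eq_intros\<close>)
      moreover have "D / (\<sigma> * t0) * \<sigma> = D / t0" using that(1) by auto
      ultimately show ?thesis by simp
    qed
    show ?case
    proof (rule symb_SucI[OF cont[OF symb_cont[OF Suc.prems]] bd[OF Suc.prems]])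
      show "symb False n \<Omega>' K w (\<lambda>z. h1 (refl2 \<sigma> \<tau> z))" by (rule Suc.IH[OF h1(2)])
      show "symb True n \<Omega>' K w (\<lambda>z. h2 (refl2 \<sigma> \<tau> z))" if b by (rule Suc.IH[OF h2(2)[OF that]])
      fix x y assume "(x, y) \<in> \<Omega>'"
      then have z: "(\<sigma> * x, \<tau> * y) \<in> \<Omega>" using \<Omega>(1) by (force simp: refl2_def)
      show "((\<lambda>t. h (refl2 \<sigma> \<tau> (t, y))) has_real_derivative h1 (refl2 \<sigma> \<tau> (x, y)) / x) (at x)"
        using chain[OF s(1) h1(1)[OF z]] by (simp add: refl2_def)
      show "((\<lambda>t. h (refl2 \<sigma> \<tau> (x, t))) has_real_derivative h2 (refl2 \<sigma> \<tau> (x, y)) / y) (at y)" if b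
        using chain[OF s(2) h2(1)[OF that z]] by (simp add: refl2_def)
    qed auto
  }
qed

lemma refl2_refl2:
  assumes "\<sigma> \<in> {-1, 1}" "\<tau> \<in> {-1, 1}"
  shows "refl2 \<sigma> \<tau> (refl2 \<sigma> \<tau> z) = z"
  using assms by (cases z) (auto simp: refl2_def)

definition signs :: "(real \<times> real) set" where "signs = {-1, 1} \<times> {-1, 1}"

lemma indicator_punctured_box:
  "indicator (punctured_box \<delta>) z = (\<Sum>(\<sigma>, \<tau>)\<in>signs. indicator (obox \<delta>) (refl2 \<sigma> \<tau> z) :: real)"
proof -
  have signs: "signs = {(-1, -1), (-1, 1), (1, -1), (1, 1)}" by (auto simp: signs_def)
  obtain x y where z: "z = (x, y)" by (cases z)
  show ?thesis
    unfolding signs z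
    by (auto simp: refl2_def obox_def punctured_box_def indicator_def abs_if split: if_splits)
qed

text \<open>The punctured box is the disjoint union of the four reflections of the open box in the first
  quadrant.\<close>
lemma punctured_box_integral:
  fixes g :: "real \<times> real \<Rightarrow> 'a::{banach, second_countable_topology}"
  assumes g: "(\<lambda>z. indicator (punctured_box \<delta>) z *\<^sub>R g z) \<in> borel_measurable borel"
    and int: "\<And>\<sigma> \<tau>. (\<sigma>, \<tau>) \<in> signs \<Longrightarrow> set_integrable lborel (obox \<delta>) (\<lambda>z. g (refl2 \<sigma> \<tau> z))"
  shows "integrable lborel (\<lambda>z. indicator (punctured_box \<delta>) z *\<^sub>R g z)"
    and "integral\<^sup>L lborel (\<lambda>z. indicator (punctured_box \<delta>) z *\<^sub>R g z)
      = (\<Sum>(\<sigma>, \<tau>)\<in>signs. LINT z:obox \<delta>|lborel. g (refl2 \<sigma> \<tau> z))"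
proof -
  let ?G = "\<lambda>z. indicator (punctured_box \<delta>) z *\<^sub>R g z"
  let ?H = "\<lambda>\<sigma> \<tau> z. indicator (obox \<delta>) (refl2 \<sigma> \<tau> z) *\<^sub>R g z"
  have H: "integrable lborel (?H \<sigma> \<tau>)" "integral\<^sup>L lborel (?H \<sigma> \<tau>) = (LINT z:obox \<delta>|lborel. g (refl2 \<sigma> \<tau> z))"
    if st: "(\<sigma>, \<tau>) \<in> signs" for \<sigma> \<tau>
  proof -
    have s: "\<sigma> \<in> {-1, 1}" "\<tau> \<in> {-1, 1}" using st by (auto simp: signs_def)
    have eqH: "?H \<sigma> \<tau> = (\<lambda>z. indicator (obox \<delta>) (refl2 \<sigma> \<tau> z) *\<^sub>R ?G z)"
    proof (rule ext)
      show "?H \<sigma> \<tau> z = indicator (obox \<delta>) (refl2 \<sigma> \<tau> z) *\<^sub>R ?G z" for z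
      using s by (cases z) (auto simp: indicator_def refl2_def obox_def punctured_box_def)
    qed
    have m: "?H \<sigma> \<tau> \<in> borel_measurable borel"
      unfolding eqH
    proof (rule borel_measurable_scaleR[OF _ g])
      have "(\<lambda>z. indicator (obox \<delta>) z :: real) \<in> borel_measurable borel" using open_obox by simp
      from measurable_compose[OF measurable_refl2 this]
      show "(\<lambda>z. indicator (obox \<delta>) (refl2 \<sigma> \<tau> z) :: real) \<in> borel_measurable borel" .
    qed
    have eq: "?H \<sigma> \<tau> (refl2 \<sigma> \<tau> z) = indicator (obox \<delta>) z *\<^sub>R g (refl2 \<sigma> \<tau> z)" for z
      using refl2_refl2[OF s] by simp
    show "integrable lborel (?H \<sigma> \<tau>)"
      using integral_refl2(1)[OF s m] int[OF st] unfolding eq set_integrable_def by simp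
    show "integral\<^sup>L lborel (?H \<sigma> \<tau>) = (LINT z:obox \<delta>|lborel. g (refl2 \<sigma> \<tau> z))"
      using integral_refl2(2)[OF s m] unfolding eq set_lebesgue_integral_def by simp
  qed
  have sum: "?G = (\<lambda>z. \<Sum>(\<sigma>, \<tau>)\<in>signs. ?H \<sigma> \<tau> z)"
    unfolding indicator_punctured_box by (simp add: scaleR_sum_left case_prod_unfold)
  show "integrable lborel ?G"
    unfolding sum by (intro Bochner_Integration.integrable_sum) (use H in auto)
  show "integral\<^sup>L lborel ?G = (\<Sum>(\<sigma>, \<tau>)\<in>signs. LINT z:obox \<delta>|lborel. g (refl2 \<sigma> \<tau> z))"
    unfolding sum using H by (subst Bochner_Integration.integral_sum) (auto intro!: sum.cong)
qed

section \<open>The main estimate\<close>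

text \<open>The restriction on one variable is dropped and the integral over that variable is the function
  described by the growth pair. By Fubini some section of the weight is integrable, which is the
  condition for the pair to exist; being unique, it is the one that the definite description
  denotes.\<close>
lemma growth_box_bound:
  assumes P: "finite P" "P \<noteq> {}" and \<delta>: "0 < \<delta>" "\<delta> < 1 / 2"
    and int: "set_integrable lborel (obox \<delta>) (\<lambda>z. weight P \<rho> (snd z) (fst z))"
    and gp: "(\<epsilon>, d) = (THE p. is_growth_pair (weight P \<rho>) p)"
  shows "\<exists>C>0. \<forall>l \<mu>. \<mu> \<le> \<delta> \<longrightarrow> (LINT z:{0<..<\<mu>} \<times> {0<..<cutoff \<delta> l}|lborel. weight P \<rho> (snd z) (fst z))
     \<le> C * (2 + \<bar>l\<bar>) powr (\<epsilon> - 1) * ln (2 + \<bar>l\<bar>) ^ d"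
proof -
  let ?J = "\<lambda>r. LINT s:{0<..<\<delta>}|lborel. weight P \<rho> r s"
  note F = lborel_set_Fubini[OF int[unfolded obox_def]]
  obtain r where r: "r \<in> {0<..<\<delta>}" "set_integrable lborel {0<..<\<delta>} (\<lambda>s. weight P \<rho> r s)"
    using AE_interval_witness[OF F(1) \<delta>(1)] by auto
  obtain a0 b0 where ab: "(a0, b0) \<in> P" "\<rho> * real b0 < 1"
    using integrable_imp_subcritical[OF P _ _ \<delta>(1) _ r(2)] r(1) \<delta> by auto
  obtain p where p: "is_growth_pair (weight P \<rho>) p" using growth_pair_exists[OF P(1) ab] by blast
  have "(THE p. is_growth_pair (weight P \<rho>) p) = p"
    by (rule the_equality, rule p, rule growth_pair_unique[OF _ p])
  then have gpe: "is_growth_pair (weight P \<rho>) (\<epsilon>, d)" using gp p by simp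
  have d: "d \<in> {0, 1}" using gpe by (auto simp: is_growth_pair_def)
  obtain c1 c2 where c: "c1 > 0" "c2 > 0" "\<And>r. 0 < r \<and> r < \<delta> \<Longrightarrow>
     c1 * r powr (- \<epsilon>) * \<bar>ln r\<bar> ^ d \<le> (LINT s:{0..\<delta>}|lebesgue. weight P \<rho> r s) \<and>
     (LINT s:{0..\<delta>}|lebesgue. weight P \<rho> r s) \<le> c2 * r powr (- \<epsilon>) * \<bar>ln r\<bar> ^ d"
    using gpe \<delta> unfolding is_growth_pair_def prod.case by blast
  have J: "(LINT s:{0..\<delta>}|lebesgue. weight P \<rho> r s) = ?J r" for r
    by (rule lebesgue_Icc_integral[OF measurable_weight_section])
  obtain C where C: "C > 0" "\<And>l. (LINT r:{0<..<cutoff \<delta> l}|lborel. ?J r) \<le> C * (2 + \<bar>l\<bar>) powr (\<epsilon> - 1) * ln (2 + \<bar>l\<bar>) ^ d"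
    using cutoff_integral_bound[OF \<delta> d c(1,2), of \<epsilon> ?J] c(3) F(2) unfolding J by auto
  show ?thesis
  proof (intro exI[of _ C] conjI allI impI C(1))
    fix l \<mu> :: real assume \<mu>: "\<mu> \<le> \<delta>"
    have cut: "cutoff \<delta> l \<le> \<delta>" by (rule cutoff_bounds(2))
    have int': "set_integrable lborel ({0<..<\<delta>} \<times> {0<..<cutoff \<delta> l}) (\<lambda>z. weight P \<rho> (snd z) (fst z))"
      by (rule set_integrable_subset[OF int]) (use cut in \<open>auto simp: obox_def open_Times intro!: borel_open\<close>)
    have "(LINT z:{0<..<\<mu>} \<times> {0<..<cutoff \<delta> l}|lborel. weight P \<rho> (snd z) (fst z))
       \<le> (LINT z:{0<..<\<delta>} \<times> {0<..<cutoff \<delta> l}|lborel. weight P \<rho> (snd z) (fst z))"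
      by (rule set_integral_pos_mono_set[OF int'])
         (use \<mu> in \<open>auto simp: weight_def open_Times intro!: borel_open\<close>)
    also have "\<dots> = (LINT r:{0<..<cutoff \<delta> l}|lborel. ?J r)"
      using lborel_set_Fubini(3)[OF int'] by simp
    finally show "(LINT z:{0<..<\<mu>} \<times> {0<..<cutoff \<delta> l}|lborel. weight P \<rho> (snd z) (fst z))
      \<le> C * (2 + \<bar>l\<bar>) powr (\<epsilon> - 1) * ln (2 + \<bar>l\<bar>) ^ d" using C(2)[of l] by linarith
  qed
qed

lemma lborel_set_swap:
  fixes g :: "real \<times> real \<Rightarrow> real"
  assumes g: "g \<in> borel_measurable borel" and AB: "open A" "open B"
  shows "set_integrable lborel (B \<times> A) (\<lambda>z. g (snd z, fst z)) \<longleftrightarrow> set_integrable lborel (A \<times> B) g"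
    and "(LINT z:B \<times> A|lborel. g (snd z, fst z)) = (LINT z:A \<times> B|lborel. g z)"
proof -
  let ?g = "\<lambda>z. indicator (A \<times> B) z *\<^sub>R g z"
  have eq: "indicator (B \<times> A) z *\<^sub>R g (snd z, fst z) = (case z of (x, y) \<Rightarrow> ?g (y, x))" for z
    by (cases z) (auto simp: indicator_def)
  have m: "?g \<in> borel_measurable (lborel \<Otimes>\<^sub>M lborel)"
    using g AB by (simp add: lborel_prod open_Times)
  show "set_integrable lborel (B \<times> A) (\<lambda>z. g (snd z, fst z)) \<longleftrightarrow> set_integrable lborel (A \<times> B) g"
    unfolding set_integrable_def eq lborel_prod[symmetric] by (rule lborel_pair.integrable_product_swap_iff)
  show "(LINT z:B \<times> A|lborel. g (snd z, fst z)) = (LINT z:A \<times> B|lborel. g z)"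
    unfolding set_lebesgue_integral_def eq lborel_prod[symmetric] by (rule lborel_pair.integral_product_swap[OF m])
qed

lemma weight_swap: "weight (prod.swap ` P) \<rho> r s = weight P \<rho> s r"
proof -
  have "(\<Sum>(a, b)\<in>prod.swap ` P. \<bar>r\<bar> ^ a * \<bar>s\<bar> ^ b) = (\<Sum>(a, b)\<in>P. \<bar>s\<bar> ^ a * \<bar>r\<bar> ^ b)"
    by (subst sum.reindex) (auto simp: inj_on_def case_prod_unfold mult.commute)
  then show ?thesis by (simp add: weight_def)
qed

text \<open>By the two-sided comparison the weight is integrable wherever the power of \<open>f\<close> is,
  first on a small box and then, by dilation, on the box of side \<open>\<delta>\<close>.\<close>
lemma vertex_weight_integrable:
  assumes S: "S \<noteq> {}" and \<delta>: "0 < \<delta>" "\<delta> \<le> R" and k: "k > 0"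
    and lower: "\<And>z. z \<in> punctured_box R \<Longrightarrow> k * vertex_sum S z \<le> \<bar>f z\<bar>"
    and upper: "\<And>z. z \<in> punctured_box R \<Longrightarrow> \<bar>f z\<bar> \<le> K * vertex_sum S z"
    and near: "integrable_near_origin (\<lambda>z. \<bar>f z\<bar> powr (- \<rho>))"
  shows "set_integrable lborel (obox \<delta>) (\<lambda>z. vertex_sum S z powr (- \<rho>))"
proof -
  obtain W where W: "open W" "(0, 0) \<in> W" "set_integrable lebesgue W (\<lambda>z. \<bar>f z\<bar> powr (- \<rho>))"
    using near by (auto simp: integrable_near_origin_def)
  obtain e where e: "e > 0" "ball (0, 0) e \<subseteq> W" using W(1,2) openE by blast
  define \<eta> where "\<eta> = min (e / 2) \<delta>"
  have \<eta>: "0 < \<eta>" "\<eta> \<le> \<delta>" using e \<delta> by (auto simp: \<eta>_def)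
  have sub: "obox \<eta> \<subseteq> W"
  proof
    fix z assume z: "z \<in> obox \<eta>"
    then have "norm (fst z) + norm (snd z) < e" by (auto simp: obox_def \<eta>_def)
    then have "norm z < e" using norm_Pair_le[of "fst z" "snd z"] by simp
    then show "z \<in> W" using e(2) by (auto simp: dist_norm norm_minus_commute zero_prod_def[symmetric])
  qed
  have meas: "obox \<eta> \<in> sets lebesgue" using open_obox by simp
  have int: "set_integrable lebesgue (obox \<eta>) (\<lambda>z. \<bar>f z\<bar> powr (- \<rho>))"
    by (rule set_integrable_subset[OF W(3) meas sub])
  define C where "C = max (\<bar>K\<bar> powr \<rho>) (k powr \<rho>)"
  have bd: "vertex_sum S z powr (- \<rho>) \<le> C * \<bar>f z\<bar> powr (- \<rho>)" if z: "z \<in> obox \<eta>" for z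
  proof -
    have zR: "z \<in> punctured_box R" using z \<eta> \<delta> by (auto simp: obox_def punctured_box_def)
    have v: "vertex_sum S z > 0"
      using vertex_sum_pos[OF S, of "fst z" "snd z"] z by (auto simp: obox_def)
    have fz: "0 < \<bar>f z\<bar>" using lower[OF zR] mult_pos_pos[OF k v] by linarith
    have Kp: "K > 0" using upper[OF zR] fz v by (smt (verit) mult_nonpos_nonneg)
    show ?thesis
    proof (cases "\<rho> \<ge> 0")
      case True
      have "\<bar>f z\<bar> / K \<le> vertex_sum S z" using upper[OF zR] Kp by (simp add: divide_le_eq mult.commute)
      then have "vertex_sum S z powr (- \<rho>) \<le> (\<bar>f z\<bar> / K) powr (- \<rho>)"
        using True fz Kp by (intro powr_mono2') auto
      also have "\<dots> = K powr \<rho> * \<bar>f z\<bar> powr (- \<rho>)" by (simp add: powr_divide powr_minus divide_simps)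
      also have "\<dots> \<le> C * \<bar>f z\<bar> powr (- \<rho>)" using Kp by (intro mult_right_mono) (auto simp: C_def)
      finally show ?thesis .
    next
      case False
      have "vertex_sum S z \<le> \<bar>f z\<bar> / k" using lower[OF zR] k by (simp add: le_divide_eq mult.commute)
      then have "vertex_sum S z powr (- \<rho>) \<le> (\<bar>f z\<bar> / k) powr (- \<rho>)"
        using False v by (intro powr_mono2) auto
      also have "\<dots> = k powr \<rho> * \<bar>f z\<bar> powr (- \<rho>)" by (simp add: powr_divide powr_minus divide_simps)
      also have "\<dots> \<le> C * \<bar>f z\<bar> powr (- \<rho>)" by (intro mult_right_mono) (auto simp: C_def)
      finally show ?thesis .
    qed
  qed
  have m: "(\<lambda>z. indicator (obox \<eta>) z *\<^sub>R vertex_sum S z powr (- \<rho>)) \<in> borel_measurable borel"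
    using measurable_vertex_weight[of S "- \<rho>"] open_obox by simp
  have "set_integrable lebesgue (obox \<eta>) (\<lambda>z. vertex_sum S z powr (- \<rho>))"
  proof (rule set_integrable_bound[OF set_integrable_mult_right[OF int, of C]])
    show "set_borel_measurable lebesgue (obox \<eta>) (\<lambda>z. vertex_sum S z powr (- \<rho>))"
      unfolding set_borel_measurable_def using m by (intro measurable_completion) simp
    show "AE z in lebesgue. z \<in> obox \<eta> \<longrightarrow> norm (vertex_sum S z powr (- \<rho>)) \<le> norm (C * \<bar>f z\<bar> powr (- \<rho>))"
      using bd by (intro AE_I2 impI) (auto intro: order_trans[OF _ abs_ge_self])
  qed
  then have "set_integrable lborel (obox \<eta>) (\<lambda>z. vertex_sum S z powr (- \<rho>))"
    unfolding set_integrable_def using m by (subst (asm) integrable_completion) auto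
  then show ?thesis by (rule integrable_obox_enlarge[OF \<eta> S])
qed

lemma open_punctured_box: "open (punctured_box \<delta>)"
proof -
  have "punctured_box \<delta> = ({-\<delta><..<\<delta>} - {0}) \<times> ({-\<delta><..<\<delta>} - {0})"
    by (auto simp: punctured_box_def)
  moreover have "open (({-\<delta><..<\<delta>} - {0}) \<times> ({-\<delta><..<\<delta>} - {0}))"
    by (intro open_Times open_Diff) auto
  ultimately show ?thesis by simp
qed

lemma negligible_axes: "negligible (- off_axes)"
proof -
  have "- off_axes = {z. z \<bullet> (1, 0) = 0} \<union> {z. z \<bullet> (0, 1) = 0}"
    by (auto simp: off_axes_def inner_Pair)
  moreover have "negligible {z::real \<times> real. z \<bullet> (1, 0) = 0}" "negligible {z::real \<times> real. z \<bullet> (0, 1) = 0}"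
    by (rule negligible_standard_hyperplane; simp add: Basis_prod_def)+
  ultimately show ?thesis by simp
qed

text \<open>The axes are a null set, so arbitrary values there are harmless for the completed measure.\<close>
lemma lebesgue_integral_off_axes:
  fixes g g' :: "real \<times> real \<Rightarrow> 'a::euclidean_space"
  assumes int: "integrable lborel g'" and eq: "\<And>z. z \<in> off_axes \<Longrightarrow> g z = g' z"
  shows "integrable lebesgue g" "integral\<^sup>L lebesgue g = integral\<^sup>L lborel g'"
proof -
  have m: "g' \<in> borel_measurable lborel" using int by simp
  have int': "integrable lebesgue g'" using integrable_completion[OF m] int by simp
  then have "g' absolutely_integrable_on UNIV" by (simp add: set_integrable_def)
  then have "g absolutely_integrable_on UNIV"
    by (rule absolutely_integrable_spike[OF _ negligible_axes]) (use eq in auto)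
  then show I: "integrable lebesgue g" by (simp add: set_integrable_def)
  have "AE z in lebesgue. z \<notin> - off_axes"
    using negligible_axes by (intro AE_not_in) (simp add: negligible_iff_null_sets)
  then have "AE z in lebesgue. g z = g' z" by eventually_elim (use eq in auto)
  then have "integral\<^sup>L lebesgue g = integral\<^sup>L lebesgue g'"
    using I int' by (intro integral_cong_AE) auto
  then show "integral\<^sup>L lebesgue g = integral\<^sup>L lborel g'" using integral_completion[OF m] by simp
qed

text \<open>The box in the first quadrant is one of the four quarters of the intersection of the dual box with
  the square.\<close>
lemma box_integral_le_dual_box:
  assumes \<delta>: "0 < \<delta>" and int: "set_integrable lborel (obox \<delta>) (\<lambda>z. vertex_sum S z powr (- \<rho>))"
  shows "(LINT z:{0<..<cutoff \<delta> l1} \<times> {0<..<cutoff \<delta> l2}|lborel. vertex_sum S z powr (- \<rho>))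
    \<le> (LINT z:({-\<delta><..<\<delta>} \<times> {-\<delta><..<\<delta>}) \<inter> dual_box l1 l2|lebesgue. vertex_sum S z powr (- \<rho>))"
proof -
  let ?w = "\<lambda>z. vertex_sum S z powr (- \<rho>)"
  let ?U = "{-\<delta><..<\<delta>} \<times> {-\<delta><..<\<delta>} :: (real \<times> real) set"
  let ?A = "{0<..<cutoff \<delta> l1} \<times> {0<..<cutoff \<delta> l2}"
  have even: "?w (refl2 \<sigma> \<tau> z) = ?w z" if "(\<sigma>, \<tau>) \<in> signs" for \<sigma> \<tau> z
  proof -
    have "\<bar>\<sigma>\<bar> = 1" "\<bar>\<tau>\<bar> = 1" using that by (auto simp: signs_def)
    then show ?thesis by (cases z) (simp add: refl2_def vertex_sum_eq abs_mult)
  qed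
  have m: "(\<lambda>z. indicator (punctured_box \<delta>) z *\<^sub>R ?w z) \<in> borel_measurable borel"
    using measurable_vertex_weight[of S "- \<rho>"] open_punctured_box by simp
  have "integrable lborel (\<lambda>z. indicator (punctured_box \<delta>) z *\<^sub>R ?w z)"
    by (rule punctured_box_integral(1)[OF m]) (use int even in simp)
  then have "integrable lebesgue (\<lambda>z. indicator ?U z *\<^sub>R ?w z)"
    by (rule lebesgue_integral_off_axes(1)) (auto simp: indicator_def punctured_box_def off_axes_def)
  then have U: "set_integrable lebesgue ?U ?w" by (simp add: set_integrable_def)
  have "open (dual_box l1 l2)"
  proof -
    have "dual_box l1 l2 = (if l1 = 0 then UNIV else {- 1 / \<bar>l1\<bar><..<1 / \<bar>l1\<bar>}) \<times> (if l2 = 0 then UNIV else {- 1 / \<bar>l2\<bar><..<1 / \<bar>l2\<bar>})"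
      by (auto simp: dual_box_def)
    then show ?thesis by (simp add: open_Times)
  qed
  then have UD: "open (?U \<inter> dual_box l1 l2)" by (intro open_Int open_Times) auto
  have int2: "set_integrable lebesgue (?U \<inter> dual_box l1 l2) ?w"
    by (rule set_integrable_subset[OF U]) (use UD in auto)
  have "(LINT z:?A|lborel. ?w z) = (LINT z:?A|lebesgue. ?w z)"
    unfolding set_lebesgue_integral_def
    by (rule integral_completion[symmetric])
       (use measurable_vertex_weight[of S "- \<rho>"] in \<open>simp add: borel_open open_Times\<close>)
  also have "\<dots> \<le> (LINT z:?U \<inter> dual_box l1 l2|lebesgue. ?w z)"
  proof (rule set_integral_pos_mono_set[OF int2])
    show "?A \<in> sets lebesgue" by (simp add: borel_open open_Times)
    show "?A \<subseteq> ?U \<inter> dual_box l1 l2"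
      by (auto simp: cutoff_def dual_box_def split: if_splits)
  qed auto
  finally show ?thesis .
qed

lemma osc_integrand_expi:
  "osc_integrand f \<rho> \<phi> l1 l2 z = of_real (\<phi> z * \<bar>f z\<bar> powr (- \<rho>)) * expi l1 (fst z) * expi l2 (snd z)"
  by (cases z) (simp add: osc_integrand_def expi_def exp_diff exp_minus divide_inverse mult_ac)

lemma expi_scale: "expi l (\<sigma> * x) = expi (\<sigma> * l) x"
  by (simp add: expi_def mult_ac)

lemma cutoff_sign: "\<sigma> \<in> {-1, 1} \<Longrightarrow> cutoff \<delta> (\<sigma> * l) = cutoff \<delta> l"
  by (auto simp: cutoff_def)

text \<open>On each quadrant the integrand is, after a reflection that only changes the signs of the
  frequencies, a function with Euler derivatives bounded by the weight. The constant depends on the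
  amplitude only through its bounds, because it enters through \<open>symb_amplitude\<close>.\<close>
lemma osc_integral_box_bound:
  assumes \<delta>: "0 < \<delta>" "\<delta> < R" "R \<le> 1" "R < r" and S: "S = {(i, j). c i j \<noteq> 0}" "S \<noteq> {}" and c: "pconv c r"
    and k: "k > 0" and lower: "\<And>z. z \<in> punctured_box R \<Longrightarrow> k * vertex_sum S z \<le> \<bar>psum c z\<bar>"
    and f: "\<And>x y. \<bar>x\<bar> < R \<Longrightarrow> \<bar>y\<bar> < R \<Longrightarrow> f (x, y) = psum c (x, y)"
    and int: "set_integrable lborel (obox \<delta>) (\<lambda>z. vertex_sum S z powr (- \<rho>))"
  shows "\<exists>T\<ge>0. \<forall>\<phi>. admissible_amplitude ({-\<delta><..<\<delta>} \<times> {-\<delta><..<\<delta>}) A B \<phi> \<longrightarrow>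
     (\<forall>l1 l2. integrable lebesgue (osc_integrand f \<rho> \<phi> l1 l2) \<and>
       cmod (osc_integral f \<rho> \<phi> l1 l2)
         \<le> T * (LINT z:{0<..<cutoff \<delta> l1} \<times> {0<..<cutoff \<delta> l2}|lborel. vertex_sum S z powr (- \<rho>)))"
proof -
  let ?w = "\<lambda>z. vertex_sum S z powr (- \<rho>)"
  let ?U = "{-\<delta><..<\<delta>} \<times> {-\<delta><..<\<delta>} :: (real \<times> real) set"
  have R: "0 < R" using \<delta> by simp
  obtain D where D: "\<And>a b. (a, b) \<in> vertices S \<Longrightarrow> a + b \<le> D" using vertex_degree_bound by blast
  \<comment> \<open>The weight is a power of degree at most \<open>\<bar>\<rho>\<bar> * D\<close> under
    dilations, hence moderate with this exponent.\<close>
  define M where "M = nat \<lceil>\<bar>\<rho>\<bar> * real D\<rceil>"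
  have M: "\<bar>\<rho>\<bar> * real D \<le> real M" by (simp add: M_def)
  \<comment> \<open>The number of derivatives that the two-dimensional bound consumes.\<close>
  define N where "N = 2 * M + 5"
  have v: "vertex_sum S z > 0" if "z \<in> punctured_box R" for z
    using vertex_sum_pos[OF S(2), of "fst z" "snd z"] that by (auto simp: punctured_box_def)
  obtain K0 where K0: "symb True N (punctured_box R) K0 (vertex_sum S) (psum c)"
    using symb_psum[OF c _ R \<delta>(4,3), of S True N] S(1) by blast
  obtain K1 where K1: "symb True N (punctured_box R) K1 ?w (\<lambda>z. \<bar>psum c z\<bar> powr (- \<rho>))"
    using symb_abs_powr[OF K0 v lower k] by blast
  obtain K2 where K2: "\<And>\<phi>. admissible_amplitude ?U A B \<phi> \<Longrightarrow> symb True N off_axes K2 (\<lambda>_. 1) \<phi>"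
    using symb_amplitude[of ?U A B 0 N 0] by (auto simp: partials_def)
  define K where "K = \<bar>2 ^ N * (K2 * K1)\<bar>"
  have sub: "punctured_box R \<subseteq> off_axes" by (auto simp: punctured_box_def off_axes_def)
  have prod: "symb True N (punctured_box R) K ?w (\<lambda>z. \<phi> z * \<bar>psum c z\<bar> powr (- \<rho>))"
    if "admissible_amplitude ?U A B \<phi>" for \<phi>
  proof -
    have "symb True N (punctured_box R) K2 (\<lambda>_. 1) \<phi>"
      by (rule symb_weaken[OF K2[OF that] _ sub]) simp
    from symb_mult[OF this K1] show ?thesis
      by (rule symb_weaken) (auto simp: K_def intro!: mult_right_mono)
  qed
  obtain C where C: "C \<ge> 0" "\<And>K w h R \<delta> l1 l2. 0 < \<delta> \<Longrightarrow> \<delta> < R \<Longrightarrow>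
     (\<forall>y\<in>{0<..<R}. moderate M R (\<lambda>x. w (x, y))) \<Longrightarrow> (\<forall>x\<in>{0<..<R}. moderate M R (\<lambda>y. w (x, y))) \<Longrightarrow>
     continuous_on (obox R) w \<Longrightarrow> set_integrable lborel (obox \<delta>) w \<Longrightarrow> symb True (2 * M + 5) (obox R) K w h \<Longrightarrow>
     (\<forall>x y. (x, y) \<in> obox R \<longrightarrow> \<delta> \<le> x \<or> \<delta> \<le> y \<longrightarrow> h (x, y) = 0) \<Longrightarrow>
     set_integrable lborel (obox \<delta>) (\<lambda>z. of_real (h z) * expi l1 (fst z) * expi l2 (snd z)) \<and>
     norm (LINT z:obox \<delta>|lborel. of_real (h z) * expi l1 (fst z) * expi l2 (snd z))
       \<le> C * K * (LINT z:{0<..<cutoff \<delta> l1} \<times> {0<..<cutoff \<delta> l2}|lborel. w z)"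
    using oscillatory_bound_2d[of M] by blast
  show ?thesis
  proof (intro exI[of _ "4 * (C * K)"] conjI allI impI)
    show "0 \<le> 4 * (C * K)" using C by (simp add: K_def)
    fix \<phi> l1 l2
    assume adm: "admissible_amplitude ?U A B \<phi>"
    have supp: "\<phi> z = 0" if "z \<notin> ?U" for z using adm that by (auto simp: admissible_amplitude_def)
    define h where "h z = \<phi> z * \<bar>psum c z\<bar> powr (- \<rho>)" for z
    have h: "symb True N (punctured_box R) K ?w h" unfolding h_def[abs_def] by (rule prod[OF adm])
    let ?I = "LINT z:{0<..<cutoff \<delta> l1} \<times> {0<..<cutoff \<delta> l2}|lborel. ?w z"
    define G where "G z = of_real (h z) * expi l1 (fst z) * expi l2 (snd z)" for z
    have G: "osc_integrand f \<rho> \<phi> l1 l2 z = G z" for z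
    proof (cases "z \<in> ?U")
      case True
      then have "f z = psum c z" using f[of "fst z" "snd z"] \<delta> by (cases z) auto
      then show ?thesis by (simp add: osc_integrand_expi G_def h_def)
    qed (simp add: osc_integrand_expi G_def h_def supp)
    have quad: "set_integrable lborel (obox \<delta>) (\<lambda>z. G (refl2 \<sigma> \<tau> z)) \<and>
        norm (LINT z:obox \<delta>|lborel. G (refl2 \<sigma> \<tau> z)) \<le> C * K * ?I" if st: "(\<sigma>, \<tau>) \<in> signs" for \<sigma> \<tau>
    proof -
      have s: "\<sigma> \<in> {-1, 1}" "\<tau> \<in> {-1, 1}" using st by (auto simp: signs_def)
      have abs: "\<bar>\<sigma>\<bar> = 1" "\<bar>\<tau>\<bar> = 1" using s by auto
      have hr: "symb True N (obox R) K ?w (\<lambda>z. h (refl2 \<sigma> \<tau> z))"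
      proof (rule symb_refl2[OF s h])
        show "refl2 \<sigma> \<tau> z \<in> punctured_box R" if "z \<in> obox R" for z
          using that s by (auto simp: refl2_def obox_def punctured_box_def abs_mult)
        show "?w (refl2 \<sigma> \<tau> z) = ?w z" for z
          using abs by (cases z) (simp add: refl2_def vertex_sum_eq abs_mult)
      qed
      have van: "h (refl2 \<sigma> \<tau> (x, y)) = 0" if "(x, y) \<in> obox R" "\<delta> \<le> x \<or> \<delta> \<le> y" for x y
      proof -
        have "refl2 \<sigma> \<tau> (x, y) \<notin> ?U" using that s \<delta> by (auto simp: refl2_def obox_def)
        then show ?thesis by (simp add: h_def supp)
      qed
      have Gr: "G (refl2 \<sigma> \<tau> z) = of_real (h (refl2 \<sigma> \<tau> z)) * expi (\<sigma> * l1) (fst z) * expi (\<tau> * l2) (snd z)" for z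
        unfolding G_def by (simp add: refl2_def expi_scale)
      have ob: "obox R \<subseteq> off_axes" by (auto simp: obox_def off_axes_def)
      have "set_integrable lborel (obox \<delta>) (\<lambda>z. of_real (h (refl2 \<sigma> \<tau> z)) * expi (\<sigma> * l1) (fst z) * expi (\<tau> * l2) (snd z)) \<and>
         norm (LINT z:obox \<delta>|lborel. of_real (h (refl2 \<sigma> \<tau> z)) * expi (\<sigma> * l1) (fst z) * expi (\<tau> * l2) (snd z))
         \<le> C * K * (LINT z:{0<..<cutoff \<delta> (\<sigma> * l1)} \<times> {0<..<cutoff \<delta> (\<tau> * l2)}|lborel. ?w z)"
      proof (rule C(2)[OF \<delta>(1,2) _ _ _ int])
        show "\<forall>y\<in>{0<..<R}. moderate M R (\<lambda>x. ?w (x, y))" "\<forall>x\<in>{0<..<R}. moderate M R (\<lambda>y. ?w (x, y))"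
          using moderate_vertex_weight[OF D M S(2)] by auto
        show "continuous_on (obox R) ?w" by (rule continuous_on_vertex_weight[OF S(2) ob])
        show "symb True (2 * M + 5) (obox R) K ?w (\<lambda>z. h (refl2 \<sigma> \<tau> z))" using hr by (simp only: N_def)
        show "\<forall>x y. (x, y) \<in> obox R \<longrightarrow> \<delta> \<le> x \<or> \<delta> \<le> y \<longrightarrow> h (refl2 \<sigma> \<tau> (x, y)) = 0" using van by blast
      qed
      then show ?thesis unfolding Gr cutoff_sign[OF s(1)] cutoff_sign[OF s(2)] .
    qed
    have mG: "(\<lambda>z. indicator (punctured_box \<delta>) z *\<^sub>R G z) \<in> borel_measurable borel"
    proof (rule borel_measurable_continuous_on_indicator)
      show "punctured_box \<delta> \<in> sets borel" using open_punctured_box by simp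
      have sb: "punctured_box \<delta> \<subseteq> punctured_box R" using \<delta> by (auto simp: punctured_box_def)
      show "continuous_on (punctured_box \<delta>) G"
        unfolding G_def
        by (intro continuous_intros continuous_on_subset[OF symb_cont[OF h] sb]
            continuous_on_compose2[OF continuous_on_expi[of UNIV]]) auto
    qed
    have off: "osc_integrand f \<rho> \<phi> l1 l2 z = indicator (punctured_box \<delta>) z *\<^sub>R G z" if "z \<in> off_axes" for z
    proof (cases "z \<in> ?U")
      case True
      then have "z \<in> punctured_box \<delta>" using that by (auto simp: punctured_box_def off_axes_def)
      then show ?thesis by (simp add: G)
    qed (simp add: G G_def h_def supp)
    have PI: "integrable lborel (\<lambda>z. indicator (punctured_box \<delta>) z *\<^sub>R G z)"
      "integral\<^sup>L lborel (\<lambda>z. indicator (punctured_box \<delta>) z *\<^sub>R G z) = (\<Sum>(\<sigma>, \<tau>)\<in>signs. LINT z:obox \<delta>|lborel. G (refl2 \<sigma> \<tau> z))"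
      using punctured_box_integral[OF mG] quad by blast+
    show "integrable lebesgue (osc_integrand f \<rho> \<phi> l1 l2)"
      by (rule lebesgue_integral_off_axes(1)[OF PI(1) off])
    have "osc_integral f \<rho> \<phi> l1 l2 = (\<Sum>(\<sigma>, \<tau>)\<in>signs. LINT z:obox \<delta>|lborel. G (refl2 \<sigma> \<tau> z))"
      unfolding osc_integral_def PI(2)[symmetric] by (rule lebesgue_integral_off_axes(2)[OF PI(1) off])
    also have "cmod \<dots> \<le> (\<Sum>(\<sigma>, \<tau>)\<in>signs. C * K * ?I)"
      unfolding case_prod_unfold by (rule sum_norm_le) (use quad in auto)
    also have "\<dots> = 4 * (C * K) * ?I"
      by (simp add: signs_def case_prod_unfold card_cartesian_product)
    finally show "cmod (osc_integral f \<rho> \<phi> l1 l2) \<le> 4 * (C * K) * ?I" .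
  qed
qed

lemma fstar_eq_vertex_sum:
  assumes "\<And>a b. taylor_coeff f a b = c a b" and S: "S = {(i, j). c i j \<noteq> 0}"
  shows "newton_polygon f = hull_quadrants S" "fstar f = vertex_sum S"
proof -
  show N: "newton_polygon f = hull_quadrants S"
    by (simp add: newton_polygon_def hull_quadrants_def S assms(1))
  show "fstar f = vertex_sum S"
    by (simp add: fstar_def vertex_sum_def vertices_def N fun_eq_iff)
qed

theorem theorem2p3:
  fixes f :: "real \<times> real \<Rightarrow> real" and V :: "(real \<times> real) set"
  assumes "open V" and "connected V" and "(0, 0) \<in> V"
    and "real_analytic_on f V"
    and "\<exists>z\<in>V. f z \<noteq> 0"
    and "f (0, 0) = 0"
    and "\<And>e z. e edge_of newton_polygon f \<Longrightarrow> compact e \<Longrightarrow> z \<in> off_axes \<Longrightarrow> edge_poly f e z \<noteq> 0"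
  shows "\<exists>U. open U \<and> (0, 0) \<in> U \<and> U \<subseteq> V \<and>
    (\<forall>\<rho>::real. integrable_near_origin (\<lambda>z. \<bar>f z\<bar> powr (- \<rho>)) \<longrightarrow>
      (\<forall>\<epsilon>1 d1 \<epsilon>2 d2. (\<epsilon>1, d1) = growth_pair1 f \<rho> \<longrightarrow> (\<epsilon>2, d2) = growth_pair2 f \<rho> \<longrightarrow>
        (\<forall>(A::real) (B::nat \<Rightarrow> nat \<Rightarrow> real). \<exists>C::real. \<forall>\<phi>. admissible_amplitude U A B \<phi> \<longrightarrow>
          (\<forall>l1 l2.
            integrable lebesgue (osc_integrand f \<rho> \<phi> l1 l2) \<and>
            cmod (osc_integral f \<rho> \<phi> l1 l2)
              < C * (2 + \<bar>l1\<bar>) powr (\<epsilon>1 - 1) * ln (2 + \<bar>l1\<bar>) ^ d1 \<and>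
            cmod (osc_integral f \<rho> \<phi> l1 l2)
              < C * (2 + \<bar>l2\<bar>) powr (\<epsilon>2 - 1) * ln (2 + \<bar>l2\<bar>) ^ d2 \<and>
            cmod (osc_integral f \<rho> \<phi> l1 l2)
              \<le> C * (LINT z:U \<inter> dual_box l1 l2|lebesgue. fstar f z powr (- \<rho>))))))"
proof -
  obtain c r where r: "r > 0" and c: "\<And>h k. \<bar>h\<bar> < r \<and> \<bar>k\<bar> < r \<Longrightarrow>
      ((\<lambda>(a, b). c a b * h ^ a * k ^ b) has_sum f (0 + h, 0 + k)) UNIV"
    using assms(3,4) unfolding real_analytic_on_def by blast
  have conv: "pconv c r" using c by (auto simp: pconv_def summable_on_def)
  have fc: "f (x, y) = psum c (x, y)" if "\<bar>x\<bar> < r" "\<bar>y\<bar> < r" for x y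
    using c[of x y] that by (simp add: psum_def infsumI)
  define S where "S = {(i, j). c i j \<noteq> 0}"
  have tc: "taylor_coeff f a b = c a b" for a b by (rule taylor_coeff_psum[OF conv r fc])
  note NS = fstar_eq_vertex_sum[OF tc S_def]
  obtain e where e: "e > 0" "ball (0, 0) e \<subseteq> V" using assms(1,3) openE by blast
  have inV: "{-\<delta><..<\<delta>} \<times> {-\<delta><..<\<delta>} \<subseteq> V" if "\<delta> \<le> e / 2" for \<delta>
  proof
    fix z assume "z \<in> {-\<delta><..<\<delta>} \<times> {-\<delta><..<\<delta>}"
    then have "\<bar>fst z\<bar> + \<bar>snd z\<bar> < e" using that by (cases z) auto
    then have "norm z < e" using norm_Pair_le[of "fst z" "snd z"] by simp
    then show "z \<in> V" using e(2) by (auto simp: dist_norm norm_minus_commute zero_prod_def[symmetric])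
  qed
  show ?thesis
  proof (cases "S = {}")
    case True
    define \<delta> where "\<delta> = min r (e / 2)"
    have \<delta>: "0 < \<delta>" "\<delta> \<le> e / 2" "\<delta> \<le> r" using r e by (auto simp: \<delta>_def)
    let ?U = "{-\<delta><..<\<delta>} \<times> {-\<delta><..<\<delta>} :: (real \<times> real) set"
    have f0: "f z = 0" if "z \<in> ?U" for z
    proof -
      have "c = (\<lambda>_ _. 0)" using True by (auto simp: S_def fun_eq_iff)
      then show ?thesis using fc[of "fst z" "snd z"] that \<delta> by (cases z) (auto simp: psum_def case_prod_unfold)
    qed
    have osc0: "osc_integrand f \<rho> \<phi> l1 l2 = (\<lambda>_. 0)" if "admissible_amplitude ?U A B \<phi>" for \<rho> \<phi> l1 l2 A B
    proof
      fix z show "osc_integrand f \<rho> \<phi> l1 l2 z = 0"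
      proof (cases "z \<in> ?U")
        case False
        then have "\<phi> z = 0" using that by (auto simp: admissible_amplitude_def)
        then show ?thesis by (simp add: osc_integrand_expi)
      qed (simp add: osc_integrand_expi f0)
    qed
    have nonneg: "0 \<le> (LINT z:?U \<inter> dual_box l1 l2|lebesgue. fstar f z powr (- \<rho>))" for l1 l2 \<rho>
      unfolding set_lebesgue_integral_def by (rule integral_nonneg_AE) auto
    show ?thesis
    proof (rule exI[of _ ?U], intro conjI allI impI)
      show "open ?U" by (simp add: open_Times)
      show "(0, 0) \<in> ?U" using \<delta> by simp
      show "?U \<subseteq> V" by (rule inV[OF \<delta>(2)])
      fix \<rho> \<epsilon>1 \<epsilon>2 A :: real and d1 d2 B
      show "\<exists>C::real. \<forall>\<phi>. admissible_amplitude ?U A B \<phi> \<longrightarrow>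
          (\<forall>l1 l2.
            integrable lebesgue (osc_integrand f \<rho> \<phi> l1 l2) \<and>
            cmod (osc_integral f \<rho> \<phi> l1 l2) < C * (2 + \<bar>l1\<bar>) powr (\<epsilon>1 - 1) * ln (2 + \<bar>l1\<bar>) ^ d1 \<and>
            cmod (osc_integral f \<rho> \<phi> l1 l2) < C * (2 + \<bar>l2\<bar>) powr (\<epsilon>2 - 1) * ln (2 + \<bar>l2\<bar>) ^ d2 \<and>
            cmod (osc_integral f \<rho> \<phi> l1 l2) \<le> C * (LINT z:?U \<inter> dual_box l1 l2|lebesgue. fstar f z powr (- \<rho>)))"
        by (rule exI[of _ 1]) (use nonneg in \<open>auto simp: osc0 osc_integral_def\<close>)
    qed
  next
    case False
    have edges: "(case z of (x, y) \<Rightarrow> \<Sum>(a, b) | (real a, real b) \<in> e. c a b * x ^ a * y ^ b) \<noteq> 0"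
      if "e edge_of hull_quadrants S" "compact e" "z \<in> off_axes" for e z
      using assms(7)[OF _ that(2,3)] that(1) unfolding NS(1) edge_poly_def tc by simp
    obtain k where k: "k > 0" and low: "\<And>x y. 0 < \<bar>x\<bar> \<Longrightarrow> \<bar>x\<bar> < k \<Longrightarrow> 0 < \<bar>y\<bar> \<Longrightarrow> \<bar>y\<bar> < k \<Longrightarrow>
        k * vertex_sum S (x, y) \<le> \<bar>psum c (x, y)\<bar>"
      using nondegenerate_lower_bound[OF conv r S_def edges False] by blast
    \<comment> \<open>The comparison with the vertex sum holds on the square of half-width
      \<open>R\<close>; amplitudes are supported in the square of half-width
      \<open>\<delta> < R\<close>, which leaves a margin beyond the support. Half-width
      below \<open>1 / 2\<close> is the range of the growth estimates.\<close>
    define R where "R = min (min k (r / 2)) (min (1 / 2) (e / 2))"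
    have R: "0 < R" "R \<le> k" "R < r" "R \<le> 1 / 2" "R \<le> 1" "R \<le> e / 2" using k r e by (auto simp: R_def)
    define \<delta> where "\<delta> = R / 2"
    have \<delta>: "0 < \<delta>" "\<delta> < R" "\<delta> < 1 / 2" "\<delta> \<le> e / 2" "\<delta> \<le> R" using R by (auto simp: \<delta>_def)
    let ?U = "{-\<delta><..<\<delta>} \<times> {-\<delta><..<\<delta>} :: (real \<times> real) set"
    have lower: "k * vertex_sum S z \<le> \<bar>psum c z\<bar>" if "z \<in> punctured_box R" for z
      using low[of "fst z" "snd z"] that R by (auto simp: punctured_box_def)
    have fR: "f (x, y) = psum c (x, y)" if "\<bar>x\<bar> < R" "\<bar>y\<bar> < R" for x y using fc[of x y] that R by simp
    obtain K where K: "\<And>z. z \<in> punctured_box R \<Longrightarrow> \<bar>psum c z\<bar> \<le> K * vertex_sum S z"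
      using psum_le_vertex_sum[OF conv _ R(1,3,5), of S] by (auto simp: S_def)
    have fpsum: "f z = psum c z" if "z \<in> punctured_box R" for z
      using fR[of "fst z" "snd z"] that by (auto simp: punctured_box_def)
    have Vne: "vertices S \<noteq> {}"
      using exists_minimising_vertex[of 1 1 S] False by (metis empty_iff zero_less_one)
    show ?thesis
    proof (rule exI[of _ ?U], intro conjI allI impI)
      show "open ?U" by (simp add: open_Times)
      show "(0, 0) \<in> ?U" using \<delta> by simp
      show "?U \<subseteq> V" by (rule inV[OF \<delta>(4)])
      fix \<rho> \<epsilon>1 \<epsilon>2 A :: real and d1 d2 B
      assume near: "integrable_near_origin (\<lambda>z. \<bar>f z\<bar> powr (- \<rho>))"
        and g1: "(\<epsilon>1, d1) = growth_pair1 f \<rho>" and g2: "(\<epsilon>2, d2) = growth_pair2 f \<rho>"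
      let ?w = "\<lambda>z. vertex_sum S z powr (- \<rho>)"
      let ?P = "vertices S" and ?P' = "prod.swap ` vertices S"
      have w1: "weight ?P \<rho> x y = ?w (x, y)" for x y by (simp add: weight_def vertex_sum_eq)
      have int: "set_integrable lborel (obox \<delta>) ?w"
        by (rule vertex_weight_integrable[OF False \<delta>(1,5) k _ _ near]) (use lower K fpsum in auto)
      have mw: "?w \<in> borel_measurable borel" by (rule measurable_vertex_weight)
      have int1: "set_integrable lborel (obox \<delta>) (\<lambda>z. weight ?P \<rho> (snd z) (fst z))"
        unfolding w1 obox_def using lborel_set_swap(1)[OF mw, of "{0<..<\<delta>}" "{0<..<\<delta>}"] int
        by (simp add: obox_def)
      have int2: "set_integrable lborel (obox \<delta>) (\<lambda>z. weight ?P' \<rho> (snd z) (fst z))"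
        unfolding weight_swap w1 using int by simp
      have gp1: "(\<epsilon>1, d1) = (THE p. is_growth_pair (weight ?P \<rho>) p)"
        using g1 unfolding growth_pair1_def NS(2) by (simp add: w1[abs_def])
      have gp2: "(\<epsilon>2, d2) = (THE p. is_growth_pair (weight ?P' \<rho>) p)"
        using g2 unfolding growth_pair2_def NS(2) by (simp add: weight_swap[abs_def] w1)
      obtain C1 where C1: "C1 > 0" "\<And>l \<mu>. \<mu> \<le> \<delta> \<Longrightarrow>
          (LINT z:{0<..<\<mu>} \<times> {0<..<cutoff \<delta> l}|lborel. weight ?P \<rho> (snd z) (fst z))
            \<le> C1 * (2 + \<bar>l\<bar>) powr (\<epsilon>1 - 1) * ln (2 + \<bar>l\<bar>) ^ d1"
        using growth_box_bound[OF finite_vertices Vne \<delta>(1,3) int1 gp1] by blast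
      obtain C2 where C2: "C2 > 0" "\<And>l \<mu>. \<mu> \<le> \<delta> \<Longrightarrow>
          (LINT z:{0<..<\<mu>} \<times> {0<..<cutoff \<delta> l}|lborel. weight ?P' \<rho> (snd z) (fst z))
            \<le> C2 * (2 + \<bar>l\<bar>) powr (\<epsilon>2 - 1) * ln (2 + \<bar>l\<bar>) ^ d2"
        using growth_box_bound[OF finite_imageI[OF finite_vertices] _ \<delta>(1,3) int2 gp2] Vne by blast
      obtain T where T: "T \<ge> 0" "\<And>\<phi> l1 l2. admissible_amplitude ?U A B \<phi> \<Longrightarrow>
          integrable lebesgue (osc_integrand f \<rho> \<phi> l1 l2) \<and>
          cmod (osc_integral f \<rho> \<phi> l1 l2)
            \<le> T * (LINT z:{0<..<cutoff \<delta> l1} \<times> {0<..<cutoff \<delta> l2}|lborel. ?w z)"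
        using osc_integral_box_bound[OF \<delta>(1,2) R(5,3) S_def False conv k lower fR int, of A B] by blast
      \<comment> \<open>\<open>T * C1\<close>, \<open>T * C2\<close> and \<open>T\<close> are the
        constants of the three estimates; adding 1 makes the first two strict even if
        \<open>T = 0\<close>.\<close>
      define C where "C = T * (C1 + C2 + 1) + 1"
      show "\<exists>C::real. \<forall>\<phi>. admissible_amplitude ?U A B \<phi> \<longrightarrow>
          (\<forall>l1 l2.
            integrable lebesgue (osc_integrand f \<rho> \<phi> l1 l2) \<and>
            cmod (osc_integral f \<rho> \<phi> l1 l2) < C * (2 + \<bar>l1\<bar>) powr (\<epsilon>1 - 1) * ln (2 + \<bar>l1\<bar>) ^ d1 \<and>
            cmod (osc_integral f \<rho> \<phi> l1 l2) < C * (2 + \<bar>l2\<bar>) powr (\<epsilon>2 - 1) * ln (2 + \<bar>l2\<bar>) ^ d2 \<and>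
            cmod (osc_integral f \<rho> \<phi> l1 l2) \<le> C * (LINT z:?U \<inter> dual_box l1 l2|lebesgue. fstar f z powr (- \<rho>)))"
      proof (rule exI[of _ C], intro allI impI)
        fix \<phi> l1 l2 assume adm: "admissible_amplitude ?U A B \<phi>"
        let ?I = "LINT z:{0<..<cutoff \<delta> l1} \<times> {0<..<cutoff \<delta> l2}|lborel. ?w z"
        let ?X1 = "(2 + \<bar>l1\<bar>) powr (\<epsilon>1 - 1) * ln (2 + \<bar>l1\<bar>) ^ d1"
        let ?X2 = "(2 + \<bar>l2\<bar>) powr (\<epsilon>2 - 1) * ln (2 + \<bar>l2\<bar>) ^ d2"
        let ?Q = "LINT z:?U \<inter> dual_box l1 l2|lebesgue. fstar f z powr (- \<rho>)"
        have X: "?X1 > 0" "?X2 > 0" by auto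
        have F: "cmod (osc_integral f \<rho> \<phi> l1 l2) \<le> T * ?I" using T(2)[OF adm] by blast
        have "(LINT z:{0<..<cutoff \<delta> l2} \<times> {0<..<cutoff \<delta> l1}|lborel. ?w (snd z, fst z)) = ?I"
          by (rule lborel_set_swap(2)[OF mw]) auto
        then have I1: "?I \<le> C1 * ?X1"
          using C1(2)[of "cutoff \<delta> l2" l1] cutoff_bounds(2)[of \<delta> l2] by (simp add: w1 mult.assoc)
        have I2: "?I \<le> C2 * ?X2"
          using C2(2)[of "cutoff \<delta> l1" l2] cutoff_bounds(2)[of \<delta> l1] by (simp add: weight_swap w1 mult.assoc)
        have I3: "?I \<le> ?Q"
          unfolding NS(2) by (rule box_integral_le_dual_box[OF \<delta>(1) int])
        have I0: "0 \<le> ?I" unfolding set_lebesgue_integral_def by (rule integral_nonneg_AE) auto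
        have strict: "cmod (osc_integral f \<rho> \<phi> l1 l2) < C * X" if "0 < X" "?I \<le> C' * X" "C' \<le> C1 + C2 + 1" for C' X
        proof -
          have "T * ?I \<le> T * (C' * X)" using T(1) that by (intro mult_left_mono) auto
          also have "\<dots> \<le> T * ((C1 + C2 + 1) * X)" using T(1) that by (intro mult_left_mono mult_right_mono) auto
          also have "\<dots> < C * X" using that by (simp add: C_def algebra_simps)
          finally show ?thesis using F by linarith
        qed
        have "T * ?I \<le> T * ?Q" using T(1) I3 by (intro mult_left_mono) auto
        also have "\<dots> \<le> C * ?Q"
        proof (rule mult_right_mono)
          have "T * 1 \<le> T * (C1 + C2 + 1)" using T(1) C1(1) C2(1) by (intro mult_left_mono) auto
          then show "T \<le> C" by (simp add: C_def)
        qed (use I0 I3 in linarith)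
        finally have third: "cmod (osc_integral f \<rho> \<phi> l1 l2) \<le> C * ?Q" using F by linarith
        show "integrable lebesgue (osc_integrand f \<rho> \<phi> l1 l2) \<and>
            cmod (osc_integral f \<rho> \<phi> l1 l2) < C * (2 + \<bar>l1\<bar>) powr (\<epsilon>1 - 1) * ln (2 + \<bar>l1\<bar>) ^ d1 \<and>
            cmod (osc_integral f \<rho> \<phi> l1 l2) < C * (2 + \<bar>l2\<bar>) powr (\<epsilon>2 - 1) * ln (2 + \<bar>l2\<bar>) ^ d2 \<and>
            cmod (osc_integral f \<rho> \<phi> l1 l2) \<le> C * (LINT z:?U \<inter> dual_box l1 l2|lebesgue. fstar f z powr (- \<rho>))"
          using T(2)[OF adm] strict[OF X(1) I1] strict[OF X(2) I2] third C1(1) C2(1) by (simp add: mult.assoc)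
      qed
    qed
  qed
qed

end
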